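(* Let $F$ be an FCP specification satisfying the normal form assumptions below, and $N(F)$ its Petri net translation. Then the transition system $\mathcal{T}(F)=(\mathcal{R}(F)/_\equiv,\rightsquigarrow,[F])$ and the full transition system $\mathcal{T}(N(F))=(\mathcal{R}(N(F)),\rightarrow,M_0)$ of the net are weakly bisimilar, taking the relation $\mathcal{R}$ defined below as the weak bisimulation.
   Context: \textbf{Petri nets.} A Petri net is $N=(P,T,F,M_0)$ with disjoint places $P$ and transitions $T$, flow $F\subseteq(P\times T)\cup(T\times P)$, initial marking $M_0:P\to\mathbb{N}$. Transition $t$ is enabled at $M$ if $M(p)>0$ for all $p$ with $(p,t)\in F$; firing gives $M'(p)=M(p)-F(p,t)+F(t,p)$ (writing $M\rightarrow M'$). A "test" of place $p$ by $t$ means both arcs $(p,t),(t,p)$. $\mathcal{R}(N)$ is the set of reachable markings. Weak bisimilarity of two unlabelled transition systems means a relation containing the pair of initial states such that each step of one side from a related pair is matched by zero or more steps of the other side reaching a related pair. \textbf{FCPs.} Prefixes: $\overline{a}\langle b\rangle$ (send $b$ on $a$), $a(x)$ (receive into $x$), $\tau$. Threads: $S::=K\lfloor\tilde a\rfloor\mid\sum_{i\in I}\pi_i.S_i\mid\nu r.S$, where each process identifier $K$ has a defining equation $K(\tilde f):=S$ with distinct formal parameters. An FCP is $\nu\tilde r.(S_1\mid\dots\mid S_n)$. Structural congruence $\equiv$ is the smallest congruence with $\alpha$-conversion of bound names, $\mid$ associative and commutative with unit $0$ (the empty sum), $\nu r.0\equiv0$, $\nu r_1.\nu r_2.P\equiv\nu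 r_2.\nu r_1.P$, $\nu r.(P_1\mid P_2)\equiv P_1\mid\nu r.P_2$ if $r\notin fn(P_1)$. The reaction relation $\rightarrow$ is generated by $\tau.S+\dots\rightarrow S$; $K\lfloor\tilde a\rfloor\rightarrow S\{\tilde a/\tilde f\}$ if $K(\tilde f):=S$; $x(y).S_1+\dots\mid\overline{x}\langle z\rangle.S_2+\dots\rightarrow S_1\{z/y\}\mid S_2$; closed under $\mid$, $\nu$, $\equiv$. $\mathcal{R}(F)$ is the set of processes reachable from $F$, and $[F_1]\rightsquigarrow[F_2]$ iff $F_1\rightarrow F_2$ ($[\cdot]$ = $\equiv$-class). \textbf{Normal form assumptions.} Names are partitioned into $\mathit{RESTR}$ (bound by $\nu$), $\mathit{INP}$ (bound by input), $\mathit{FRM}$ (formal parameters), $\mathit{PUB}$ (the rest); every name is bound at most once, these sets are disjoint, and substitutions never clash with bound names. Different threads call disjoint sets of identifiers; no defining equation calls its own identifier; for $K(\tilde f):=S$, $fn(S)=\tilde f$. $F=\nu\tilde r.(S_{init,1}\sigma_1\mid\dots\mid S_{init,n}\sigma_n)$ where $K_{init,i}(\tilde f_{init,i}):=S_{init,i}$ are defining equations, $S_{init,i}$ are choices or calls, $\sigma_i:\tilde f_{init,i}\to\tilde r\cup\mathit{PUB}$; $0$ does not occur; in $x(y).S$ we have $y\in fn(S)$ and in $\nu r.S$ we have $r\in fn(S)$. $\mathit{NEW}$ is a set of fresh names with $|\mathit{NEW}|=|\mathit{RESTR}|+|\mathit{INP}|+|\mathit{FRM}|$. \textbf{Substitution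 net $N_{\mathit{subst}}$.} Places (no transitions): $[x=p]$ for $x\in\mathit{INP}\cup\mathit{FRM}$, $p\in\mathit{PUB}$; $[x=n]$ for $x\in\mathit{INP}\cup\mathit{FRM}\cup\mathit{RESTR}$, $n\in\mathit{NEW}$; $[x\neq n]$ for $x\in\mathit{INP}\cup\mathit{FRM}\cup\{r_*\}$, $n\in\mathit{NEW}$. A substitution marking $M$ satisfies: for all $n\in\mathit{NEW}$, $M([r_*\neq n])+\sum_{r\in\mathit{RESTR}}M([r=n])=1$; for all $x$, $\sum_{a}M([x=a])\le1$; for $x\in\mathit{INP}\cup\mathit{FRM}$, $n\in\mathit{NEW}$, $M([x=n])+M([x\neq n])=1$. Given $\sigma:(\mathit{INP}'\cup\mathit{FRM}'\to\mathit{PUB}\cup\tilde r)\cup(\mathit{RESTR}'\to\tilde r)$ (subsets of the respective sets, second part injective, $\tilde r$ names outside $\mathit{PUB}$), $M$ corresponds to $\sigma$ if: $M([x=a])=0$ for all $x\notin dom(\sigma)$ and all $a$; $M([x=\sigma(x)])=1$ if $\sigma(x)\in\mathit{PUB}$; if $\sigma(x)\in\tilde r$ there is $n\in\mathit{NEW}$ with $M([x=n])=1$; and for $x,y$ with $\sigma(x),\sigma(y)\in\tilde r$: $\sigma(x)=\sigma(y)$ iff $M([x=n])=M([y=n])$ for all $n\in\mathit{NEW}$ (missing places count as $0$). \textbf{Control flow nets.} Augmented processes are pairs $(S,\lambda)$, $S$ a thread, $\lambda$ a sequence of names. Transitions carry a label in $\{\tau,\mathit{send}(a,b),\mathit{rec}(a,b)\}$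 and a set of commands $\mathit{map}(x,b),\mathit{unmap}(x,b),\mathit{test}[x=b]$ ($a,b\in\mathit{PUB}\cup\mathit{NEW}$): (ν) $(\nu r.S,\lambda)\to(S,\lambda)$, label $\tau$, commands $\{\mathit{map}(r,n)\}$, for each $n\in\mathit{NEW}$; (τ) $(\tau.S+\dots,\lambda)\to(S,\lambda\lambda')$, label $\tau$, no commands; (snd) $(\overline x\langle y\rangle.S+\dots,\lambda)\to(S,\lambda\lambda')$, label $\mathit{send}(a,b)$, commands $\{\mathit{test}[x=a],\mathit{test}[y=b]\}$, for all $a,b$; (rec) $(x(y).S+\dots,\lambda)\to(S,\lambda\lambda')$, label $\mathit{rec}(a,b)$, commands $\{\mathit{test}[x=a],\mathit{map}(y,b)\}$, for all $a,b$; where $\lambda'$ lists (in a fixed order) $fn$ of the choice minus $fn(S)$; (call1) for $K(f_1,\dots,f_k):=S$ and $m\ge1$: $(K\lfloor x_1..x_m\rfloor,\lambda)\to(K\lfloor x_1..x_{m-1}\rfloor,\lambda'')$, label $\tau$, commands $\{\mathit{test}[x_m=a],\mathit{map}(f_m,a)\}$, for each $a$, with $\lambda''=\lambda$ if $x_m\in\lambda$ else $\lambda\cdot x_m$; (call2) $(K\lfloor-\rfloor,x\lambda)\to(K\lfloor-\rfloor,\lambda)$, label $\tau$, commands $\{\mathit{unmap}(x,a)\}$, for each $a$; (call3) $(K\lfloor-\rfloor,\varepsilon)\to(S,\varepsilon)$, label $\tau$, no commands. $N(S_{init,i})$ has as places the augmented processes reachable from $(S_{init,i},\varepsilon)$,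 these transitions (one input, one output place each), and one token on $(S_{init,i},\varepsilon)$. \textbf{Composition.} Parallel composition of $N(S_{init,1}),\dots,N(S_{init,n})$: disjoint union plus, for each pair of transitions $t_1,t_2$ in different components with labels $\mathit{send}(a,b)$ and $\mathit{rec}(a,b)$, a new transition $(t_1,t_2)$ with the union of their pre- and postsets, label $\tau$, union of commands. Hiding removes all transitions not labelled $\tau$. $N(F)$ is obtained by placing $N_{\mathit{subst}}$ (initially marked with a substitution marking corresponding to $\sigma_1\cup\dots\cup\sigma_n$) next to the result and implementing commands of each transition $t$: $\mathit{test}[x=b]$: test $[x=b]$; $\mathit{map}(x,p)$, $p\in\mathit{PUB}$: arc $t\to[x=p]$; $\mathit{map}(x,n)$, $x\in\mathit{INP}\cup\mathit{FRM}$, $n\in\mathit{NEW}$: arcs $t\to[x=n]$, $[x\neq n]\to t$; $\mathit{map}(r,n)$, $r\in\mathit{RESTR}$: arcs $[r_*\neq n]\to t$, $t\to[r=n]$ and tests of $[x\neq n]$ for all $x\in\mathit{INP}\cup\mathit{FRM}$; $\mathit{unmap}(x,a)$: arc $[x=a]\to t$ and, if $a\in\mathit{NEW}$, arc $t\to[x\neq a]$ (for $x\in\mathit{INP}\cup\mathit{FRM}$) or $t\to[r_*\neq a]$ (for $x\in\mathit{RESTR}$). \textbf{Stability.} A place $(S,\lambda)$ of a control flow net is stable if $S$ is a choice or a call $K\lfloor\tilde x\rfloor$ with its full parameter list; a marking of $N(F)$ is stable if it marks a stable place in every control flow net. \textbf{The relation $\mathcal{R}$.} $([G],M_1\cup M_2)\in\mathcal{R}$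 (with $M_1$ the marking of $N_{\mathit{subst}}$ and $M_2$ the control flow marking, $M_1\cup M_2$ stable and reachable, $G$ reachable from $F$) iff $G\equiv\nu\tilde r.(S_1\sigma_1\mid\dots\mid S_n\sigma_n)$ where each $S_i$ is a choice or call derived from the body $S$ of some defining equation, i.e. $(S,\varepsilon)$ reaches $(S_i,\lambda_i)$ by control flow transitions with no intermediate process a call, each $\sigma_i:fn(S_i)\cup\lambda_i\to\tilde r\cup\mathit{PUB}$, $M_1$ corresponds to $\sigma_1\cup\dots\cup\sigma_n$, and $M_2((S_i,\lambda_i))=1$ for all $i$.
   Formalization: R relates only stable markings, so it is not itself a weak bisimulation on the full system; proved instead: ([F],M_0) is in R, and R closed under completing pending ν-allocations and calls is one, equal to R on stable, derived markings. A thread's identifiers include K_init and indirect calls. *)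

theory Defs
  imports Main
begin

section \<open>Transition systems and weak bisimulation\<close>

record 's tsys =
  states :: "'s set"
  steps :: "('s \<times> 's) set"
  start :: 's

definition weak_bisimulation :: "'s tsys \<Rightarrow> 't tsys \<Rightarrow> ('s \<times> 't) set \<Rightarrow> bool" where
  "weak_bisimulation A B Q \<longleftrightarrow>
     Q \<subseteq> states A \<times> states B \<and>
     (start A, start B) \<in> Q \<and>
     (\<forall>s t. (s, t) \<in> Q \<longrightarrow>
        (\<forall>s'. (s, s') \<in> steps A \<longrightarrow> (\<exists>t'. (t, t') \<in> (steps B)\<^sup>* \<and> (s', t') \<in> Q)) \<and>
        (\<forall>t'. (t, t') \<in> steps B \<longrightarrow> (\<exists>s'. (s, s') \<in> (steps A)\<^sup>* \<and> (s', t') \<in> Q)))"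

section \<open>Petri nets\<close>

text \<open>The flow relation is split into its two halves: \<open>flow_pt\<close> for the arcs from places to
  transitions and \<open>flow_tp\<close> for the arcs from transitions to places.\<close>

record ('p, 't) petri_net =
  places :: "'p set"
  transitions :: "'t set"
  flow_pt :: "('p \<times> 't) set"
  flow_tp :: "('t \<times> 'p) set"
  init_marking :: "'p \<Rightarrow> nat"

definition enabled :: "('p, 't) petri_net \<Rightarrow> ('p \<Rightarrow> nat) \<Rightarrow> 't \<Rightarrow> bool" where
  "enabled N M t \<longleftrightarrow> t \<in> transitions N \<and> (\<forall>p. (p, t) \<in> flow_pt N \<longrightarrow> M p > 0)"

definition fire :: "('p, 't) petri_net \<Rightarrow> ('p \<Rightarrow> nat) \<Rightarrow> 't \<Rightarrow> 'p \<Rightarrow> nat" where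
  "fire N M t = (\<lambda>p. M p - of_bool ((p, t) \<in> flow_pt N) + of_bool ((t, p) \<in> flow_tp N))"

definition net_steps :: "('p, 't) petri_net \<Rightarrow> (('p \<Rightarrow> nat) \<times> ('p \<Rightarrow> nat)) set" where
  "net_steps N = {(M, fire N M t) | M t. enabled N M t}"

definition reachable_markings :: "('p, 't) petri_net \<Rightarrow> ('p \<Rightarrow> nat) set" where
  "reachable_markings N = {M. (init_marking N, M) \<in> (net_steps N)\<^sup>*}"

definition net_tsys :: "('p, 't) petri_net \<Rightarrow> ('p \<Rightarrow> nat) tsys" where
  "net_tsys N =
     \<lparr>states = reachable_markings N,
      steps = net_steps N \<inter> reachable_markings N \<times> reachable_markings N,
      start = init_marking N\<rparr>"

section \<open>Processes\<close>

type_synonym name = nat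
type_synonym ident = nat

datatype prefix = Send name name | Recv name name | Tau

datatype proc =
    Call ident "name list"
  | Sum "(prefix \<times> proc) list"
  | Res name proc
  | Par proc proc

abbreviation Zero :: proc where "Zero \<equiv> Sum []"

fun prefix_free :: "prefix \<Rightarrow> name set" where
  "prefix_free (Send a b) = {a, b}"
| "prefix_free (Recv a x) = {a}"
| "prefix_free Tau = {}"

fun prefix_bound :: "prefix \<Rightarrow> name set" where
  "prefix_bound (Recv a x) = {x}"
| "prefix_bound _ = {}"

fun fn :: "proc \<Rightarrow> name set" where
  "fn (Call K as) = set as"
| "fn (Sum bs) = (\<Union>(\<pi>, P) \<in> set bs. prefix_free \<pi> \<union> (fn P - prefix_bound \<pi>))"
| "fn (Res r P) = fn P - {r}"
| "fn (Par P Q) = fn P \<union> fn Q"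

text \<open>Simultaneous capture-avoiding substitution: a binder is kept unless it would capture a
  substituted name, in which case it is renamed.\<close>

definition refresh :: "name \<Rightarrow> name set \<Rightarrow> name" where
  "refresh x A = (if x \<in> A then (LEAST z. z \<notin> A) else x)"

fun subst :: "(name \<Rightarrow> name) \<Rightarrow> proc \<Rightarrow> proc" where
  "subst \<sigma> (Call K as) = Call K (map \<sigma> as)"
| "subst \<sigma> (Sum bs) = Sum (map (\<lambda>(\<pi>, P).
     (case \<pi> of
        Tau \<Rightarrow> (Tau, subst \<sigma> P)
      | Send a b \<Rightarrow> (Send (\<sigma> a) (\<sigma> b), subst \<sigma> P)
      | Recv a x \<Rightarrow>
          (Recv (\<sigma> a) (refresh x (\<sigma> ` (fn P - {x}))),
           subst (\<sigma>(x := refresh x (\<sigma> ` (fn P - {x})))) P))) bs)"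
| "subst \<sigma> (Res r P) =
     Res (refresh r (\<sigma> ` (fn P - {r}))) (subst (\<sigma>(r := refresh r (\<sigma> ` (fn P - {r})))) P)"
| "subst \<sigma> (Par P Q) = Par (subst \<sigma> P) (subst \<sigma> Q)"

definition subst_map :: "(name \<rightharpoonup> name) \<Rightarrow> proc \<Rightarrow> proc" where
  "subst_map \<sigma> P = subst (\<lambda>x. case \<sigma> x of None \<Rightarrow> x | Some a \<Rightarrow> a) P"

abbreviation rename1 :: "proc \<Rightarrow> name \<Rightarrow> name \<Rightarrow> proc" where
  "rename1 P z y \<equiv> subst (id(y := z)) P"

fun par_list :: "proc list \<Rightarrow> proc" where
  "par_list [] = Zero"
| "par_list [P] = P"
| "par_list (P # Q # Ps) = Par P (par_list (Q # Ps))"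

definition res_list :: "name list \<Rightarrow> proc \<Rightarrow> proc" where
  "res_list rs P = foldr Res rs P"

inductive scong :: "proc \<Rightarrow> proc \<Rightarrow> bool" (infix "\<cong>" 50) where
  refl: "P \<cong> P"
| sym: "P \<cong> Q \<Longrightarrow> Q \<cong> P"
| trans: "P \<cong> Q \<Longrightarrow> Q \<cong> R \<Longrightarrow> P \<cong> R"
| cong_sum: "P \<cong> Q \<Longrightarrow> Sum (bs @ (\<pi>, P) # cs) \<cong> Sum (bs @ (\<pi>, Q) # cs)"
| cong_res: "P \<cong> Q \<Longrightarrow> Res r P \<cong> Res r Q"
| cong_par: "P \<cong> P' \<Longrightarrow> Q \<cong> Q' \<Longrightarrow> Par P Q \<cong> Par P' Q'"
| alpha_res: "z \<notin> fn P \<Longrightarrow> Res r P \<cong> Res z (rename1 P z r)"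
| alpha_recv: "z \<notin> fn P \<Longrightarrow>
    Sum (bs @ (Recv a x, P) # cs) \<cong> Sum (bs @ (Recv a z, rename1 P z x) # cs)"
| par_assoc: "Par (Par P Q) R \<cong> Par P (Par Q R)"
| par_comm: "Par P Q \<cong> Par Q P"
| par_unit: "Par P Zero \<cong> P"
| res_zero: "Res r Zero \<cong> Zero"
| res_swap: "Res r (Res s P) \<cong> Res s (Res r P)"
| res_extrude: "r \<notin> fn P \<Longrightarrow> Res r (Par P Q) \<cong> Par P (Res r Q)"

definition scong_class :: "proc \<Rightarrow> proc set" where
  "scong_class P = {Q. P \<cong> Q}"

section \<open>FCP specifications\<close>

text \<open>A specification consists of the defining equations \<open>K(fs) := S\<close> as triples \<open>(K, fs, S)\<close>,
  the top-level restricted names, and for each thread the pair of its initial identifier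
  \<open>K\<^sub>i\<^sub>n\<^sub>i\<^sub>t\<close> and its substitution \<open>\<sigma>\<close>.\<close>

type_synonym equation = "ident \<times> name list \<times> proc"

record fcp =
  eqs :: "equation list"
  restr :: "name list"
  inits :: "(ident \<times> (name \<rightharpoonup> name)) list"

abbreviation n_threads :: "fcp \<Rightarrow> nat" where
  "n_threads F \<equiv> length (inits F)"

abbreviation init_ident :: "fcp \<Rightarrow> nat \<Rightarrow> ident" where
  "init_ident F i \<equiv> fst (inits F ! i)"

abbreviation init_subst :: "fcp \<Rightarrow> nat \<Rightarrow> (name \<rightharpoonup> name)" where
  "init_subst F i \<equiv> snd (inits F ! i)"

definition init_body :: "fcp \<Rightarrow> nat \<Rightarrow> proc" where
  "init_body F i = snd (the (map_of (eqs F) (init_ident F i)))"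

definition fcp_proc :: "fcp \<Rightarrow> proc" where
  "fcp_proc F = res_list (restr F)
     (par_list (map (\<lambda>i. subst_map (init_subst F i) (init_body F i)) [0..<n_threads F]))"

inductive react :: "equation list \<Rightarrow> proc \<Rightarrow> proc \<Rightarrow> bool" for E :: "equation list" where
  tau: "(Tau, S) \<in> set bs \<Longrightarrow> react E (Sum bs) S"
| call: "(K, fs, S) \<in> set E \<Longrightarrow> length as = length fs \<Longrightarrow>
    react E (Call K as) (subst_map (map_of (zip fs as)) S)"
| comm: "(Recv x y, S\<^sub>1) \<in> set bs \<Longrightarrow> (Send x z, S\<^sub>2) \<in> set cs \<Longrightarrow>
    react E (Par (Sum bs) (Sum cs)) (Par (rename1 S\<^sub>1 z y) S\<^sub>2)"
| par: "react E P P' \<Longrightarrow> react E (Par P Q) (Par P' Q)"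
| res: "react E P P' \<Longrightarrow> react E (Res r P) (Res r P')"
| struct: "P \<cong> P' \<Longrightarrow> react E P' Q' \<Longrightarrow> Q' \<cong> Q \<Longrightarrow> react E P Q"

definition reachable_procs :: "fcp \<Rightarrow> proc set" where
  "reachable_procs F = {G. (react (eqs F))\<^sup>*\<^sup>* (fcp_proc F) G}"

definition fcp_tsys :: "fcp \<Rightarrow> proc set tsys" where
  "fcp_tsys F =
     \<lparr>states = scong_class ` reachable_procs F,
      steps = {(scong_class G, scong_class G') | G G'.
        G \<in> reachable_procs F \<and> G' \<in> reachable_procs F \<and> react (eqs F) G G'},
      start = scong_class (fcp_proc F)\<rparr>"

section \<open>Normal form\<close>

fun thread :: "proc \<Rightarrow> bool" where
  "thread (Call K as) = True"
| "thread (Sum bs) = (\<forall>(\<pi>, P) \<in> set bs. thread P)"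
| "thread (Res r P) = thread P"
| "thread (Par P Q) = False"

fun zero_free :: "proc \<Rightarrow> bool" where
  "zero_free (Call K as) = True"
| "zero_free (Sum bs) = (bs \<noteq> [] \<and> (\<forall>(\<pi>, P) \<in> set bs. zero_free P))"
| "zero_free (Res r P) = zero_free P"
| "zero_free (Par P Q) = (zero_free P \<and> zero_free Q)"

fun binders_used :: "proc \<Rightarrow> bool" where
  "binders_used (Call K as) = True"
| "binders_used (Sum bs) = (\<forall>(\<pi>, P) \<in> set bs. prefix_bound \<pi> \<subseteq> fn P \<and> binders_used P)"
| "binders_used (Res r P) = (r \<in> fn P \<and> binders_used P)"
| "binders_used (Par P Q) = (binders_used P \<and> binders_used Q)"

fun is_call :: "proc \<Rightarrow> bool" where
  "is_call (Call K as) = True"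
| "is_call _ = False"

fun is_choice :: "proc \<Rightarrow> bool" where
  "is_choice (Sum bs) = (bs \<noteq> [])"
| "is_choice _ = False"

text \<open>Binding occurrences, listed with multiplicity.\<close>

fun res_binders :: "proc \<Rightarrow> name list" where
  "res_binders (Call K as) = []"
| "res_binders (Sum bs) = concat (map (\<lambda>(\<pi>, P). res_binders P) bs)"
| "res_binders (Res r P) = r # res_binders P"
| "res_binders (Par P Q) = res_binders P @ res_binders Q"

fun inp_binders :: "proc \<Rightarrow> name list" where
  "inp_binders (Call K as) = []"
| "inp_binders (Sum bs) = concat (map (\<lambda>(\<pi>, P).
     (case \<pi> of Recv a x \<Rightarrow> [x] | _ \<Rightarrow> []) @ inp_binders P) bs)"
| "inp_binders (Res r P) = inp_binders P"
| "inp_binders (Par P Q) = inp_binders P @ inp_binders Q"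

text \<open>The called identifiers, each with the number of arguments it is called with.\<close>

fun calls :: "proc \<Rightarrow> (ident \<times> nat) set" where
  "calls (Call K as) = {(K, length as)}"
| "calls (Sum bs) = (\<Union>(\<pi>, P) \<in> set bs. calls P)"
| "calls (Res r P) = calls P"
| "calls (Par P Q) = calls P \<union> calls Q"

definition restr_binders :: "fcp \<Rightarrow> name list" where
  "restr_binders F = restr F @ concat (map (\<lambda>(K, fs, S). res_binders S) (eqs F))"

definition input_binders :: "fcp \<Rightarrow> name list" where
  "input_binders F = concat (map (\<lambda>(K, fs, S). inp_binders S) (eqs F))"

definition formal_binders :: "fcp \<Rightarrow> name list" where
  "formal_binders F = concat (map (\<lambda>(K, fs, S). fs) (eqs F))"

abbreviation RESTR :: "fcp \<Rightarrow> name set" where "RESTR F \<equiv> set (restr_binders F)"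
abbreviation INP :: "fcp \<Rightarrow> name set" where "INP F \<equiv> set (input_binders F)"
abbreviation FRM :: "fcp \<Rightarrow> name set" where "FRM F \<equiv> set (formal_binders F)"

text \<open>The free names of the equation bodies and the names in the ranges of the initial
  substitutions are all the names of the specification that may occur without being bound.\<close>

definition PUB :: "fcp \<Rightarrow> name set" where
  "PUB F = ((\<Union>(K, fs, S) \<in> set (eqs F). fn S) \<union> (\<Union>(K, \<sigma>) \<in> set (inits F). ran \<sigma>))
     - (RESTR F \<union> INP F \<union> FRM F)"

definition call_graph :: "fcp \<Rightarrow> (ident \<times> ident) set" where
  "call_graph F = {(K, K'). \<exists>fs S m. (K, fs, S) \<in> set (eqs F) \<and> (K', m) \<in> calls S}"

definition thread_idents :: "fcp \<Rightarrow> nat \<Rightarrow> ident set" where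
  "thread_idents F i = {K. (init_ident F i, K) \<in> (call_graph F)\<^sup>*}"

definition normal_form :: "fcp \<Rightarrow> bool" where
  "normal_form F \<longleftrightarrow>
     distinct (map fst (eqs F)) \<and>
     distinct (restr_binders F @ input_binders F @ formal_binders F) \<and>
     (\<forall>(K, fs, S) \<in> set (eqs F).
        thread S \<and> fn S = set fs \<and> zero_free S \<and> binders_used S \<and>
        K \<notin> fst ` calls S \<and>
        (\<forall>(K', m) \<in> calls S. \<exists>fs' S'. (K', fs', S') \<in> set (eqs F) \<and> length fs' = m)) \<and>
     (\<forall>(K, \<sigma>) \<in> set (inits F). \<exists>fs S. (K, fs, S) \<in> set (eqs F) \<and>
        (is_choice S \<or> is_call S) \<and> dom \<sigma> = set fs \<and> ran \<sigma> \<subseteq> set (restr F) \<union> PUB F) \<and>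
     (\<forall>i < n_threads F. \<forall>j < n_threads F. i \<noteq> j \<longrightarrow> thread_idents F i \<inter> thread_idents F j = {})"

definition new_names :: "fcp \<Rightarrow> name set \<Rightarrow> bool" where
  "new_names F NEW \<longleftrightarrow>
     finite NEW \<and> NEW \<inter> (PUB F \<union> RESTR F \<union> INP F \<union> FRM F) = {} \<and>
     card NEW = card (RESTR F) + card (INP F) + card (FRM F)"

section \<open>The substitution net\<close>

text \<open>\<open>EqP x a\<close>, \<open>NeqP x n\<close> and \<open>NeqStar n\<close> are the places \<open>[x = a]\<close>, \<open>[x \<noteq> n]\<close> and
  \<open>[r\<^sub>* \<noteq> n]\<close>.\<close>

datatype splace = EqP name name | NeqP name name | NeqStar name

definition subst_places :: "fcp \<Rightarrow> name set \<Rightarrow> splace set" where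
  "subst_places F NEW =
     {EqP x p | x p. x \<in> INP F \<union> FRM F \<and> p \<in> PUB F} \<union>
     {EqP x n | x n. x \<in> INP F \<union> FRM F \<union> RESTR F \<and> n \<in> NEW} \<union>
     {NeqP x n | x n. x \<in> INP F \<union> FRM F \<and> n \<in> NEW} \<union>
     {NeqStar n | n. n \<in> NEW}"

text \<open>Markings are total functions that vanish on missing places.\<close>

definition subst_marking :: "fcp \<Rightarrow> name set \<Rightarrow> (splace \<Rightarrow> nat) \<Rightarrow> bool" where
  "subst_marking F NEW M \<longleftrightarrow>
     (\<forall>p. p \<notin> subst_places F NEW \<longrightarrow> M p = 0) \<and>
     (\<forall>n \<in> NEW. M (NeqStar n) + (\<Sum>r \<in> RESTR F. M (EqP r n)) = 1) \<and>
     (\<forall>x \<in> INP F \<union> FRM F \<union> RESTR F. (\<Sum>a \<in> PUB F \<union> NEW. M (EqP x a)) \<le> 1) \<and>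
     (\<forall>x \<in> INP F \<union> FRM F. \<forall>n \<in> NEW. M (EqP x n) + M (NeqP x n) = 1)"

definition corresponds ::
  "fcp \<Rightarrow> name set \<Rightarrow> name set \<Rightarrow> (name \<rightharpoonup> name) \<Rightarrow> (splace \<Rightarrow> nat) \<Rightarrow> bool" where
  "corresponds F NEW R \<sigma> M \<longleftrightarrow>
     R \<inter> PUB F = {} \<and>
     dom \<sigma> \<subseteq> INP F \<union> FRM F \<union> RESTR F \<and> ran \<sigma> \<subseteq> PUB F \<union> R \<and>
     (\<forall>r \<in> dom \<sigma> \<inter> RESTR F. the (\<sigma> r) \<in> R) \<and> inj_on \<sigma> (dom \<sigma> \<inter> RESTR F) \<and>
     subst_marking F NEW M \<and>
     (\<forall>x a. x \<notin> dom \<sigma> \<longrightarrow> M (EqP x a) = 0) \<and>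
     (\<forall>x p. \<sigma> x = Some p \<and> p \<in> PUB F \<longrightarrow> M (EqP x p) = 1) \<and>
     (\<forall>x r. \<sigma> x = Some r \<and> r \<in> R \<longrightarrow> (\<exists>n \<in> NEW. M (EqP x n) = 1)) \<and>
     (\<forall>x y r s. \<sigma> x = Some r \<and> r \<in> R \<and> \<sigma> y = Some s \<and> s \<in> R \<longrightarrow>
        (r = s \<longleftrightarrow> (\<forall>n \<in> NEW. M (EqP x n) = M (EqP y n))))"

text \<open>\<open>\<sigma>\<close> is the union of \<open>\<sigma>s 0, \<dots>, \<sigma>s (k - 1)\<close>, as sets of pairs.\<close>

definition is_union :: "(name \<rightharpoonup> name) \<Rightarrow> nat \<Rightarrow> (nat \<Rightarrow> name \<rightharpoonup> name) \<Rightarrow> bool" where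
  "is_union \<sigma> k \<sigma>s \<longleftrightarrow> Map.graph \<sigma> = (\<Union>i<k. Map.graph (\<sigma>s i))"

section \<open>Control flow nets\<close>

type_synonym aug = "proc \<times> name list"

datatype label = LTau | LSend name name | LRec name name

datatype command = Test name name | MapTo name name | Unmap name name

type_synonym ctrans = "aug \<times> label \<times> command set \<times> aug"

definition dropped :: "(prefix \<times> proc) list \<Rightarrow> proc \<Rightarrow> name list" where
  "dropped bs S = sorted_list_of_set (fn (Sum bs) - fn S)"

inductive_set cf_trans :: "fcp \<Rightarrow> name set \<Rightarrow> ctrans set"
  for F :: fcp and NEW :: "name set" where
  nu: "n \<in> NEW \<Longrightarrow> ((Res r S, l), LTau, {MapTo r n}, (S, l)) \<in> cf_trans F NEW"
| tau: "(Tau, S) \<in> set bs \<Longrightarrow>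
    ((Sum bs, l), LTau, {}, (S, l @ dropped bs S)) \<in> cf_trans F NEW"
| snd: "(Send x y, S) \<in> set bs \<Longrightarrow> a \<in> PUB F \<union> NEW \<Longrightarrow> b \<in> PUB F \<union> NEW \<Longrightarrow>
    ((Sum bs, l), LSend a b, {Test x a, Test y b}, (S, l @ dropped bs S)) \<in> cf_trans F NEW"
| rec: "(Recv x y, S) \<in> set bs \<Longrightarrow> a \<in> PUB F \<union> NEW \<Longrightarrow> b \<in> PUB F \<union> NEW \<Longrightarrow>
    ((Sum bs, l), LRec a b, {Test x a, MapTo y b}, (S, l @ dropped bs S)) \<in> cf_trans F NEW"
| call1: "(K, fs, S) \<in> set (eqs F) \<Longrightarrow> length xs < length fs \<Longrightarrow> a \<in> PUB F \<union> NEW \<Longrightarrow>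
    ((Call K (xs @ [x]), l), LTau, {Test x a, MapTo (fs ! length xs) a},
     (Call K xs, if x \<in> set l then l else l @ [x])) \<in> cf_trans F NEW"
| call2: "a \<in> PUB F \<union> NEW \<Longrightarrow>
    ((Call K [], x # l), LTau, {Unmap x a}, (Call K [], l)) \<in> cf_trans F NEW"
| call3: "(K, fs, S) \<in> set (eqs F) \<Longrightarrow>
    ((Call K [], []), LTau, {}, (S, [])) \<in> cf_trans F NEW"

definition cf_step :: "fcp \<Rightarrow> name set \<Rightarrow> (aug \<times> aug) set" where
  "cf_step F NEW = {(s, s'). \<exists>lab C. (s, lab, C, s') \<in> cf_trans F NEW}"

definition cf_places :: "fcp \<Rightarrow> name set \<Rightarrow> nat \<Rightarrow> aug set" where
  "cf_places F NEW i = {s. ((init_body F i, []), s) \<in> (cf_step F NEW)\<^sup>*}"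

definition cf_net_trans :: "fcp \<Rightarrow> name set \<Rightarrow> nat \<Rightarrow> ctrans set" where
  "cf_net_trans F NEW i = {(s, lab, C, s') \<in> cf_trans F NEW. s \<in> cf_places F NEW i}"

section \<open>Composition\<close>

text \<open>\<open>Ctl i s\<close> is the place \<open>s\<close> of the control flow net of thread \<open>i\<close>.  \<open>Local i t\<close> is its
  transition \<open>t\<close>, and \<open>Sync i t j u\<close> merges a send of thread \<open>i\<close> with a receive of thread \<open>j\<close>.\<close>

datatype nplace = Ctl nat aug | Sub splace

datatype ntrans = Local nat ctrans | Sync nat ctrans nat ctrans

definition par_trans :: "fcp \<Rightarrow> name set \<Rightarrow> ntrans set" where
  "par_trans F NEW =
     {Local i t | i t. i < n_threads F \<and> t \<in> cf_net_trans F NEW i} \<union>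
     {Sync i (s, LSend a b, C, s') j (u, LRec a b, D, u') | i s a b C s' j u D u'.
        i < n_threads F \<and> j < n_threads F \<and> i \<noteq> j \<and>
        (s, LSend a b, C, s') \<in> cf_net_trans F NEW i \<and>
        (u, LRec a b, D, u') \<in> cf_net_trans F NEW j}"

fun ntrans_label :: "ntrans \<Rightarrow> label" where
  "ntrans_label (Local i (s, lab, C, s')) = lab"
| "ntrans_label (Sync i t j u) = LTau"

fun ntrans_commands :: "ntrans \<Rightarrow> command set" where
  "ntrans_commands (Local i (s, lab, C, s')) = C"
| "ntrans_commands (Sync i (s, lab, C, s') j (u, lab', D, u')) = C \<union> D"

fun ctl_pre :: "ntrans \<Rightarrow> (nat \<times> aug) set" where
  "ctl_pre (Local i (s, lab, C, s')) = {(i, s)}"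
| "ctl_pre (Sync i (s, lab, C, s') j (u, lab', D, u')) = {(i, s), (j, u)}"

fun ctl_post :: "ntrans \<Rightarrow> (nat \<times> aug) set" where
  "ctl_post (Local i (s, lab, C, s')) = {(i, s')}"
| "ctl_post (Sync i (s, lab, C, s') j (u, lab', D, u')) = {(i, s'), (j, u')}"

fun cmd_pre :: "fcp \<Rightarrow> name set \<Rightarrow> command \<Rightarrow> splace set" where
  "cmd_pre F NEW (Test x b) = {EqP x b}"
| "cmd_pre F NEW (MapTo x b) =
     (if b \<in> NEW then
        if x \<in> RESTR F then insert (NeqStar b) {NeqP y b | y. y \<in> INP F \<union> FRM F}
        else {NeqP x b}
      else {})"
| "cmd_pre F NEW (Unmap x a) = {EqP x a}"

fun cmd_post :: "fcp \<Rightarrow> name set \<Rightarrow> command \<Rightarrow> splace set" where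
  "cmd_post F NEW (Test x b) = {EqP x b}"
| "cmd_post F NEW (MapTo x b) =
     (if b \<in> NEW \<and> x \<in> RESTR F then insert (EqP x b) {NeqP y b | y. y \<in> INP F \<union> FRM F}
      else {EqP x b})"
| "cmd_post F NEW (Unmap x a) =
     (if a \<in> NEW then {if x \<in> RESTR F then NeqStar a else NeqP x a} else {})"

definition sub_pre :: "fcp \<Rightarrow> name set \<Rightarrow> ntrans \<Rightarrow> splace set" where
  "sub_pre F NEW t = (\<Union>c \<in> ntrans_commands t. cmd_pre F NEW c)"

definition sub_post :: "fcp \<Rightarrow> name set \<Rightarrow> ntrans \<Rightarrow> splace set" where
  "sub_post F NEW t = (\<Union>c \<in> ntrans_commands t. cmd_post F NEW c)"

text \<open>A transition whose commands mention a place that the substitution net does not have (a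
  restricted name \<open>r\<close> tested against or unmapped from a public name) is left out: a missing
  place counts as unmarked, so that the transition could never fire.\<close>

definition net_trans :: "fcp \<Rightarrow> name set \<Rightarrow> ntrans set" where
  "net_trans F NEW = {t \<in> par_trans F NEW. ntrans_label t = LTau \<and>
     sub_pre F NEW t \<union> sub_post F NEW t \<subseteq> subst_places F NEW}"

definition fcp_net ::
  "fcp \<Rightarrow> name set \<Rightarrow> (splace \<Rightarrow> nat) \<Rightarrow> (nplace, ntrans) petri_net" where
  "fcp_net F NEW M\<^sub>s =
     \<lparr>places = {Ctl i s | i s. i < n_threads F \<and> s \<in> cf_places F NEW i}
        \<union> Sub ` subst_places F NEW,
      transitions = net_trans F NEW,
      flow_pt = {(Ctl i s, t) | i s t. t \<in> net_trans F NEW \<and> (i, s) \<in> ctl_pre t}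
        \<union> {(Sub p, t) | p t. t \<in> net_trans F NEW \<and> p \<in> sub_pre F NEW t},
      flow_tp = {(t, Ctl i s) | i s t. t \<in> net_trans F NEW \<and> (i, s) \<in> ctl_post t}
        \<union> {(t, Sub p) | p t. t \<in> net_trans F NEW \<and> p \<in> sub_post F NEW t},
      init_marking = (\<lambda>p. case p of
          Ctl i s \<Rightarrow> of_bool (i < n_threads F \<and> s = (init_body F i, []))
        | Sub q \<Rightarrow> M\<^sub>s q)\<rparr>"

section \<open>Stability and the bisimulation\<close>

fun stable_place :: "fcp \<Rightarrow> aug \<Rightarrow> bool" where
  "stable_place F (Call K xs, l) = (\<exists>fs S. (K, fs, S) \<in> set (eqs F) \<and> length xs = length fs)"
| "stable_place F (S, l) = is_choice S"

definition stable_marking :: "fcp \<Rightarrow> (nplace \<Rightarrow> nat) \<Rightarrow> bool" where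
  "stable_marking F M \<longleftrightarrow> (\<forall>i < n_threads F. \<exists>s. stable_place F s \<and> M (Ctl i s) > 0)"

definition derived :: "fcp \<Rightarrow> name set \<Rightarrow> aug \<Rightarrow> bool" where
  "derived F NEW s \<longleftrightarrow> (\<exists>(K, fs, S) \<in> set (eqs F).
     ((S, []), s) \<in> {(u, v) \<in> cf_step F NEW. \<not> is_call (fst u)}\<^sup>*)"

definition bisim_rel ::
  "fcp \<Rightarrow> name set \<Rightarrow> (splace \<Rightarrow> nat) \<Rightarrow> (proc set \<times> (nplace \<Rightarrow> nat)) set" where
  "bisim_rel F NEW M\<^sub>s = {(scong_class G, M) | G M.
     G \<in> reachable_procs F \<and> M \<in> reachable_markings (fcp_net F NEW M\<^sub>s) \<and> stable_marking F M \<and>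
     (\<exists>rs Ss ls \<sigma>s \<sigma>.
        distinct rs \<and> set rs \<inter> PUB F = {} \<and>
        G \<cong> res_list rs (par_list (map (\<lambda>i. subst_map (\<sigma>s i) (Ss i)) [0..<n_threads F])) \<and>
        (\<forall>i < n_threads F.
           (is_choice (Ss i) \<or> is_call (Ss i)) \<and> derived F NEW (Ss i, ls i) \<and>
           dom (\<sigma>s i) = fn (Ss i) \<union> set (ls i) \<and> ran (\<sigma>s i) \<subseteq> set rs \<union> PUB F) \<and>
        is_union \<sigma> (n_threads F) \<sigma>s \<and>
        corresponds F NEW (set rs) \<sigma> (\<lambda>q. M (Sub q)) \<and>
        (\<forall>i < n_threads F. M (Ctl i (Ss i, ls i)) = 1))}"

text \<open>\<open>bisim_rel\<close> relates stable markings only, but a single step can lead from a stable marking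
  to one where some thread has yet to allocate restricted names or to pass and unmap parameters.
  On the full transition system such a marking is related to what \<open>bisim_rel\<close> assigns to
  the markings obtained by completing this housekeeping.  A place is settled if \<open>bisim_rel\<close> can
  put a thread there.  Every reachable stable place is settled, except \<open>(K\<lfloor>-\<rfloor>, \<lambda>)\<close> for a \<open>K\<close> without
  parameters when the unmapping of the caller's names has begun and no body calls \<open>K\<close> with
  exactly the names \<open>\<lambda>\<close> left to unmap.\<close>

definition settled_place :: "fcp \<Rightarrow> name set \<Rightarrow> aug \<Rightarrow> bool" where
  "settled_place F NEW s \<longleftrightarrow> stable_place F s \<and> derived F NEW s"

definition settled_marking :: "fcp \<Rightarrow> name set \<Rightarrow> (nplace \<Rightarrow> nat) \<Rightarrow> bool" where
  "settled_marking F NEW M \<longleftrightarrow>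
     (\<forall>i < n_threads F. \<exists>s. settled_place F NEW s \<and> M (Ctl i s) > 0)"

definition housekeeping ::
  "fcp \<Rightarrow> name set \<Rightarrow> (splace \<Rightarrow> nat) \<Rightarrow> ((nplace \<Rightarrow> nat) \<times> (nplace \<Rightarrow> nat)) set" where
  "housekeeping F NEW M\<^sub>s = (let N = fcp_net F NEW M\<^sub>s in
     {(M, fire N M t) | M t. enabled N M t \<and>
        (\<forall>i s. (Ctl i s, t) \<in> flow_pt N \<longrightarrow> \<not> settled_place F NEW s)})"

definition full_bisim_rel ::
  "fcp \<Rightarrow> name set \<Rightarrow> (splace \<Rightarrow> nat) \<Rightarrow> (proc set \<times> (nplace \<Rightarrow> nat)) set" where
  "full_bisim_rel F NEW M\<^sub>s = {(c, M). M \<in> reachable_markings (fcp_net F NEW M\<^sub>s) \<and>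
     (\<exists>M'. (M, M') \<in> (housekeeping F NEW M\<^sub>s)\<^sup>* \<and> (c, M') \<in> bisim_rel F NEW M\<^sub>s)}"

end

theory Submission
  imports Defs "HOL-Library.Multiset"
begin

text \<open>
  A reachable marking of the net determines the place of every thread and a substitution \<open>\<theta>\<close>
  assigning public or new names to the names in use.  Reading off the process at every place,
  instantiated by \<open>\<theta>\<close>, and restricting all new names gives a process that is unique up to \<open>\<cong>\<close>.
  Housekeeping steps (allocation of restricted names, passing and unmapping of parameters) do not
  change this process, every other step of the net is a reaction of it, and housekeeping always
  reaches a settled marking since \<open>NEW\<close> is large enough.  So the extended relation links a marking
  exactly with the class of its process.

  For the converse, a reaction of \<open>\<nu>A.(T\<^sub>1 | \<dots> | T\<^sub>n)\<close> with guarded \<open>T\<^sub>i\<close> must come from one or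
  two of the \<open>T\<^sub>i\<close>, although \<open>\<cong>\<close> may be applied at will.  This holds because the multiset of guarded
  components obtained by opening all top-level restrictions is invariant under \<open>\<cong>\<close> up to the
  continuations of the components.
\<close>

subsection \<open>Substitution and structural congruence\<close>

declare scong.refl [simp] and scong.trans [trans]

lemma proc_induct [case_names Call Sum Res Par]:
  assumes "\<And>K as. Q (Call K as)"
    and "\<And>bs. (\<And>\<pi> P. (\<pi>, P) \<in> set bs \<Longrightarrow> Q P) \<Longrightarrow> Q (Sum bs)"
    and "\<And>r P. Q P \<Longrightarrow> Q (Res r P)"
    and "\<And>P R. Q P \<Longrightarrow> Q R \<Longrightarrow> Q (Par P R)"
  shows "Q P"
proof (induction P)
  case (Sum bs)
  then show ?case by (intro assms(2)) (metis snds.intros snd_conv)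
qed (use assms in auto)

definition bound_name :: "(name \<Rightarrow> name) \<Rightarrow> name \<Rightarrow> proc \<Rightarrow> name" where
  "bound_name \<sigma> x P = refresh x (\<sigma> ` (fn P - {x}))"

fun subst_branch :: "(name \<Rightarrow> name) \<Rightarrow> prefix \<times> proc \<Rightarrow> prefix \<times> proc" where
  "subst_branch \<sigma> (Tau, P) = (Tau, subst \<sigma> P)"
| "subst_branch \<sigma> (Send a b, P) = (Send (\<sigma> a) (\<sigma> b), subst \<sigma> P)"
| "subst_branch \<sigma> (Recv a x, P) =
     (Recv (\<sigma> a) (bound_name \<sigma> x P), subst (\<sigma>(x := bound_name \<sigma> x P)) P)"

lemma subst_Sum [simp]: "subst \<sigma> (Sum bs) = Sum (map (subst_branch \<sigma>) bs)"
  by (auto simp: bound_name_def split: prefix.split)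

lemma subst_Res [simp]:
  "subst \<sigma> (Res r P) = Res (bound_name \<sigma> r P) (subst (\<sigma>(r := bound_name \<sigma> r P)) P)"
  by (simp add: bound_name_def)

declare subst.simps(2,3) [simp del]

definition branch_fn :: "prefix \<times> proc \<Rightarrow> name set" where
  "branch_fn b = prefix_free (fst b) \<union> (fn (snd b) - prefix_bound (fst b))"

lemma fn_Sum [simp]: "fn (Sum bs) = (\<Union>b\<in>set bs. branch_fn b)"
  by (auto simp: branch_fn_def)

declare fn.simps(2) [simp del]

lemma finite_fn [simp]: "finite (fn P)"
proof (induction P rule: proc_induct)
  case (Sum bs)
  have "finite (prefix_free \<pi>)" for \<pi> by (cases \<pi>) auto
  with Sum show ?case by (auto simp: branch_fn_def)
qed auto

lemma refresh_notin: "finite A \<Longrightarrow> refresh x A \<notin> A"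
  unfolding refresh_def using LeastI_ex[OF ex_new_if_finite[OF infinite_UNIV_nat]] by simp

lemma bound_name_fresh: "bound_name \<sigma> x P \<notin> \<sigma> ` (fn P - {x})"
  by (simp add: bound_name_def refresh_notin)

lemma image_upd_fresh: "z \<notin> \<sigma> ` (A - {x}) \<Longrightarrow> (\<sigma>(x := z)) ` A - {z} = \<sigma> ` (A - {x})"
  by (auto simp: image_iff)

lemma fn_subst [simp]: "fn (subst \<sigma> P) = \<sigma> ` fn P"
proof (induction P arbitrary: \<sigma> rule: proc_induct)
  case (Sum bs)
  have "branch_fn (subst_branch \<sigma> b) = \<sigma> ` branch_fn b" if "b \<in> set bs" for b
  proof -
    obtain \<pi> P where b_eq: "b = (\<pi>, P)" by force
    with that Sum have "fn (subst \<tau> P) = \<tau> ` fn P" for \<tau> by auto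
    then show ?thesis
      by (cases \<pi>)
        (simp_all add: b_eq branch_fn_def image_Un image_upd_fresh[OF bound_name_fresh]
          del: fun_upd_apply)
  qed
  then show ?case by (simp add: image_UN)
next
  case (Res r P)
  then show ?case by (simp add: image_upd_fresh[OF bound_name_fresh] del: fun_upd_apply)
qed (auto simp: image_Un)

lemma bound_name_cong:
  assumes "\<And>y. y \<in> fn P - {x} \<Longrightarrow> \<sigma> y = \<tau> y"
  shows "bound_name \<sigma> x P = bound_name \<tau> x P"
proof -
  have "\<sigma> ` (fn P - {x}) = \<tau> ` (fn P - {x})" using assms by (rule image_cong[OF HOL.refl])
  then show ?thesis by (simp add: bound_name_def)
qed

lemma subst_cong: "(\<And>x. x \<in> fn P \<Longrightarrow> \<sigma> x = \<tau> x) \<Longrightarrow> subst \<sigma> P = subst \<tau> P"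
proof (induction P arbitrary: \<sigma> \<tau> rule: proc_induct)
  case (Sum bs)
  have "subst_branch \<sigma> b = subst_branch \<tau> b" if "b \<in> set bs" for b
  proof -
    obtain \<pi> P where b_eq: "b = (\<pi>, P)" by force
    have IH: "(\<And>x. x \<in> fn P \<Longrightarrow> \<sigma> x = \<tau> x) \<Longrightarrow> subst \<sigma> P = subst \<tau> P" for \<sigma> \<tau>
      using Sum.IH that b_eq by blast
    have agree: "\<sigma> x = \<tau> x" if "x \<in> branch_fn b" for x
      using Sum.prems that \<open>b \<in> set bs\<close> by auto
    show ?thesis
    proof (cases \<pi>)
      case (Recv a x)
      have "bound_name \<sigma> x P = bound_name \<tau> x P"
        by (rule bound_name_cong) (auto intro!: agree simp: b_eq Recv branch_fn_def)
      then show ?thesis using agree by (auto simp: b_eq Recv branch_fn_def intro!: IH)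
    qed (use agree in \<open>auto simp: b_eq branch_fn_def intro!: IH\<close>)
  qed
  then show ?case by simp
next
  case (Res r P)
  have "bound_name \<sigma> r P = bound_name \<tau> r P"
    by (rule bound_name_cong) (use Res.prems in auto)
  then show ?case using Res.prems by (auto intro!: Res.IH)
next
  case (Par P R)
  have "subst \<sigma> P = subst \<tau> P" by (rule Par.IH(1)) (simp add: Par.prems)
  moreover have "subst \<sigma> R = subst \<tau> R" by (rule Par.IH(2)) (simp add: Par.prems)
  ultimately show ?case by simp
qed simp

lemma bound_name_id [simp]: "bound_name id x P = x"
  by (simp add: bound_name_def refresh_def)

lemma subst_id [simp]: "subst id P = P"
proof (induction P rule: proc_induct)
  case (Sum bs)
  have "subst_branch id b = b" if "b \<in> set bs" for b
  proof -
    obtain \<pi> P where b_eq: "b = (\<pi>, P)" by force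
    moreover have "subst id P = P" using Sum that b_eq by blast
    moreover have "id(x := x) = id" for x :: name by auto
    ultimately show ?thesis
      by (cases \<pi>) (simp_all only: subst_branch.simps bound_name_id id_apply)
  qed
  then show ?case by (simp only: subst_Sum map_idI)
next
  case (Res r P)
  have "id(r := r) = id" by auto
  with Res show ?case by (simp only: subst_Res bound_name_id)
qed auto

lemma fn_rename1_Diff: "z \<notin> fn P \<Longrightarrow> fn (rename1 P z x) - {z} = fn P - {x}"
  by (auto simp: image_iff)

lemma scong_fn: "P \<cong> Q \<Longrightarrow> fn P = fn Q"
proof (induction rule: scong.induct)
  case (alpha_res z P r)
  then show ?case using fn_rename1_Diff by (simp del: fn_subst)
next
  case (alpha_recv z P bs a x cs)
  then have "branch_fn (Recv a x, P) = branch_fn (Recv a z, rename1 P z x)"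
    using fn_rename1_Diff by (simp add: branch_fn_def del: fn_subst)
  then show ?case by simp
qed (auto simp: branch_fn_def)

definition branch_cong :: "prefix \<times> proc \<Rightarrow> prefix \<times> proc \<Rightarrow> bool" where
  "branch_cong b c \<longleftrightarrow> (\<forall>bs cs. Sum (bs @ b # cs) \<cong> Sum (bs @ c # cs))"

lemma branch_cong_sym: "branch_cong b c \<Longrightarrow> branch_cong c b"
  by (simp add: branch_cong_def scong.sym)

lemma branch_cong_trans [trans]: "branch_cong b c \<Longrightarrow> branch_cong c d \<Longrightarrow> branch_cong b d"
  unfolding branch_cong_def by (blast intro: scong.trans)

lemma branch_cong_continuation: "P \<cong> Q \<Longrightarrow> branch_cong (\<pi>, P) (\<pi>, Q)"
  by (simp add: branch_cong_def scong.cong_sum)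

lemma scong_Sum: "list_all2 branch_cong bs cs \<Longrightarrow> Sum bs \<cong> Sum cs"
proof -
  have "list_all2 branch_cong bs cs \<Longrightarrow> Sum (ps @ bs) \<cong> Sum (ps @ cs)" for ps
  proof (induction arbitrary: ps rule: list_all2_induct)
    case (Cons b bs c cs)
    then have "Sum (ps @ b # bs) \<cong> Sum (ps @ c # bs)" by (simp add: branch_cong_def)
    also have "\<dots> \<cong> Sum (ps @ c # cs)" using Cons.IH[of "ps @ [c]"] by simp
    finally show ?case .
  qed simp
  from this[of "[]"] show "list_all2 branch_cong bs cs \<Longrightarrow> Sum bs \<cong> Sum cs" by simp
qed

text \<open>Restriction and input bind in the same way, so what concerns \<open>\<alpha>\<close>-conversion is proved for
  any \<open>binding_op\<close>.\<close>

definition binding_op :: "(name \<Rightarrow> proc \<Rightarrow> proc) \<Rightarrow> bool" where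
  "binding_op B \<longleftrightarrow> (\<forall>x P Q. P \<cong> Q \<longrightarrow> B x P \<cong> B x Q) \<and>
     (\<forall>x z P. z \<notin> fn P \<longrightarrow> B x P \<cong> B z (rename1 P z x))"

lemma binding_cong: "binding_op B \<Longrightarrow> P \<cong> Q \<Longrightarrow> B x P \<cong> B x Q"
  and binding_alpha: "binding_op B \<Longrightarrow> z \<notin> fn P \<Longrightarrow> B x P \<cong> B z (rename1 P z x)"
  by (simp_all add: binding_op_def)

lemma binding_Res: "binding_op Res"
  by (simp add: binding_op_def scong.cong_res scong.alpha_res)

lemma binding_Recv: "binding_op (\<lambda>x P. Sum (bs @ (Recv a x, P) # cs))"
  by (simp add: binding_op_def scong.cong_sum scong.alpha_recv)

lemma branch_cong_RecvI:
  "(\<And>B. binding_op B \<Longrightarrow> B x P \<cong> B y Q) \<Longrightarrow> branch_cong (Recv a x, P) (Recv a y, Q)"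
  unfolding branch_cong_def using binding_Recv by blast

text \<open>The assumption \<open>comp\<close> of the next lemmas is discharged by \<open>subst_comp\<close>, whose inductive proof
  needs them.\<close>

lemma rename1_subst_upd_if_comp:
  assumes comp: "\<And>\<sigma> \<tau>. subst \<tau> (subst \<sigma> P) \<cong> subst (\<tau> \<circ> \<sigma>) P"
    and z_fresh: "z \<notin> \<sigma> ` (fn P - {x})"
  shows "rename1 (subst (\<sigma>(x := z)) P) w z \<cong> subst (\<sigma>(x := w)) P"
proof -
  have "rename1 (subst (\<sigma>(x := z)) P) w z \<cong> subst (id(z := w) \<circ> \<sigma>(x := z)) P" by (rule comp)
  also have "\<dots> = subst (\<sigma>(x := w)) P" by (rule subst_cong) (use z_fresh in auto)
  finally show ?thesis .
qed

lemma binding_subst_upd_if_comp: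
  assumes comp: "\<And>\<sigma> \<tau>. subst \<tau> (subst \<sigma> P) \<cong> subst (\<tau> \<circ> \<sigma>) P" and "binding_op B"
    and z_fresh: "z \<notin> \<sigma> ` (fn P - {x})" and w_fresh: "w \<notin> \<sigma> ` (fn P - {x})"
  shows "B z (subst (\<sigma>(x := z)) P) \<cong> B w (subst (\<sigma>(x := w)) P)"
proof (cases "z = w")
  case False
  then have "w \<notin> fn (subst (\<sigma>(x := z)) P)" using w_fresh by auto
  then have "B z (subst (\<sigma>(x := z)) P) \<cong> B w (rename1 (subst (\<sigma>(x := z)) P) w z)"
    by (rule binding_alpha[OF \<open>binding_op B\<close>])
  also have "\<dots> \<cong> B w (subst (\<sigma>(x := w)) P)"
    by (intro binding_cong[OF \<open>binding_op B\<close>] rename1_subst_upd_if_comp comp z_fresh)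
  finally show ?thesis .
qed simp

lemma binding_subst_comp_if_comp:
  assumes comp: "\<And>\<sigma> \<tau>. subst \<tau> (subst \<sigma> P) \<cong> subst (\<tau> \<circ> \<sigma>) P" and "binding_op B"
    and z_fresh: "z \<notin> \<sigma> ` (fn P - {x})" and w_fresh: "w \<notin> \<tau> ` (fn (subst (\<sigma>(x := z)) P) - {z})"
    and v_fresh: "v \<notin> (\<tau> \<circ> \<sigma>) ` (fn P - {x})"
  shows "B w (subst (\<tau>(z := w)) (subst (\<sigma>(x := z)) P)) \<cong> B v (subst ((\<tau> \<circ> \<sigma>)(x := v)) P)"
proof -
  have w_fresh': "w \<notin> (\<tau> \<circ> \<sigma>) ` (fn P - {x})"
    using w_fresh image_upd_fresh[OF z_fresh] by (simp add: image_comp del: fun_upd_apply)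
  have "B w (subst (\<tau>(z := w)) (subst (\<sigma>(x := z)) P)) \<cong> B w (subst (\<tau>(z := w) \<circ> \<sigma>(x := z)) P)"
    by (intro binding_cong[OF \<open>binding_op B\<close>] comp)
  also have "subst (\<tau>(z := w) \<circ> \<sigma>(x := z)) P = subst ((\<tau> \<circ> \<sigma>)(x := w)) P"
    by (rule subst_cong) (use z_fresh in auto)
  also have "B w \<dots> \<cong> B v (subst ((\<tau> \<circ> \<sigma>)(x := v)) P)"
    by (rule binding_subst_upd_if_comp[OF comp \<open>binding_op B\<close> w_fresh' v_fresh])
  finally show ?thesis .
qed

lemma subst_comp: "subst \<tau> (subst \<sigma> P) \<cong> subst (\<tau> \<circ> \<sigma>) P"
proof (induction P arbitrary: \<sigma> \<tau> rule: proc_induct)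
  case (Sum bs)
  have "branch_cong (subst_branch \<tau> (subst_branch \<sigma> b)) (subst_branch (\<tau> \<circ> \<sigma>) b)"
    if "b \<in> set bs" for b
  proof -
    obtain \<pi> P where b_eq: "b = (\<pi>, P)" by force
    with that Sum have IH: "subst \<tau> (subst \<sigma> P) \<cong> subst (\<tau> \<circ> \<sigma>) P" for \<sigma> \<tau> by blast
    show ?thesis
    proof (cases \<pi>)
      case (Recv a x)
      show ?thesis
        unfolding b_eq Recv subst_branch.simps comp_apply[of \<tau> \<sigma> a]
        by (intro branch_cong_RecvI binding_subst_comp_if_comp IH bound_name_fresh)
    qed (use IH in \<open>simp_all add: b_eq branch_cong_continuation\<close>)
  qed
  then have "list_all2 branch_cong (map (subst_branch \<tau> \<circ> subst_branch \<sigma>) bs)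
      (map (subst_branch (\<tau> \<circ> \<sigma>)) bs)"
    by (simp add: list_all2_conv_all_nth)
  then show ?case by (simp only: subst_Sum map_map) (rule scong_Sum)
next
  case (Res r P)
  show ?case
    unfolding subst_Res by (intro binding_subst_comp_if_comp Res.IH binding_Res bound_name_fresh)
qed (simp_all add: comp_def scong.cong_par)

lemmas rename1_subst_upd = rename1_subst_upd_if_comp[OF subst_comp]
  and binding_subst_upd = binding_subst_upd_if_comp[OF subst_comp]

lemma subst_upd_subst_upd:
  assumes "z \<notin> \<tau> ` (fn P - {x})"
  shows "subst (\<sigma>(z := w)) (subst (\<tau>(x := z)) P) \<cong> subst ((\<sigma> \<circ> \<tau>)(x := w)) P"
proof -
  have "subst (\<sigma>(z := w)) (subst (\<tau>(x := z)) P) \<cong> subst (\<sigma>(z := w) \<circ> \<tau>(x := z)) P"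
    by (rule subst_comp)
  also have "\<dots> = subst ((\<sigma> \<circ> \<tau>)(x := w)) P" by (rule subst_cong) (use assms in auto)
  finally show ?thesis .
qed

lemma subst_upd_rename1:
  "z \<notin> fn P \<Longrightarrow> subst (\<sigma>(z := w)) (rename1 P z x) \<cong> subst (\<sigma>(x := w)) P"
  using subst_upd_subst_upd[of z id P x \<sigma> w] by simp

lemma subst_Res_fresh:
  "z \<notin> \<sigma> ` (fn P - {r}) \<Longrightarrow> subst \<sigma> (Res r P) \<cong> Res z (subst (\<sigma>(r := z)) P)"
  unfolding subst_Res by (intro binding_subst_upd binding_Res bound_name_fresh)

lemma binding_subst_rename1:
  assumes "binding_op B" and z_fresh: "z \<notin> fn P"
  shows "B (bound_name \<sigma> x P) (subst (\<sigma>(x := bound_name \<sigma> x P)) P) \<cong>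
    B (bound_name \<sigma> z (rename1 P z x))
      (subst (\<sigma>(z := bound_name \<sigma> z (rename1 P z x))) (rename1 P z x))" (is "?L \<cong> B ?w _")
proof -
  have "?w \<notin> \<sigma> ` (fn P - {x})"
    using bound_name_fresh[of \<sigma> z "rename1 P z x"] fn_rename1_Diff[OF z_fresh] by simp
  then have "?L \<cong> B ?w (subst (\<sigma>(x := ?w)) P)"
    by (intro binding_subst_upd \<open>binding_op B\<close> bound_name_fresh)
  also have "\<dots> \<cong> B ?w (subst (\<sigma>(z := ?w)) (rename1 P z x))"
    by (intro binding_cong[OF \<open>binding_op B\<close>] scong.sym[OF subst_upd_rename1] z_fresh)
  finally show ?thesis .
qed

lemma subst_Res_Res:
  assumes "r \<noteq> s" "z \<notin> \<sigma> ` fn P" "w \<notin> insert z (\<sigma> ` fn P)"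
  shows "subst \<sigma> (Res r (Res s P)) \<cong> Res z (Res w (subst (\<sigma>(r := z, s := w)) P))"
proof -
  have "subst \<sigma> (Res r (Res s P)) \<cong> Res z (subst (\<sigma>(r := z)) (Res s P))"
    by (rule subst_Res_fresh) (use assms in auto)
  also have "\<dots> \<cong> Res z (Res w (subst (\<sigma>(r := z, s := w)) P))"
    by (intro scong.cong_res subst_Res_fresh) (use assms in auto)
  finally show ?thesis .
qed

lemma subst_Res_swap: "subst \<sigma> (Res r (Res s P)) \<cong> subst \<sigma> (Res s (Res r P))"
proof (cases "r = s")
  case False
  obtain z where z_fresh: "z \<notin> \<sigma> ` fn P" using ex_new_if_finite[of "\<sigma> ` fn P"] by auto
  obtain w where w_fresh: "w \<notin> insert z (\<sigma> ` fn P)"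
    using ex_new_if_finite[of "insert z (\<sigma> ` fn P)"] by auto
  have "subst \<sigma> (Res r (Res s P)) \<cong> Res z (Res w (subst (\<sigma>(r := z, s := w)) P))"
    using False z_fresh w_fresh by (rule subst_Res_Res)
  also have "\<dots> \<cong> Res w (Res z (subst (\<sigma>(r := z, s := w)) P))" by (rule scong.res_swap)
  also have "\<sigma>(r := z, s := w) = \<sigma>(s := w, r := z)" using False by (rule fun_upd_twist)
  also have "Res w (Res z (subst (\<sigma>(s := w, r := z)) P)) \<cong> subst \<sigma> (Res s (Res r P))"
    by (rule scong.sym[OF subst_Res_Res]) (use False z_fresh w_fresh in auto)
  finally show ?thesis .
qed simp

lemma subst_Res_extrude:
  assumes "r \<notin> fn P"
  shows "subst \<sigma> (Res r (Par P Q)) \<cong> subst \<sigma> (Par P (Res r Q))"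
proof -
  obtain z where z_fresh: "z \<notin> \<sigma> ` (fn P \<union> fn Q)"
    using ex_new_if_finite[of "\<sigma> ` (fn P \<union> fn Q)"] by auto
  have "subst \<sigma> (Res r (Par P Q)) \<cong> Res z (subst (\<sigma>(r := z)) (Par P Q))"
    by (rule subst_Res_fresh) (use z_fresh in auto)
  also have "subst (\<sigma>(r := z)) (Par P Q) = Par (subst \<sigma> P) (subst (\<sigma>(r := z)) Q)"
    using assms by (auto intro!: subst_cong)
  also have "Res z \<dots> \<cong> Par (subst \<sigma> P) (Res z (subst (\<sigma>(r := z)) Q))"
    by (rule scong.res_extrude) (use z_fresh in auto)
  also have "\<dots> \<cong> Par (subst \<sigma> P) (subst \<sigma> (Res r Q))"
    by (intro scong.cong_par scong.refl scong.sym[OF subst_Res_fresh]) (use z_fresh in auto)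
  finally show ?thesis by simp
qed

lemma scong_subst: "P \<cong> Q \<Longrightarrow> subst \<sigma> P \<cong> subst \<sigma> Q"
proof (induction arbitrary: \<sigma> rule: scong.induct)
  case (trans P Q R)
  then show ?case by (blast intro: scong.trans)
next
  case (cong_sum P Q bs \<pi> cs)
  have "bound_name \<sigma> x P = bound_name \<sigma> x Q" for x
    using scong_fn[OF cong_sum.hyps] by (simp add: bound_name_def)
  then have "branch_cong (subst_branch \<sigma> (\<pi>, P)) (subst_branch \<sigma> (\<pi>, Q))"
    using cong_sum.IH by (cases \<pi>) (auto intro!: branch_cong_continuation)
  then show ?case by (simp add: branch_cong_def)
next
  case (cong_res P Q r)
  have "bound_name \<sigma> r P = bound_name \<sigma> r Q"
    using scong_fn[OF cong_res.hyps] by (simp add: bound_name_def)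
  then show ?case using cong_res.IH by (simp add: scong.cong_res del: fun_upd_apply)
next
  case (alpha_res z P r)
  then show ?case unfolding subst_Res by (intro binding_subst_rename1 binding_Res)
next
  case (alpha_recv z P bs a x cs)
  then have "branch_cong (subst_branch \<sigma> (Recv a x, P)) (subst_branch \<sigma> (Recv a z, rename1 P z x))"
    unfolding subst_branch.simps by (intro branch_cong_RecvI binding_subst_rename1)
  then show ?case by (simp only: subst_Sum map_append list.map branch_cong_def)
next
  case (res_swap r s P)
  show ?case by (rule subst_Res_swap)
next
  case (res_extrude r P Q)
  then show ?case by (rule subst_Res_extrude)
next
  case (res_zero r)
  then show ?case by (simp add: scong.res_zero)
qed (simp_all add: scong.sym scong.cong_par scong.par_assoc scong.par_comm scong.par_unit)

subsection \<open>Restriction of a set of names\<close>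

definition nu :: "name set \<Rightarrow> proc \<Rightarrow> proc" where
  "nu A P = res_list (sorted_list_of_set A) P"

lemma res_list_simps [simp]:
  "res_list [] P = P" "res_list (r # rs) P = Res r (res_list rs P)"
  by (simp_all add: res_list_def)

lemma nu_empty [simp]: "nu {} P = P"
  by (simp add: nu_def)

lemma fn_res_list [simp]: "fn (res_list rs P) = fn P - set rs"
  by (induction rs) auto

lemma fn_nu [simp]: "finite A \<Longrightarrow> fn (nu A P) = fn P - A"
  by (simp add: nu_def)

lemma res_list_cong: "P \<cong> Q \<Longrightarrow> res_list rs P \<cong> res_list rs Q"
  by (induction rs) (auto intro: scong.cong_res)

lemma nu_cong: "P \<cong> Q \<Longrightarrow> nu A P \<cong> nu A Q"
  by (simp add: nu_def res_list_cong)

lemma Res_unused: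
  assumes "r \<notin> fn P" shows "Res r P \<cong> P"
proof -
  have "Res r P \<cong> Res r (Par P Zero)" by (intro scong.cong_res scong.sym[OF scong.par_unit])
  also have "\<dots> \<cong> Par P (Res r Zero)" using assms by (rule scong.res_extrude)
  also have "\<dots> \<cong> Par P Zero" by (intro scong.cong_par scong.refl scong.res_zero)
  also have "\<dots> \<cong> P" by (rule scong.par_unit)
  finally show ?thesis .
qed

lemma res_list_insort: "res_list (insort r rs) P \<cong> Res r (res_list rs P)"
proof (induction rs)
  case (Cons s rs)
  have "Res s (res_list (insort r rs) P) \<cong> Res s (Res r (res_list rs P))"
    using Cons by (rule scong.cong_res)
  also have "\<dots> \<cong> Res r (Res s (res_list rs P))" by (rule scong.res_swap)
  finally show ?case by simp
qed simp

lemma nu_insert: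
  assumes "finite A" shows "nu (insert r A) P \<cong> Res r (nu A P)"
proof (cases "r \<in> A")
  case True
  then have "Res r (nu A P) \<cong> nu A P" using assms by (intro Res_unused) simp
  with True show ?thesis by (simp add: insert_absorb scong.sym)
next
  case False
  then have "sorted_list_of_set (insert r A) = insort r (sorted_list_of_set A)"
    using assms by simp
  then show ?thesis by (simp only: nu_def res_list_insort)
qed

lemma nu_Un: "finite A \<Longrightarrow> finite B \<Longrightarrow> nu (A \<union> B) P \<cong> nu A (nu B P)"
proof (induction A rule: finite_induct)
  case (insert r A)
  have "nu (insert r A \<union> B) P \<cong> Res r (nu (A \<union> B) P)" using nu_insert insert by simp
  also have "\<dots> \<cong> Res r (nu A (nu B P))" using insert by (intro scong.cong_res) simp
  also have "\<dots> \<cong> nu (insert r A) (nu B P)" using insert by (intro scong.sym[OF nu_insert])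
  finally show ?case .
qed simp

lemma nu_unused: "finite A \<Longrightarrow> A \<inter> fn P = {} \<Longrightarrow> nu A P \<cong> P"
proof (induction A rule: finite_induct)
  case (insert r A)
  have "nu (insert r A) P \<cong> Res r (nu A P)" using insert by (intro nu_insert)
  also have "\<dots> \<cong> nu A P" using insert by (intro Res_unused) auto
  also have "\<dots> \<cong> P" using insert by auto
  finally show ?case .
qed simp

lemma nu_Int_fn:
  assumes "finite A" shows "nu A P \<cong> nu (A \<inter> fn P) P"
proof -
  have "nu ((A \<inter> fn P) \<union> (A - fn P)) P \<cong> nu (A \<inter> fn P) (nu (A - fn P) P)"
    using assms by (intro nu_Un) auto
  also have "\<dots> \<cong> nu (A \<inter> fn P) P" using assms by (intro nu_cong nu_unused) auto
  also have "(A \<inter> fn P) \<union> (A - fn P) = A" by auto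
  finally show ?thesis .
qed

lemma nu_cong_set: "finite A \<Longrightarrow> finite B \<Longrightarrow> A \<inter> fn P = B \<inter> fn P \<Longrightarrow> nu A P \<cong> nu B P"
  by (metis nu_Int_fn scong.trans scong.sym)

lemma nu_Par_right: "finite A \<Longrightarrow> A \<inter> fn P = {} \<Longrightarrow> nu A (Par P Q) \<cong> Par P (nu A Q)"
proof (induction A rule: finite_induct)
  case (insert r A)
  have "nu (insert r A) (Par P Q) \<cong> Res r (nu A (Par P Q))" using insert by (intro nu_insert)
  also have "\<dots> \<cong> Res r (Par P (nu A Q))" using insert by (intro scong.cong_res) auto
  also have "\<dots> \<cong> Par P (Res r (nu A Q))" using insert by (intro scong.res_extrude) auto
  also have "\<dots> \<cong> Par P (nu (insert r A) Q)"
    using insert by (intro scong.cong_par scong.refl scong.sym[OF nu_insert])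
  finally show ?case .
qed simp

lemma Par_nu_nu:
  assumes "finite A" "finite B" "A \<inter> fn Q = {}" "B \<inter> fn P = {}"
  shows "Par (nu A P) (nu B Q) \<cong> nu (A \<union> B) (Par P Q)"
proof -
  have "Par (nu A P) (nu B Q) \<cong> Par (nu B Q) (nu A P)" by (rule scong.par_comm)
  also have "\<dots> \<cong> nu A (Par (nu B Q) P)" using assms by (intro scong.sym[OF nu_Par_right]) auto
  also have "\<dots> \<cong> nu A (Par P (nu B Q))" by (intro nu_cong scong.par_comm)
  also have "\<dots> \<cong> nu A (nu B (Par P Q))"
    using assms by (intro nu_cong scong.sym[OF nu_Par_right]) auto
  also have "\<dots> \<cong> nu (A \<union> B) (Par P Q)" using assms by (intro scong.sym[OF nu_Un])
  finally show ?thesis .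
qed

lemma res_list_nu: "res_list rs P \<cong> nu (set rs) P"
proof (induction rs)
  case (Cons r rs)
  have "Res r (res_list rs P) \<cong> Res r (nu (set rs) P)" using Cons by (rule scong.cong_res)
  also have "\<dots> \<cong> nu (insert r (set rs)) P" by (rule scong.sym[OF nu_insert]) simp
  finally show ?case by simp
qed simp

lemma subst_nu:
  "finite A \<Longrightarrow> A \<subseteq> fn P \<Longrightarrow> inj_on h A \<Longrightarrow> h ` A \<inter> \<sigma> ` (fn P - A) = {} \<Longrightarrow>
   subst \<sigma> (nu A P) \<cong> nu (h ` A) (subst (override_on \<sigma> h A) P)"
proof (induction A arbitrary: \<sigma> rule: finite_induct)
  case (insert r A)
  have h_r: "h r \<notin> h ` A" using insert.hyps(2) insert.prems(2) by (simp add: inj_on_insert)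
  have "h r \<notin> \<sigma> ` (fn (nu A P) - {r})" using insert.hyps(1) insert.prems(3) by auto
  then have "subst \<sigma> (Res r (nu A P)) \<cong> Res (h r) (subst (\<sigma>(r := h r)) (nu A P))"
    by (rule subst_Res_fresh)
  also have "\<dots> \<cong> Res (h r) (nu (h ` A) (subst (override_on (\<sigma>(r := h r)) h A) P))"
  proof (intro scong.cong_res insert.IH)
    show "h ` A \<inter> (\<sigma>(r := h r)) ` (fn P - A) = {}"
      using insert.prems(3) h_r by (auto simp: image_iff; metis)
  qed (use insert.prems in auto)
  also have "override_on (\<sigma>(r := h r)) h A = override_on \<sigma> h (insert r A)"
    by (auto simp: override_on_def)
  also have "Res (h r) (nu (h ` A) (subst \<dots> P)) \<cong> nu (h ` insert r A) (subst \<dots> P)"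
    using insert.hyps(1) by (simp add: scong.sym[OF nu_insert])
  finally show ?case using scong_subst[OF nu_insert[OF insert.hyps(1)]] scong.trans by blast
qed (simp add: override_on_def)

lemma nu_rename:
  assumes "finite A" "finite B" and "inj_on h (A \<inter> fn P)" and into: "h ` (A \<inter> fn P) \<subseteq> B"
    and fresh: "B \<inter> (fn P - A) = {}"
  shows "nu A P \<cong> nu B (subst (override_on id h A) P)"
proof -
  let ?g = "override_on id h A"
  have "nu A P \<cong> subst id (nu (A \<inter> fn P) P)" using nu_Int_fn[OF \<open>finite A\<close>] by simp
  also have "\<dots> \<cong> nu (h ` (A \<inter> fn P)) (subst (override_on id h (A \<inter> fn P)) P)"
    using assms by (intro subst_nu) auto
  also have "subst (override_on id h (A \<inter> fn P)) P = subst ?g P"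
    by (rule subst_cong) (simp add: override_on_def)
  also have "nu (h ` (A \<inter> fn P)) (subst ?g P) \<cong> nu B (subst ?g P)"
  proof (rule nu_cong_set)
    have "?g x \<in> h ` (A \<inter> fn P)" if "x \<in> fn P" "?g x \<in> B" for x
      using fresh that by (cases "x \<in> A") auto
    moreover have "h ` (A \<inter> fn P) \<subseteq> ?g ` fn P" by (force simp: override_on_def)
    ultimately show "h ` (A \<inter> fn P) \<inter> fn (subst ?g P) = B \<inter> fn (subst ?g P)" using into by auto
  qed (use assms in auto)
  finally show ?thesis .
qed

subsection \<open>Parallel composition of a family of processes\<close>

lemma par_list_Cons: "par_list (P # Ps) \<cong> Par P (par_list Ps)"
  by (cases Ps) (auto intro: scong.sym[OF scong.par_unit])

lemma par_list_append: "par_list (Ps @ Qs) \<cong> Par (par_list Ps) (par_list Qs)"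
proof (induction Ps)
  case Nil
  show ?case by simp (meson scong.par_unit scong.par_comm scong.sym scong.trans)
next
  case (Cons P Ps)
  have "par_list (P # (Ps @ Qs)) \<cong> Par P (par_list (Ps @ Qs))" by (rule par_list_Cons)
  also have "\<dots> \<cong> Par P (Par (par_list Ps) (par_list Qs))"
    by (intro scong.cong_par scong.refl Cons)
  also have "\<dots> \<cong> Par (Par P (par_list Ps)) (par_list Qs)" by (rule scong.sym[OF scong.par_assoc])
  also have "\<dots> \<cong> Par (par_list (P # Ps)) (par_list Qs)"
    by (intro scong.cong_par scong.refl scong.sym[OF par_list_Cons])
  finally show ?case by simp
qed

lemma fn_par_list [simp]: "fn (par_list Ps) = (\<Union>P\<in>set Ps. fn P)"
  by (induction Ps rule: par_list.induct) auto

lemma subst_par_list: "subst \<sigma> (par_list Ps) = par_list (map (subst \<sigma>) Ps)"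
  by (induction Ps rule: par_list.induct) auto

lemma par_list_cong: "list_all2 (\<cong>) Ps Qs \<Longrightarrow> par_list Ps \<cong> par_list Qs"
proof (induction rule: list_all2_induct)
  case (Cons P Ps Q Qs)
  have "par_list (P # Ps) \<cong> Par P (par_list Ps)" by (rule par_list_Cons)
  also have "\<dots> \<cong> Par Q (par_list Qs)" using Cons by (intro scong.cong_par)
  also have "\<dots> \<cong> par_list (Q # Qs)" by (rule scong.sym[OF par_list_Cons])
  finally show ?case .
qed simp

lemma par_list_middle: "par_list (Ps @ Q # Qs) \<cong> Par Q (par_list (Ps @ Qs))"
proof -
  have "par_list (Ps @ Q # Qs) \<cong> Par (par_list Ps) (par_list (Q # Qs))" by (rule par_list_append)
  also have "\<dots> \<cong> Par (par_list (Q # Qs)) (par_list Ps)" by (rule scong.par_comm)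
  also have "\<dots> \<cong> par_list (Q # Qs @ Ps)"
    using scong.sym[OF par_list_append[of "Q # Qs" Ps]] by simp
  also have "\<dots> \<cong> Par Q (par_list (Qs @ Ps))" by (rule par_list_Cons)
  also have "\<dots> \<cong> Par Q (par_list (Ps @ Qs))"
    by (meson par_list_append scong.cong_par scong.par_comm scong.refl scong.sym scong.trans)
  finally show ?thesis .
qed

lemma par_list_perm: "mset Ps = mset Qs \<Longrightarrow> par_list Ps \<cong> par_list Qs"
proof (induction Ps arbitrary: Qs)
  case (Cons P Ps)
  then have "P \<in> set Qs" by (metis list.set_intros(1) set_mset_mset)
  then obtain As Bs where Qs_split: "Qs = As @ P # Bs" by (meson split_list)
  have "par_list (P # Ps) \<cong> Par P (par_list Ps)" by (rule par_list_Cons)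
  also have "\<dots> \<cong> Par P (par_list (As @ Bs))"
    using Cons.prems Qs_split by (intro scong.cong_par scong.refl Cons.IH) simp
  also have "\<dots> \<cong> par_list Qs" unfolding Qs_split by (rule scong.sym[OF par_list_middle])
  finally show ?case .
qed simp

lemma par_list_rel_mset:
  assumes "rel_mset (\<cong>) (mset Ps) (mset Qs)" shows "par_list Ps \<cong> par_list Qs"
proof -
  obtain Ps' Qs' where lists: "mset Ps' = mset Ps" "mset Qs' = mset Qs" "list_all2 (\<cong>) Ps' Qs'"
    using assms by (auto simp: rel_mset_def)
  have "par_list Ps \<cong> par_list Ps'" using lists by (intro par_list_perm) simp
  also have "\<dots> \<cong> par_list Qs'" using lists by (intro par_list_cong)
  also have "\<dots> \<cong> par_list Qs" using lists by (intro par_list_perm)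
  finally show ?thesis .
qed

abbreviation par_family :: "nat \<Rightarrow> (nat \<Rightarrow> proc) \<Rightarrow> proc" where
  "par_family n T \<equiv> par_list (map T [0..<n])"

lemma par_family_eq: "(\<And>i. i < n \<Longrightarrow> T i = U i) \<Longrightarrow> par_family n T = par_family n U"
  by (intro arg_cong[where f = par_list] map_cong) auto

lemma par_family_cong: "(\<And>i. i < n \<Longrightarrow> T i \<cong> U i) \<Longrightarrow> par_family n T \<cong> par_family n U"
  by (rule par_list_cong) (simp add: list_all2_conv_all_nth)

lemma mset_family: "mset (map T [0..<n]) = image_mset T (mset_set {..<n})"
  by (simp add: atLeast0LessThan)

lemma image_mset_fun_upd:
  assumes "finite A" "i \<in> A"
  shows "image_mset (T(i := y)) (mset_set A) = add_mset y (image_mset T (mset_set (A - {i})))"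
proof -
  have "image_mset (T(i := y)) (mset_set (A - {i})) = image_mset T (mset_set (A - {i}))"
    using assms(1) by (intro image_mset_cong) auto
  then show ?thesis using mset_set.remove[OF assms] by simp
qed

lemma image_mset_eq_add_msetE:
  assumes "image_mset T (mset_set A) = add_mset y M" "finite A"
  obtains i where "i \<in> A" "T i = y" "M = image_mset T (mset_set (A - {i}))"
proof -
  have "y \<in># image_mset T (mset_set A)" using assms(1) by simp
  then obtain i where "i \<in> A" "T i = y" using assms(2) by auto
  moreover have "M = image_mset T (mset_set (A - {i}))"
    using assms(1) image_mset_fun_upd[OF assms(2) \<open>i \<in> A\<close>, of T "T i"] \<open>T i = y\<close>
    unfolding fun_upd_triv by simp
  ultimately show thesis by (rule that)
qed

lemma par_family_fun_upd:
  assumes "i < n" "mset Rs = image_mset T (mset_set ({..<n} - {i}))"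
  shows "par_family n (T(i := P)) \<cong> Par P (par_list Rs)"
proof -
  have "mset (map (T(i := P)) [0..<n]) = mset (P # Rs)"
    unfolding mset_family using assms by (simp add: image_mset_fun_upd)
  then have "par_family n (T(i := P)) \<cong> par_list (P # Rs)" by (rule par_list_perm)
  also have "\<dots> \<cong> Par P (par_list Rs)" by (rule par_list_Cons)
  finally show ?thesis .
qed

lemma par_family_extrude:
  assumes "i < n" and unused: "\<And>j. j < n \<Longrightarrow> j \<noteq> i \<Longrightarrow> r \<notin> fn (T j)"
  shows "par_family n (T(i := Res r P)) \<cong> Res r (par_family n (T(i := P)))"
proof -
  obtain Rs where mset_Rs: "mset Rs = image_mset T (mset_set ({..<n} - {i}))" using ex_mset by blast
  then have "set Rs = T ` ({..<n} - {i})" by (simp flip: set_mset_mset)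
  then have fresh: "r \<notin> fn (par_list Rs)" using unused by auto
  have "par_family n (T(i := Res r P)) \<cong> Par (Res r P) (par_list Rs)"
    by (rule par_family_fun_upd[OF assms(1) mset_Rs])
  also have "\<dots> \<cong> Par (par_list Rs) (Res r P)" by (rule scong.par_comm)
  also have "\<dots> \<cong> Res r (Par (par_list Rs) P)"
    using fresh by (rule scong.sym[OF scong.res_extrude])
  also have "\<dots> \<cong> Res r (Par P (par_list Rs))" by (intro scong.cong_res scong.par_comm)
  also have "\<dots> \<cong> Res r (par_family n (T(i := P)))"
    by (intro scong.cong_res scong.sym[OF par_family_fun_upd[OF assms(1) mset_Rs]])
  finally show ?thesis .
qed

subsection \<open>Opening the top-level restrictions\<close>

definition abstraction_eq :: "name \<Rightarrow> proc \<Rightarrow> name \<Rightarrow> proc \<Rightarrow> bool" where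
  "abstraction_eq x P y Q \<longleftrightarrow> (\<forall>z. rename1 P z x \<cong> rename1 Q z y)"

lemma abstraction_eq_subst:
  assumes "\<And>z. subst (\<sigma>(x := z)) P \<cong> subst (\<tau>(y := z)) Q"
    and v_fresh: "v \<notin> \<sigma> ` (fn P - {x})" and w_fresh: "w \<notin> \<tau> ` (fn Q - {y})"
  shows "abstraction_eq v (subst (\<sigma>(x := v)) P) w (subst (\<tau>(y := w)) Q)"
  unfolding abstraction_eq_def
proof
  fix z
  have "rename1 (subst (\<sigma>(x := v)) P) z v \<cong> subst (\<sigma>(x := z)) P"
    using v_fresh by (rule rename1_subst_upd)
  also have "\<dots> \<cong> subst (\<tau>(y := z)) Q" by (rule assms(1))
  also have "\<dots> \<cong> rename1 (subst (\<tau>(y := w)) Q) z w"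
    using w_fresh by (rule scong.sym[OF rename1_subst_upd])
  finally show "rename1 (subst (\<sigma>(x := v)) P) z v \<cong> rename1 (subst (\<tau>(y := w)) Q) z w" .
qed

fun branch_eq :: "prefix \<times> proc \<Rightarrow> prefix \<times> proc \<Rightarrow> bool" where
  "branch_eq (Tau, P) (Tau, Q) \<longleftrightarrow> P \<cong> Q"
| "branch_eq (Send a b, P) (Send c d, Q) \<longleftrightarrow> a = c \<and> b = d \<and> P \<cong> Q"
| "branch_eq (Recv a x, P) (Recv b y, Q) \<longleftrightarrow> a = b \<and> abstraction_eq x P y Q"
| "branch_eq _ _ \<longleftrightarrow> False"

lemma branch_eq_refl: "branch_eq b b"
  by (cases "(b, b)" rule: branch_eq.cases) (auto simp: abstraction_eq_def)

lemma branch_eq_sym: "branch_eq b c \<Longrightarrow> branch_eq c b"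
  by (cases "(b, c)" rule: branch_eq.cases) (auto simp: abstraction_eq_def intro: scong.sym)

lemma branch_eq_trans: "branch_eq b c \<Longrightarrow> branch_eq c d \<Longrightarrow> branch_eq b d"
  by (cases "(b, c)" rule: branch_eq.cases; cases "(c, d)" rule: branch_eq.cases)
    (auto simp: abstraction_eq_def intro: scong.trans)

lemma abstraction_eq_branch_cong:
  assumes "abstraction_eq x P y Q" shows "branch_cong (Recv a x, P) (Recv a y, Q)"
proof -
  obtain z where z_fresh: "z \<notin> fn P" "z \<notin> fn Q" using ex_new_if_finite[of "fn P \<union> fn Q"] by auto
  have "branch_cong (Recv a x, P) (Recv a z, rename1 P z x)"
    using z_fresh(1) by (intro branch_cong_RecvI binding_alpha)
  also have "branch_cong \<dots> (Recv a z, rename1 Q z y)"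
    using assms by (intro branch_cong_continuation) (simp add: abstraction_eq_def)
  also have "branch_cong \<dots> (Recv a y, Q)"
    using z_fresh(2) by (intro branch_cong_sym[OF branch_cong_RecvI] binding_alpha)
  finally show ?thesis .
qed

lemma branch_eq_branch_cong: "branch_eq b c \<Longrightarrow> branch_cong b c"
  by (cases "(b, c)" rule: branch_eq.cases)
    (auto intro: branch_cong_continuation abstraction_eq_branch_cong)

text \<open>Guarded processes are equated only up to their continuations, so that a reaction of one of
  them is a reaction of the other.\<close>

fun guarded_eq :: "proc \<Rightarrow> proc \<Rightarrow> bool" where
  "guarded_eq (Call K as) (Call L bs) \<longleftrightarrow> K = L \<and> as = bs"
| "guarded_eq (Sum bs) (Sum cs) \<longleftrightarrow> list_all2 branch_eq bs cs"
| "guarded_eq _ _ \<longleftrightarrow> False"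

lemma guarded_eq_scong: "guarded_eq P Q \<Longrightarrow> P \<cong> Q"
  by (cases "(P, Q)" rule: guarded_eq.cases)
    (auto intro!: scong_Sum branch_eq_branch_cong elim: list_all2_mono)

lemma guarded_eq_refl: "is_call P \<or> is_choice P \<Longrightarrow> guarded_eq P P"
  by (cases P) (auto intro!: list_all2_refl branch_eq_refl)

lemma symp_guarded_eq: "symp guarded_eq"
proof (rule sympI)
  show "guarded_eq Q P" if "guarded_eq P Q" for P Q
    using that
    by (cases "(P, Q)" rule: guarded_eq.cases) (auto simp: list_all2_conv_all_nth branch_eq_sym)
qed

lemma transp_guarded_eq: "transp guarded_eq"
proof (rule transpI)
  fix P Q R assume eqs: "guarded_eq P Q" "guarded_eq Q R"
  then show "guarded_eq P R"
  proof (cases P)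
    case (Sum bs)
    with eqs obtain cs ds where "Q = Sum cs" "R = Sum ds" by (cases Q; cases R) auto
    then show ?thesis using eqs Sum list_all2_trans[OF branch_eq_trans] by auto
  next
    case (Call K as)
    with eqs show ?thesis by (cases Q) auto
  qed auto
qed

abbreviation components_eq :: "proc multiset \<Rightarrow> proc multiset \<Rightarrow> bool" where
  "components_eq \<equiv> rel_mset guarded_eq"

lemma components_eq_sym: "components_eq M N \<Longrightarrow> components_eq N M"
  using multiset.rel_symp[OF symp_guarded_eq] by (rule sympD)

lemma components_eq_trans: "components_eq M N \<Longrightarrow> components_eq N L \<Longrightarrow> components_eq M L"
  using multiset.rel_transp[OF transp_guarded_eq] by (rule transpD)

lemma components_eq_single: "guarded_eq P Q \<Longrightarrow> components_eq {#P#} {#Q#}"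
  by (simp add: rel_mset_Plus rel_mset_Zero)

lemma rel_mset_plus:
  "rel_mset R M M' \<Longrightarrow> rel_mset R N N' \<Longrightarrow> rel_mset R (M + N) (M' + N')"
  by (induction rule: rel_mset_induct) (auto intro: rel_mset_Plus)

definition fn_mset :: "proc multiset \<Rightarrow> name set" where
  "fn_mset M = (\<Union>P\<in>set_mset M. fn P)"

lemma fn_mset_simps [simp]:
  "fn_mset {#} = {}" "fn_mset (add_mset P M) = fn P \<union> fn_mset M"
  "fn_mset (M + N) = fn_mset M \<union> fn_mset N"
  by (auto simp: fn_mset_def)

lemma finite_fn_mset [simp]: "finite (fn_mset M)"
  by (simp add: fn_mset_def)

lemma fn_mset_mset: "fn_mset (mset Ps) = fn (par_list Ps)"
  by (simp add: fn_mset_def)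

lemma components_eq_fn_mset: "components_eq M N \<Longrightarrow> fn_mset M = fn_mset N"
  by (induction guarded_eq M N rule: rel_mset_induct) (auto dest!: guarded_eq_scong scong_fn)

definition opened :: "(name \<Rightarrow> name) \<Rightarrow> proc \<Rightarrow> proc multiset \<Rightarrow> name set" where
  "opened e P M = fn_mset M - e ` fn P"

definition apart :: "(name \<Rightarrow> name) \<Rightarrow> proc \<Rightarrow> proc multiset \<Rightarrow> proc \<Rightarrow> proc multiset \<Rightarrow> bool" where
  "apart e P M Q N \<longleftrightarrow> opened e P M \<inter> fn_mset N = {} \<and> opened e Q N \<inter> fn_mset M = {}"

lemma finite_opened [simp]: "finite (opened e P M)"
  by (simp add: opened_def)

text \<open>The multisets in \<open>openings e P\<close> are those of the guarded components of \<open>P\<close> under the renaming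
  \<open>e\<close> once the top-level restrictions have been given names of our choice.  The chosen names that
  matter are \<open>opened e P M\<close>; keeping them implicit disposes of unused restrictions.\<close>

fun openings :: "(name \<Rightarrow> name) \<Rightarrow> proc \<Rightarrow> proc multiset set" where
  "openings e (Call K as) = {{#Call K (map e as)#}}"
| "openings e (Sum bs) = {if bs = [] then {#} else {#subst e (Sum bs)#}}"
| "openings e (Res r P) = (\<Union>z\<in>- e ` (fn P - {r}). openings (e(r := z)) P)"
| "openings e (Par P Q) =
     {M + N | M N. M \<in> openings e P \<and> N \<in> openings e Q \<and> apart e P M Q N}"

declare openings.simps(2) [simp del]

lemma openings_Sum: "bs \<noteq> [] \<Longrightarrow> openings e (Sum bs) = {{#subst e (Sum bs)#}}"
  by (simp only: openings.simps if_False)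

lemma openings_Zero [simp]: "openings e Zero = {{#}}"
  by (simp add: openings.simps)

lemma openings_guarded_single:
  "is_call P \<or> is_choice P \<Longrightarrow> openings e P = {{#subst e P#}}"
  by (cases P) (auto simp: openings_Sum simp del: subst_Sum)

lemma openings_cong: "(\<And>x. x \<in> fn P \<Longrightarrow> e x = e' x) \<Longrightarrow> openings e P = openings e' P"
proof (induction P arbitrary: e e' rule: proc_induct)
  case (Call K as)
  then have "map e as = map e' as" by auto
  then show ?case by (simp only: openings.simps)
next
  case (Sum bs)
  then have "subst e (Sum bs) = subst e' (Sum bs)" by (intro subst_cong)
  then show ?case by (simp only: openings.simps)
next
  case (Res r P)
  have "openings (e(r := z)) P = openings (e'(r := z)) P" for z
    by (rule Res.IH) (use Res.prems in auto)
  moreover have "e ` (fn P - {r}) = e' ` (fn P - {r})"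
    by (rule image_cong) (use Res.prems in auto)
  ultimately show ?case by simp
next
  case (Par P Q)
  have "openings e P = openings e' P" "openings e Q = openings e' Q"
    by (rule Par.IH; use Par.prems in auto)+
  moreover have "e ` fn P = e' ` fn P" "e ` fn Q = e' ` fn Q"
    by (rule image_cong; use Par.prems in auto)+
  ultimately show ?case by (simp add: apart_def opened_def)
qed

lemma fn_subset_openings: "M \<in> openings e P \<Longrightarrow> e ` fn P \<subseteq> fn_mset M"
proof (induction P arbitrary: e M rule: proc_induct)
  case (Sum bs)
  have "fn (subst e (Sum bs)) = e ` fn (Sum bs)" by (rule fn_subst)
  with Sum show ?case by (cases "bs = []") (auto simp: openings_Sum)
next
  case (Res r P)
  then obtain z where "M \<in> openings (e(r := z)) P" by auto
  with Res.IH have "(e(r := z)) ` fn P \<subseteq> fn_mset M" by blast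
  moreover have "e ` (fn P - {r}) = (e(r := z)) ` (fn P - {r})" by (rule image_cong) auto
  ultimately show ?case by auto
next
  case (Par P Q)
  then show ?case by (fastforce simp: image_Un)
qed auto

lemma openings_guarded: "M \<in> openings e P \<Longrightarrow> Q \<in># M \<Longrightarrow> is_call Q \<or> is_choice Q"
proof (induction P arbitrary: e M rule: proc_induct)
  case (Sum bs)
  then show ?case by (cases "bs = []") (auto simp: openings_Sum)
qed auto

abbreviation openings_eq :: "proc multiset set \<Rightarrow> proc multiset set \<Rightarrow> bool" where
  "openings_eq \<equiv> rel_set components_eq"

lemma openings_eq_refl [simp]: "openings_eq (openings e P) (openings e P)"
  using openings_guarded guarded_eq_refl unfolding rel_set_def
  by (metis multiset.rel_refl_strong)

lemma openings_eq_sym: "openings_eq A B \<Longrightarrow> openings_eq B A"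
  unfolding rel_set_def using components_eq_sym by blast

lemma openings_eq_trans: "openings_eq A B \<Longrightarrow> openings_eq B C \<Longrightarrow> openings_eq A C"
  unfolding rel_set_def by (meson components_eq_trans)

lemma openings_eq_single: "guarded_eq P Q \<Longrightarrow> openings_eq {{#P#}} {{#Q#}}"
  by (simp add: rel_set_def components_eq_single)

lemma openings_Par_cong:
  assumes "openings_eq (openings e P) (openings e' P')"
    and "openings_eq (openings e Q) (openings e' Q')"
    and "e ` fn P = e' ` fn P'" "e ` fn Q = e' ` fn Q'"
  shows "openings_eq (openings e (Par P Q)) (openings e' (Par P' Q'))"
proof -
  have simulate: "\<exists>N\<in>openings e' (Par P' Q'). components_eq M N"
    if eqs: "openings_eq (openings e P) (openings e' P')"
        "openings_eq (openings e Q) (openings e' Q')"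
      and fns: "e ` fn P = e' ` fn P'" "e ` fn Q = e' ` fn Q'" and "M \<in> openings e (Par P Q)"
    for e e' P P' Q Q' M
  proof -
    from that(5) obtain M1 M2 where M_split: "M = M1 + M2" "M1 \<in> openings e P" "M2 \<in> openings e Q"
      and "apart e P M1 Q M2" by auto
    from M_split eqs obtain N1 N2 where N_split: "N1 \<in> openings e' P'" "N2 \<in> openings e' Q'"
      and comps: "components_eq M1 N1" "components_eq M2 N2" by (metis rel_setD1)
    have "apart e' P' N1 Q' N2"
      using \<open>apart e P M1 Q M2\<close> fns comps[THEN components_eq_fn_mset]
      by (simp add: apart_def opened_def)
    then have "N1 + N2 \<in> openings e' (Par P' Q')" using N_split by auto
    moreover have "components_eq M (N1 + N2)" unfolding M_split using comps by (rule rel_mset_plus)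
    ultimately show ?thesis by blast
  qed
  have "\<exists>M\<in>openings e (Par P Q). components_eq N M" if "N \<in> openings e' (Par P' Q')" for N
    using assms that by (intro simulate[of e' P' e P Q' Q]) (auto intro: openings_eq_sym)
  then show ?thesis
    using simulate[OF assms] unfolding rel_set_def by (blast intro: components_eq_sym)
qed

lemma rel_set_UN:
  "(\<And>x. x \<in> A \<Longrightarrow> rel_set R (X x) (Y x)) \<Longrightarrow> rel_set R (\<Union>x\<in>A. X x) (\<Union>x\<in>A. Y x)"
  by (intro rel_setI) (fast dest: rel_setD1 rel_setD2)+

lemma openings_Res_cong:
  assumes "\<And>z. openings_eq (openings (e(r := z)) P) (openings (e'(s := z)) Q)"
    and "e ` (fn P - {r}) = e' ` (fn Q - {s})"
  shows "openings_eq (openings e (Res r P)) (openings e' (Res s Q))"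
  unfolding openings.simps assms(2) by (intro rel_set_UN assms(1))

lemma branch_eq_subst_comp:
  "branch_eq (subst_branch e (subst_branch \<sigma> b)) (subst_branch (e \<circ> \<sigma>) b)"
proof -
  obtain \<pi> P where b_eq: "b = (\<pi>, P)" by force
  show ?thesis
  proof (cases \<pi>)
    case (Recv a x)
    show ?thesis unfolding b_eq Recv subst_branch.simps branch_eq.simps comp_apply[of e \<sigma> a]
      by (intro conjI HOL.refl abstraction_eq_subst subst_upd_subst_upd bound_name_fresh)
  qed (auto simp: b_eq intro!: subst_comp)
qed

lemma openings_subst: "openings_eq (openings e (subst \<sigma> P)) (openings (e \<circ> \<sigma>) P)"
proof (induction P arbitrary: e \<sigma> rule: proc_induct)
  case (Call K as)
  have "openings e (subst \<sigma> (Call K as)) = openings (e \<circ> \<sigma>) (Call K as)" by simp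
  then show ?case by (simp only: openings_eq_refl)
next
  case (Sum bs)
  show ?case
  proof (cases "bs = []")
    case False
    have "guarded_eq (subst e (subst \<sigma> (Sum bs))) (subst (e \<circ> \<sigma>) (Sum bs))"
      by (simp add: list_all2_conv_all_nth branch_eq_subst_comp)
    then have "openings_eq {{#subst e (subst \<sigma> (Sum bs))#}} {{#subst (e \<circ> \<sigma>) (Sum bs)#}}"
      by (rule openings_eq_single)
    then show ?thesis
      using False by (simp only: openings_Sum subst_Sum[of \<sigma>] list.map_disc_iff not_False_eq_True)
  qed (simp add: rel_set_def rel_mset_Zero)
next
  case (Res r P)
  define x where "x = bound_name \<sigma> r P"
  have fresh: "x \<notin> \<sigma> ` (fn P - {r})" unfolding x_def by (rule bound_name_fresh)
  have "openings_eq (openings (e(x := z)) (subst (\<sigma>(r := x)) P)) (openings ((e \<circ> \<sigma>)(r := z)) P)"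
    for z
  proof -
    have "openings (e(x := z) \<circ> \<sigma>(r := x)) P = openings ((e \<circ> \<sigma>)(r := z)) P"
      by (rule openings_cong) (use fresh in auto)
    with Res.IH[of "e(x := z)" "\<sigma>(r := x)"] show ?thesis by (simp only:)
  qed
  moreover have "e ` (fn (subst (\<sigma>(r := x)) P) - {x}) = (e \<circ> \<sigma>) ` (fn P - {r})"
    unfolding fn_subst image_upd_fresh[OF fresh] by (simp add: image_comp)
  ultimately show ?case unfolding subst_Res x_def[symmetric] by (rule openings_Res_cong)
next
  case (Par P Q)
  then show ?case
    by (simp only: subst.simps) (intro openings_Par_cong; simp add: image_comp comp_def)
qed

lemma openings_Res_unused:
  assumes "r \<notin> fn P" shows "openings e (Res r P) = openings e P"
proof -
  have "openings (e(r := z)) P = openings e P" for z by (rule openings_cong) (use assms in auto)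
  then show ?thesis using ex_new_if_finite[of "e ` (fn P - {r})"] by auto
qed

lemma openings_Res_eq:
  "(\<And>e. openings e P = openings e Q) \<Longrightarrow> fn P = fn Q \<Longrightarrow> openings e (Res r P) = openings e (Res r Q)"
  by simp

lemma openings_Res_swap_subset:
  assumes "r \<noteq> s" "r \<in> fn P" "s \<in> fn P"
  shows "openings e (Res r (Res s P)) \<subseteq> openings e (Res s (Res r P))"
proof
  fix M assume "M \<in> openings e (Res r (Res s P))"
  then obtain z w where z_fresh: "z \<notin> e ` (fn P - {s} - {r})"
    and w_fresh: "w \<notin> (e(r := z)) ` (fn P - {s})" and "M \<in> openings (e(r := z, s := w)) P"
      by (auto simp del: fun_upd_apply)
  then have M_opening: "M \<in> openings (e(s := w, r := z)) P"
    by (simp only: fun_upd_twist[OF assms(1)])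
  have "z \<noteq> w" using w_fresh assms by auto
  then have "w \<notin> e ` (fn P - {r} - {s})" "z \<notin> (e(s := w)) ` (fn P - {r})"
    using z_fresh w_fresh by auto
  with M_opening show "M \<in> openings e (Res s (Res r P))" by auto
qed

lemma openings_Res_swap: "openings e (Res r (Res s P)) = openings e (Res s (Res r P))"
proof -
  have unused: "openings e (Res r (Res s P)) = openings e (Res s (Res r P))" if "r \<notin> fn P" for r s e
  proof -
    have "openings e (Res r (Res s P)) = openings e (Res s P)"
      using that by (intro openings_Res_unused) simp
    also have "\<dots> = openings e (Res s (Res r P))"
      using that openings_Res_unused[of r P] by (intro openings_Res_eq) simp_all
    finally show ?thesis .
  qed
  consider "r = s" | "r \<notin> fn P" | "s \<notin> fn P" | "r \<noteq> s" "r \<in> fn P" "s \<in> fn P" by blast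
  then show ?thesis
  proof cases
    assume "r \<noteq> s" "r \<in> fn P" "s \<in> fn P"
    then show ?thesis by (intro equalityI openings_Res_swap_subset) auto
  qed (use unused in blast)+
qed

lemma openings_extrude:
  assumes r_fresh: "r \<notin> fn P"
  shows "openings e (Res r (Par P Q)) = openings e (Par P (Res r Q))"
proof (cases "r \<in> fn Q")
  case True
  have in_P: "openings (e(r := z)) P = openings e P" "(e(r := z)) ` fn P = e ` fn P" for z
    using r_fresh by (auto intro!: openings_cong)
  have in_Q: "(e(r := z)) ` fn Q = insert z (e ` (fn Q - {r}))" for z using True by auto
  have fn_PQ: "fn P \<union> fn Q - {r} = fn P \<union> (fn Q - {r})" using r_fresh by auto
  have "(z \<notin> e ` (fn (Par P Q) - {r}) \<and> apart (e(r := z)) P M Q N) \<longleftrightarrow>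
      (z \<notin> e ` (fn Q - {r}) \<and> apart e P M (Res r Q) N)"
    if "M \<in> openings e P" "N \<in> openings (e(r := z)) Q" for z M N
  proof -
    have "e ` fn P \<subseteq> fn_mset M" using that(1) by (rule fn_subset_openings)
    moreover have "insert z (e ` (fn Q - {r})) \<subseteq> fn_mset N"
      using fn_subset_openings[OF that(2)] unfolding in_Q .
    ultimately show ?thesis
      unfolding apart_def opened_def fn.simps fn_PQ image_Un in_P in_Q by blast
  qed
  note freshness = this
  have "openings e (Res r (Par P Q)) = {M + N | z M N. M \<in> openings e P \<and>
      N \<in> openings (e(r := z)) Q \<and> z \<notin> e ` (fn (Par P Q) - {r}) \<and> apart (e(r := z)) P M Q N}"
    by (auto simp: in_P(1) simp del: fun_upd_apply)
  also have "\<dots> = {M + N | z M N. M \<in> openings e P \<and>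
      N \<in> openings (e(r := z)) Q \<and> z \<notin> e ` (fn Q - {r}) \<and> apart e P M (Res r Q) N}"
    using freshness by blast
  also have "\<dots> = openings e (Par P (Res r Q))" by (auto simp del: fun_upd_apply)
  finally show ?thesis .
next
  case False
  then have "openings e (Res r (Par P Q)) = openings e (Par P Q)"
    using r_fresh by (intro openings_Res_unused) simp
  moreover have "openings e (Res r Q) = openings e Q" "fn (Res r Q) = fn Q"
    using False openings_Res_unused by simp_all
  ultimately show ?thesis by (simp add: apart_def opened_def del: openings.simps(3))
qed

lemma openings_Par_comm: "openings e (Par P Q) = openings e (Par Q P)"
proof -
  have "openings e (Par P Q) \<subseteq> openings e (Par Q P)" for P Q
  proof
    fix M assume "M \<in> openings e (Par P Q)"
    then obtain M1 M2 where "M = M2 + M1" "M1 \<in> openings e P" "M2 \<in> openings e Q"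
      "apart e Q M2 P M1" by (auto simp: apart_def add.commute)
    then show "M \<in> openings e (Par Q P)" by auto
  qed
  then show ?thesis by blast
qed

lemma openings_Par_assoc_subset:
  "openings e (Par (Par P Q) R) \<subseteq> openings e (Par P (Par Q R))"
proof
  fix M assume "M \<in> openings e (Par (Par P Q) R)"
  then obtain M1 M2 M3 where M_split: "M = (M1 + M2) + M3"
    and mem: "M1 \<in> openings e P" "M2 \<in> openings e Q" "M3 \<in> openings e R"
    and apart: "apart e P M1 Q M2" "apart e (Par P Q) (M1 + M2) R M3" by auto
  have "apart e Q M2 R M3" "apart e P M1 (Par Q R) (M2 + M3)"
    using apart mem[THEN fn_subset_openings]
    unfolding apart_def opened_def fn_mset_simps fn.simps image_Un by blast+
  then have "M1 + (M2 + M3) \<in> openings e (Par P (Par Q R))" using mem by auto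
  then show "M \<in> openings e (Par P (Par Q R))" by (simp only: M_split add.assoc)
qed

lemma openings_Par_assoc: "openings e (Par (Par P Q) R) = openings e (Par P (Par Q R))"
proof
  have comm_left: "openings e (Par (Par P Q) R) = openings e (Par (Par Q P) R)" for P Q R
    unfolding openings.simps(4)[of e _ R] openings_Par_comm[of e P Q] apart_def opened_def fn.simps
    by (simp only: Un_commute)
  have "openings e (Par P (Par Q R)) = openings e (Par (Par R Q) P)"
    by (simp only: openings_Par_comm[of e P] comm_left[of Q])
  also have "\<dots> \<subseteq> openings e (Par R (Par Q P))" by (rule openings_Par_assoc_subset)
  also have "\<dots> = openings e (Par (Par P Q) R)"
    by (simp only: openings_Par_comm[of e R] comm_left[of Q])
  finally show "openings e (Par P (Par Q R)) \<subseteq> openings e (Par (Par P Q) R)" .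
qed (rule openings_Par_assoc_subset)

lemma openings_Par_Zero: "openings e (Par P Zero) = openings e P"
  using fn_subset_openings by (auto simp: apart_def opened_def)

lemma openings_Sum_cong:
  assumes "branch_eq (subst_branch e b) (subst_branch e c)"
  shows "openings_eq (openings e (Sum (bs @ b # cs))) (openings e (Sum (bs @ c # cs)))"
proof -
  have "list_all2 branch_eq (map (subst_branch e) (bs @ b # cs))
      (map (subst_branch e) (bs @ c # cs))"
    using assms by (auto simp: list_all2_append list_all2_refl branch_eq_refl)
  then show ?thesis by (simp add: openings_Sum openings_eq_single)
qed

lemma branch_eq_subst_scong:
  "P \<cong> Q \<Longrightarrow> branch_eq (subst_branch e (\<pi>, P)) (subst_branch e (\<pi>, Q))"
  using scong_fn[of P Q]
  by (cases \<pi>) (auto simp: bound_name_def abstraction_eq_def intro!: scong_subst)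

lemma branch_eq_subst_alpha:
  "z \<notin> fn P \<Longrightarrow>
    branch_eq (subst_branch e (Recv a x, P)) (subst_branch e (Recv a z, rename1 P z x))"
  unfolding subst_branch.simps branch_eq.simps
  by (intro conjI HOL.refl abstraction_eq_subst scong.sym[OF subst_upd_rename1] bound_name_fresh)

lemma openings_Res_alpha:
  assumes "z \<notin> fn P"
  shows "openings_eq (openings e (Res r P)) (openings e (Res z (rename1 P z r)))"
proof (rule openings_Res_cong)
  fix w
  have "openings (e(z := w) \<circ> id(r := z)) P = openings (e(r := w)) P"
    by (rule openings_cong) (use assms in auto)
  with openings_eq_sym[OF openings_subst[of "e(z := w)" "id(r := z)" P]]
  show "openings_eq (openings (e(r := w)) P) (openings (e(z := w)) (rename1 P z r))" by simp
qed (use fn_rename1_Diff[OF assms] in auto)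

lemma scong_openings: "P \<cong> Q \<Longrightarrow> openings_eq (openings e P) (openings e Q)"
proof (induction arbitrary: e rule: scong.induct)
  case (sym P Q)
  then show ?case by (blast intro: openings_eq_sym)
next
  case (trans P Q R)
  then show ?case by (blast intro: openings_eq_trans)
next
  case (cong_sum P Q bs \<pi> cs)
  then show ?case by (intro openings_Sum_cong branch_eq_subst_scong)
next
  case (cong_res P Q r)
  then show ?case using scong_fn[OF cong_res.hyps] by (intro openings_Res_cong) auto
next
  case (cong_par P P' Q Q')
  then show ?case using cong_par.hyps[THEN scong_fn] by (intro openings_Par_cong) auto
next
  case (alpha_res z P r)
  then show ?case by (rule openings_Res_alpha)
next
  case (alpha_recv z P bs a x cs)
  then show ?case by (intro openings_Sum_cong branch_eq_subst_alpha)
next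
  case (par_assoc P Q R)
  show ?case by (simp only: openings_Par_assoc openings_eq_refl)
next
  case (par_comm P Q)
  show ?case by (simp only: openings_Par_comm[of e P] openings_eq_refl)
next
  case (res_zero r)
  have "openings e (Res r Zero) = openings e Zero" by (rule openings_Res_unused) simp
  then show ?case by (simp only: openings_eq_refl)
next
  case (res_swap r s P)
  show ?case by (simp only: openings_Res_swap[of e r] openings_eq_refl)
next
  case (res_extrude r P Q)
  show ?case by (simp only: openings_extrude[OF res_extrude] openings_eq_refl)
qed (simp_all only: openings_Par_Zero openings_eq_refl)

lemma subst_Par_opened:
  assumes P'_opened: "subst e P' \<cong> nu (opened e P M) (par_list Us)"
    and Q'_opened: "subst e Q' \<cong> nu (opened e Q N) (par_list Vs)"
    and fn_Us: "fn_mset (mset Us) \<subseteq> fn_mset M" and fn_Vs: "fn_mset (mset Vs) \<subseteq> fn_mset N"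
    and M_opening: "M \<in> openings e P" and N_opening: "N \<in> openings e Q" and apart: "apart e P M Q N"
  shows "subst e (Par P' Q') \<cong> nu (opened e (Par P Q) (M + N)) (par_list (Us @ Vs))"
proof -
  let ?A = "opened e P M" and ?B = "opened e Q N"
  have "subst e (Par P' Q') \<cong> Par (nu ?A (par_list Us)) (nu ?B (par_list Vs))"
    using P'_opened Q'_opened by (simp add: scong.cong_par)
  also have "\<dots> \<cong> nu (?A \<union> ?B) (Par (par_list Us) (par_list Vs))"
    using apart fn_Us fn_Vs
    by (intro Par_nu_nu) (auto simp: apart_def fn_mset_mset simp del: fn_par_list)
  also have "?A \<union> ?B = opened e (Par P Q) (M + N)"
    using apart fn_subset_openings[OF M_opening] fn_subset_openings[OF N_opening]
    by (auto simp: apart_def opened_def image_Un)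
  also have "nu \<dots> (Par (par_list Us) (par_list Vs)) \<cong> nu \<dots> (par_list (Us @ Vs))"
    by (intro nu_cong scong.sym[OF par_list_append])
  finally show ?thesis .
qed

lemma subst_Res_opened:
  assumes "subst (e(r := z)) P' \<cong> nu (opened (e(r := z)) P M) (par_list Ps)"
    and "fn P' \<subseteq> fn P" and "fn_mset (mset Ps) \<subseteq> fn_mset M" and z_fresh: "z \<notin> e ` (fn P - {r})"
  shows "subst e (Res r P') \<cong> nu (opened e (Res r P) M) (par_list Ps)"
proof -
  let ?B = "opened (e(r := z)) P M"
  have "subst e (Res r P') \<cong> Res z (subst (e(r := z)) P')"
    using z_fresh assms(2) by (intro subst_Res_fresh) auto
  also have "\<dots> \<cong> Res z (nu ?B (par_list Ps))" by (intro scong.cong_res assms(1))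
  also have "\<dots> \<cong> nu (insert z ?B) (par_list Ps)" by (rule scong.sym[OF nu_insert]) simp
  also have "\<dots> \<cong> nu (opened e (Res r P) M) (par_list Ps)"
    by (rule nu_cong_set)
      (use z_fresh assms(3) in \<open>auto simp: opened_def fn_mset_mset simp del: fn_par_list\<close>)
  finally show ?thesis .
qed

lemma openings_sound:
  "mset Ps \<in> openings e P \<Longrightarrow> subst e P \<cong> nu (opened e P (mset Ps)) (par_list Ps)"
proof (induction P arbitrary: e Ps rule: proc_induct)
  case (Call K as)
  then show ?case by (simp add: opened_def)
next
  case (Sum bs)
  show ?case
  proof (cases "bs = []")
    case False
    then have Ps_eq: "Ps = [subst e (Sum bs)]" using Sum by (simp add: openings_Sum)
    have "opened e (Sum bs) (mset Ps) = {}"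
      unfolding opened_def Ps_eq by (simp del: subst_Sum fn_Sum)
    then show ?thesis by (simp only: nu_empty Ps_eq par_list.simps scong.refl)
  qed (use Sum in \<open>simp add: opened_def\<close>)
next
  case (Res r P)
  then obtain z where z_opening: "z \<notin> e ` (fn P - {r})" "mset Ps \<in> openings (e(r := z)) P" by auto
  show ?case
    by (rule subst_Res_opened[OF Res.IH[OF z_opening(2)] _ _ z_opening(1)]) simp_all
next
  case (Par P Q)
  then obtain M N where M_opening: "M \<in> openings e P" and N_opening: "N \<in> openings e Q"
    and apart: "apart e P M Q N" and Ps_eq: "mset Ps = M + N" by auto
  obtain Us Vs where mset_Us_Vs: "mset Us = M" "mset Vs = N" by (meson ex_mset)
  have "subst e (Par P Q) \<cong> nu (opened e (Par P Q) (M + N)) (par_list (Us @ Vs))"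
    using Par.IH M_opening N_opening apart mset_Us_Vs by (intro subst_Par_opened) auto
  also have "\<dots> \<cong> nu (opened e (Par P Q) (M + N)) (par_list Ps)"
    by (intro nu_cong par_list_perm) (simp add: mset_Us_Vs Ps_eq)
  finally show ?case by (simp only: Ps_eq)
qed

subsection \<open>Inversion of reactions\<close>

inductive mset_react :: "equation list \<Rightarrow> proc multiset \<Rightarrow> proc multiset \<Rightarrow> bool"
  for E :: "equation list" where
  tau: "(Tau, S) \<in> set bs \<Longrightarrow> mset_react E (add_mset (Sum bs) M) (add_mset S M)"
| call: "(K, fs, S) \<in> set E \<Longrightarrow> length as = length fs \<Longrightarrow>
    mset_react E (add_mset (Call K as) M) (add_mset (subst_map (map_of (zip fs as)) S) M)"
| comm: "(Recv x y, S\<^sub>1) \<in> set bs \<Longrightarrow> (Send x z, S\<^sub>2) \<in> set cs \<Longrightarrow>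
    mset_react E (add_mset (Sum bs) (add_mset (Sum cs) M))
      (add_mset (rename1 S\<^sub>1 z y) (add_mset S\<^sub>2 M))"

lemma mset_react_plus: "mset_react E M M' \<Longrightarrow> mset_react E (M + N) (M' + N)"
  by (induction rule: mset_react.induct) (auto intro: mset_react.intros)

definition closed_eqs :: "equation list \<Rightarrow> bool" where
  "closed_eqs E \<longleftrightarrow> (\<forall>(K, fs, S)\<in>set E. fn S \<subseteq> set fs)"

lemma closed_eqsD: "closed_eqs E \<Longrightarrow> (K, fs, S) \<in> set E \<Longrightarrow> fn S \<subseteq> set fs"
  by (auto simp: closed_eqs_def)

lemma fn_branch_subset:
  "(\<pi>, S) \<in> set bs \<Longrightarrow> prefix_free \<pi> \<union> (fn S - prefix_bound \<pi>) \<subseteq> fn (Sum bs)"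
  by (force simp: branch_fn_def)

lemma fn_instantiated_subset:
  assumes "fn S \<subseteq> set fs" "length as = length fs"
  shows "fn (subst_map (map_of (zip fs as)) S) \<subseteq> set as"
proof
  fix y assume "y \<in> fn (subst_map (map_of (zip fs as)) S)"
  then obtain x where x_subst: "x \<in> fn S"
    "y = (case map_of (zip fs as) x of None \<Rightarrow> x | Some a \<Rightarrow> a)" by (auto simp: subst_map_def)
  then obtain a where "map_of (zip fs as) x = Some a" using assms
    by (metis map_of_zip_is_Some subsetD)
  with x_subst show "y \<in> set as" by (auto dest: map_of_SomeD set_zip_rightD)
qed

lemma fn_comm_subset:
  assumes "(Recv x y, S\<^sub>1) \<in> set bs" "(Send x z, S\<^sub>2) \<in> set cs"
  shows "fn (rename1 S\<^sub>1 z y) \<union> fn S\<^sub>2 \<subseteq> fn (Sum bs) \<union> fn (Sum cs)"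
  using fn_branch_subset[OF assms(1)] fn_branch_subset[OF assms(2)] by (auto simp del: fn_Sum)

lemma mset_react_fn_mset:
  assumes "closed_eqs E" "mset_react E M M'"
  shows "fn_mset M' \<subseteq> fn_mset M"
  using assms(2)
proof cases
  case (tau S bs N)
  then show ?thesis using fn_branch_subset[of Tau S bs] by auto
next
  case (call K fs S as N)
  then show ?thesis
    using fn_instantiated_subset[OF closed_eqsD[OF assms(1) call(3)] call(4)] by auto
next
  case (comm x y S\<^sub>1 bs z S\<^sub>2 cs N)
  then show ?thesis
    using fn_comm_subset[OF comm(3,4)] by (simp del: fn_Sum fn_subst) blast
qed

lemma react_fn: "react E P Q \<Longrightarrow> closed_eqs E \<Longrightarrow> fn Q \<subseteq> fn P"
proof (induction rule: react.induct)
  case (tau S bs)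
  then show ?case using fn_branch_subset[of Tau S bs] by simp
next
  case (call K fs S as)
  then show ?case using fn_instantiated_subset[OF closed_eqsD] by fastforce
next
  case (comm x y S\<^sub>1 bs z S\<^sub>2 cs)
  then show ?case using fn_comm_subset by (simp only: fn.simps)
next
  case (struct P P' Q' Q)
  then show ?case using scong_fn by metis
qed auto

lemma branch_eq_TauD: "branch_eq (Tau, S) c \<Longrightarrow> \<exists>T. c = (Tau, T) \<and> S \<cong> T"
  and branch_eq_SendD: "branch_eq (Send a b, S) c \<Longrightarrow> \<exists>T. c = (Send a b, T) \<and> S \<cong> T"
  and branch_eq_RecvD:
    "branch_eq (Recv a x, S) c \<Longrightarrow> \<exists>y T. c = (Recv a y, T) \<and> abstraction_eq x S y T"
  by (cases c; cases "fst c"; auto)+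

lemma guarded_eq_SumE:
  assumes "guarded_eq (Sum bs) Q" "b \<in> set bs"
  obtains cs c where "Q = Sum cs" "c \<in> set cs" "branch_eq b c"
proof (cases Q)
  case (Sum cs)
  with assms have "list_all2 branch_eq bs cs" by simp
  with assms(2) obtain c where "c \<in> set cs" "branch_eq b c"
    by (metis in_set_conv_nth list_all2_conv_all_nth)
  with Sum that show ?thesis by blast
qed (use assms in auto)

lemma guarded_eq_CallD: "guarded_eq (Call K as) Q \<Longrightarrow> Q = Call K as"
  by (cases Q) auto

lemma components_eq_rel_scong: "components_eq M N \<Longrightarrow> rel_mset (\<cong>) M N"
  by (erule multiset.rel_mono_strong) (rule guarded_eq_scong)

lemma mset_react_components_eq:
  assumes "mset_react E M M'" "components_eq M N"
  shows "\<exists>N'. mset_react E N N' \<and> rel_mset (\<cong>) M' N'"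
  using assms(1)
proof cases
  case (tau S bs M0)
  with assms(2) obtain Q N0 where N_eq: "N = add_mset Q N0" "guarded_eq (Sum bs) Q"
    and rest: "components_eq M0 N0" using msed_rel_invL by metis
  with tau obtain cs T where Q_branch: "Q = Sum cs" "(Tau, T) \<in> set cs" "S \<cong> T"
    by (metis branch_eq_TauD guarded_eq_SumE)
  then have "mset_react E N (add_mset T N0)" using N_eq by (auto intro: mset_react.tau)
  moreover have "rel_mset (\<cong>) M' (add_mset T N0)"
    unfolding tau by (intro rel_mset_Plus Q_branch components_eq_rel_scong rest)
  ultimately show ?thesis by blast
next
  case (call K fs S as M0)
  with assms(2) obtain Q N0 where N_eq: "N = add_mset Q N0" "guarded_eq (Call K as) Q"
    and rest: "components_eq M0 N0" using msed_rel_invL by metis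
  then have "mset_react E N (add_mset (subst_map (map_of (zip fs as)) S) N0)"
    using call guarded_eq_CallD by (auto intro: mset_react.call)
  moreover have "rel_mset (\<cong>) M' (add_mset (subst_map (map_of (zip fs as)) S) N0)"
    unfolding call by (intro rel_mset_Plus scong.refl components_eq_rel_scong rest)
  ultimately show ?thesis by blast
next
  case (comm x y S\<^sub>1 bs z S\<^sub>2 cs M0)
  with assms(2) obtain Q N1 where N_eq: "N = add_mset Q N1" "guarded_eq (Sum bs) Q"
    "components_eq (add_mset (Sum cs) M0) N1" using msed_rel_invL by metis
  then obtain Q' N0 where N1_eq: "N1 = add_mset Q' N0" "guarded_eq (Sum cs) Q'"
    and rest: "components_eq M0 N0" using msed_rel_invL by metis
  from N_eq(2) comm obtain bs' y' T\<^sub>1 where Q_branch: "Q = Sum bs'" "(Recv x y', T\<^sub>1) \<in> set bs'"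
    "rename1 S\<^sub>1 z y \<cong> rename1 T\<^sub>1 z y'" by (metis abstraction_eq_def branch_eq_RecvD guarded_eq_SumE)
  from N1_eq(2) comm obtain cs' T\<^sub>2 where Q'_branch: "Q' = Sum cs'"
    "(Send x z, T\<^sub>2) \<in> set cs'" "S\<^sub>2 \<cong> T\<^sub>2" by (metis branch_eq_SendD guarded_eq_SumE)
  have "mset_react E N (add_mset (rename1 T\<^sub>1 z y') (add_mset T\<^sub>2 N0))"
    unfolding N_eq N1_eq Q_branch Q'_branch using Q_branch(2) Q'_branch(2) by (rule mset_react.comm)
  moreover have "rel_mset (\<cong>) M' (add_mset (rename1 T\<^sub>1 z y') (add_mset T\<^sub>2 N0))"
    unfolding comm by (intro rel_mset_Plus Q_branch Q'_branch components_eq_rel_scong rest)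
  ultimately show ?thesis by blast
qed

lemma subst_instantiated:
  assumes "fn S \<subseteq> set fs" "length as = length fs"
  shows "subst e (subst_map (map_of (zip fs as)) S) \<cong> subst_map (map_of (zip fs (map e as))) S"
proof -
  let ?inst = "\<lambda>as x. case map_of (zip fs as) x of None \<Rightarrow> x | Some a \<Rightarrow> a"
  have "subst e (subst (?inst as) S) \<cong> subst (e \<circ> ?inst as) S" by (rule subst_comp)
  also have "\<dots> = subst (?inst (map e as)) S"
  proof (rule subst_cong)
    fix x assume "x \<in> fn S"
    then obtain a where "map_of (zip fs as) x = Some a"
      using assms by (metis map_of_zip_is_Some subsetD)
    moreover have "map_of (zip fs (map e as)) x = map_option e (map_of (zip fs as) x)"
      using assms(2)[symmetric] by (induction fs as rule: list_induct2) auto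
    ultimately show "(e \<circ> ?inst as) x = ?inst (map e as) x" by simp
  qed
  finally show ?thesis unfolding subst_map_def .
qed

definition opened_react ::
  "equation list \<Rightarrow> (name \<Rightarrow> name) \<Rightarrow> proc \<Rightarrow> proc multiset \<Rightarrow> proc \<Rightarrow> bool" where
  "opened_react E e P M Q \<longleftrightarrow>
     (\<exists>Ps. mset_react E M (mset Ps) \<and> subst e Q \<cong> nu (opened e P M) (par_list Ps))"

lemma subst_branch_mem: "b \<in> set bs \<Longrightarrow> subst_branch e b \<in> set (map (subst_branch e) bs)"
  by simp

lemma opened_react_tau:
  assumes "(Tau, S) \<in> set bs"
  shows "opened_react E e (Sum bs) {#subst e (Sum bs)#} S"
proof -
  have "mset_react E {#subst e (Sum bs)#} (mset [subst e S])"
    using mset_react.tau[where M = "{#}"] subst_branch_mem[OF assms, of e] by simp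
  moreover have "opened e (Sum bs) {#subst e (Sum bs)#} = {}"
    by (simp add: opened_def del: subst_Sum fn_Sum)
  ultimately show ?thesis
    unfolding opened_react_def by (intro exI[of _ "[subst e S]"]) simp
qed

lemma opened_react_call:
  assumes "(K, fs, S) \<in> set E" "length as = length fs" "fn S \<subseteq> set fs"
  shows "opened_react E e (Call K as) {#Call K (map e as)#} (subst_map (map_of (zip fs as)) S)"
proof -
  let ?S = "subst_map (map_of (zip fs (map e as))) S"
  have "mset_react E {#Call K (map e as)#} (mset [?S])"
    using mset_react.call[OF assms(1), of "map e as" "{#}"] assms(2) by simp
  moreover have "subst e (subst_map (map_of (zip fs as)) S) \<cong> ?S"
    using assms(3,2) by (rule subst_instantiated)
  ultimately show ?thesis
    unfolding opened_react_def by (intro exI[of _ "[?S]"]) (simp add: opened_def)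
qed

lemma opened_react_comm:
  assumes "(Recv x y, S\<^sub>1) \<in> set bs" "(Send x z, S\<^sub>2) \<in> set cs"
  shows "opened_react E e (Par (Sum bs) (Sum cs)) {#subst e (Sum bs), subst e (Sum cs)#}
    (Par (rename1 S\<^sub>1 z y) S\<^sub>2)"
proof -
  let ?y = "bound_name e y S\<^sub>1"
  let ?S\<^sub>1 = "rename1 (subst (e(y := ?y)) S\<^sub>1) (e z) ?y"
  have "mset_react E {#subst e (Sum bs), subst e (Sum cs)#} (mset [?S\<^sub>1, subst e S\<^sub>2])"
    using assms[THEN subst_branch_mem, of e] mset_react.comm[where M = "{#}"] by simp
  moreover have "subst e (Par (rename1 S\<^sub>1 z y) S\<^sub>2) \<cong> par_list [?S\<^sub>1, subst e S\<^sub>2]"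
  proof -
    have "subst e (rename1 S\<^sub>1 z y) \<cong> subst (e \<circ> id(y := z)) S\<^sub>1" by (rule subst_comp)
    also have "e \<circ> id(y := z) = e(y := e z)" by auto
    also have "subst (e(y := e z)) S\<^sub>1 \<cong> ?S\<^sub>1"
      by (rule scong.sym[OF rename1_subst_upd]) (rule bound_name_fresh)
    finally show ?thesis unfolding subst.simps par_list.simps by (intro scong.cong_par scong.refl)
  qed
  moreover have "opened e (Par (Sum bs) (Sum cs)) {#subst e (Sum bs), subst e (Sum cs)#} = {}"
    by (auto simp: opened_def image_Un simp del: subst_Sum fn_Sum)
  ultimately show ?thesis unfolding opened_react_def by (metis nu_empty)
qed

lemma opened_react_Par:
  assumes "closed_eqs E" and react: "opened_react E e P M P'"
    and M_opening: "M \<in> openings e P" and N_opening: "N \<in> openings e Q" and apart: "apart e P M Q N"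
  shows "opened_react E e (Par P Q) (M + N) (Par P' Q)"
proof -
  obtain Us where Us_react: "mset_react E M (mset Us)"
    "subst e P' \<cong> nu (opened e P M) (par_list Us)"
    using react unfolding opened_react_def by blast
  obtain Vs where mset_Vs: "mset Vs = N" by (meson ex_mset)
  have "subst e (Par P' Q) \<cong> nu (opened e (Par P Q) (M + N)) (par_list (Us @ Vs))"
    using Us_react(2) M_opening N_opening apart openings_sound[of Vs e Q]
      mset_react_fn_mset[OF assms(1) Us_react(1)] mset_Vs
    by (intro subst_Par_opened) auto
  moreover have "mset_react E (M + N) (mset (Us @ Vs))"
    using mset_react_plus[OF Us_react(1)] mset_Vs by simp
  ultimately show ?thesis unfolding opened_react_def by blast
qed

lemma opened_react_Res:
  assumes "closed_eqs E" and react: "opened_react E (e(r := z)) P M P'" and "fn P' \<subseteq> fn P"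
    and "z \<notin> e ` (fn P - {r})"
  shows "opened_react E e (Res r P) M (Res r P')"
proof -
  obtain Ps where Ps_react: "mset_react E M (mset Ps)"
    "subst (e(r := z)) P' \<cong> nu (opened (e(r := z)) P M) (par_list Ps)"
    using react unfolding opened_react_def by blast
  have "subst e (Res r P') \<cong> nu (opened e (Res r P) M) (par_list Ps)"
    using Ps_react(2) assms(3) mset_react_fn_mset[OF assms(1) Ps_react(1)] assms(4)
    by (intro subst_Res_opened) auto
  with Ps_react(1) show ?thesis unfolding opened_react_def by blast
qed

lemma opened_react_struct:
  assumes react: "opened_react E e P' N Q'" and "P \<cong> P'" "Q' \<cong> Q" and comps: "components_eq M N"
  shows "opened_react E e P M Q"
proof -
  obtain Us where Us_react: "mset_react E N (mset Us)"
    "subst e Q' \<cong> nu (opened e P' N) (par_list Us)"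
    using react unfolding opened_react_def by blast
  obtain M' where M'_react: "mset_react E M M'" "rel_mset (\<cong>) (mset Us) M'"
    using mset_react_components_eq[OF Us_react(1) components_eq_sym[OF comps]] by blast
  obtain Ps where mset_Ps: "mset Ps = M'" by (meson ex_mset)
  have "subst e Q \<cong> subst e Q'" using scong_subst[OF assms(3)] by (rule scong.sym)
  also have "\<dots> \<cong> nu (opened e P' N) (par_list Us)" by (rule Us_react(2))
  also have "\<dots> \<cong> nu (opened e P' N) (par_list Ps)"
    using M'_react(2) mset_Ps by (intro nu_cong par_list_rel_mset) simp
  also have "opened e P' N = opened e P M"
    using components_eq_fn_mset[OF comps] scong_fn[OF assms(2)] by (simp add: opened_def)
  finally show ?thesis using M'_react(1) mset_Ps unfolding opened_react_def by blast
qed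

lemma react_opened_react:
  "react E P Q \<Longrightarrow> closed_eqs E \<Longrightarrow> M \<in> openings e P \<Longrightarrow> opened_react E e P M Q"
proof (induction arbitrary: e M rule: react.induct)
  case (tau S bs)
  then have "M = {#subst e (Sum bs)#}" by (cases "bs = []") (auto simp: openings_Sum)
  with tau(1) show ?case by (simp only: opened_react_tau)
next
  case (call K fs S as)
  then show ?case using closed_eqsD[OF call(3,1)] by (simp add: opened_react_call)
next
  case (comm x y S\<^sub>1 bs z S\<^sub>2 cs)
  then have "bs \<noteq> []" "cs \<noteq> []" by auto
  then have "M = {#subst e (Sum bs), subst e (Sum cs)#}"
    using comm(4) by (auto simp: openings_Sum simp del: subst_Sum)
  with comm(1,2) show ?case by (simp only: opened_react_comm)
next
  case (par P P' Q)
  from par.prems(2) obtain M1 M2 where "M = M1 + M2" "M1 \<in> openings e P" "M2 \<in> openings e Q"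
    "apart e P M1 Q M2" by auto
  then show ?case using opened_react_Par par.IH par.prems(1) by blast
next
  case (res P P' r)
  from res.prems(2) obtain z where "z \<notin> e ` (fn P - {r})" "M \<in> openings (e(r := z)) P" by auto
  then show ?case
    using opened_react_Res res.IH res.prems(1) react_fn[OF res.hyps res.prems(1)] by blast
next
  case (struct P P' Q' Q)
  from scong_openings[OF struct.hyps(1)] struct.prems(2)
  obtain N where "N \<in> openings e P'" "components_eq M N" by (meson rel_setD1)
  then show ?case using opened_react_struct struct.IH struct.hyps struct.prems(1) by blast
qed

lemma openings_par_list:
  assumes "\<And>P. P \<in> set Ps \<Longrightarrow> is_call P \<or> is_choice P"
  shows "mset Ps \<in> openings id (par_list Ps)"
  using assms
proof (induction Ps rule: induct_list012)
  case (3 P Q Ps)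
  have "apart id P {#P#} (par_list (Q # Ps)) (mset (Q # Ps))"
    unfolding apart_def opened_def fn_mset_mset by simp
  moreover have "{#P#} \<in> openings id P" by (simp add: "3.prems" openings_guarded_single)
  moreover have "mset (Q # Ps) \<in> openings id (par_list (Q # Ps))"
    by (rule "3.IH"(2)) (simp add: "3.prems")
  ultimately have "{#P#} + mset (Q # Ps) \<in> openings id (Par P (par_list (Q # Ps)))"
    unfolding openings.simps(4) by blast
  moreover have "{#P#} + mset (Q # Ps) = mset (P # Q # Ps)" by simp
  ultimately show ?case by (simp only: par_list.simps)
qed (simp_all add: openings_guarded_single)

lemma openings_id_nu: "M \<in> openings id P \<Longrightarrow> M \<in> openings id (nu A P)"
proof -
  have "M \<in> openings id (res_list rs P)" if "M \<in> openings id P" for rs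
  proof (induction rs)
    case (Cons r rs)
    have "id(r := r) = id" by auto
    with Cons have "M \<in> openings (id(r := r)) (res_list rs P)" by (simp only:)
    moreover have "r \<in> - id ` (fn (res_list rs P) - {r})" by simp
    ultimately show ?case unfolding res_list_simps openings.simps by blast
  qed (simp only: that res_list_simps)
  then show "M \<in> openings id P \<Longrightarrow> M \<in> openings id (nu A P)" by (simp only: nu_def)
qed

lemma react_nu_par_list:
  assumes "closed_eqs E" "react E G G'" "G \<cong> nu A (par_list Ps)" "finite A"
    and guarded: "\<And>P. P \<in> set Ps \<Longrightarrow> is_call P \<or> is_choice P"
  shows "\<exists>Qs. mset_react E (mset Ps) (mset Qs) \<and> G' \<cong> nu A (par_list Qs)"
proof -
  let ?P = "nu A (par_list Ps)"
  have "react E ?P G'" using assms(2,3) by (meson react.struct scong.refl scong.sym)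
  moreover have "mset Ps \<in> openings id ?P"
    by (intro openings_id_nu openings_par_list guarded)
  ultimately have "opened_react E id ?P (mset Ps) G'" using react_opened_react assms(1) by blast
  then obtain Qs where Qs_react: "mset_react E (mset Ps) (mset Qs)"
    "G' \<cong> nu (opened id ?P (mset Ps)) (par_list Qs)"
    unfolding opened_react_def subst_id by blast
  have "nu (opened id ?P (mset Ps)) (par_list Qs) \<cong> nu A (par_list Qs)"
    using assms(4) mset_react_fn_mset[OF assms(1) Qs_react(1)]
    by (intro nu_cong_set) (auto simp: opened_def fn_mset_mset simp del: fn_par_list)
  with Qs_react show ?thesis using scong.trans by blast
qed

inductive family_react ::
  "equation list \<Rightarrow> nat \<Rightarrow> (nat \<Rightarrow> proc) \<Rightarrow> (nat \<Rightarrow> proc) \<Rightarrow> bool"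
  for E :: "equation list" and n :: nat and T :: "nat \<Rightarrow> proc" where
  tau: "i < n \<Longrightarrow> T i = Sum bs \<Longrightarrow> (Tau, S) \<in> set bs \<Longrightarrow> family_react E n T (T(i := S))"
| call: "i < n \<Longrightarrow> T i = Call K as \<Longrightarrow> (K, fs, S) \<in> set E \<Longrightarrow> length as = length fs \<Longrightarrow>
    family_react E n T (T(i := subst_map (map_of (zip fs as)) S))"
| comm: "i < n \<Longrightarrow> j < n \<Longrightarrow> i \<noteq> j \<Longrightarrow> T i = Sum cs \<Longrightarrow> T j = Sum bs \<Longrightarrow>
    (Send x z, S\<^sub>2) \<in> set cs \<Longrightarrow> (Recv x y, S\<^sub>1) \<in> set bs \<Longrightarrow>
    family_react E n T (T(i := S\<^sub>2, j := rename1 S\<^sub>1 z y))"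

lemma mset_react_family:
  assumes "mset_react E (mset (map T [0..<n])) M'"
  shows "\<exists>U. family_react E n T U \<and> mset (map U [0..<n]) = M'"
  using assms
proof cases
  case (tau S bs M)
  from tau(1)[unfolded mset_family] obtain i where i_thread: "i \<in> {..<n}" "T i = Sum bs"
    "M = image_mset T (mset_set ({..<n} - {i}))" by (rule image_mset_eq_add_msetE) simp
  have "mset (map (T(i := S)) [0..<n]) = M'"
    unfolding mset_family tau(2) i_thread(3) using i_thread(1) by (intro image_mset_fun_upd) auto
  then show ?thesis using i_thread tau(3) family_react.tau[of i n T bs S E] by blast
next
  case (call K fs S as M)
  from call(1)[unfolded mset_family] obtain i where i_thread: "i \<in> {..<n}" "T i = Call K as"
    "M = image_mset T (mset_set ({..<n} - {i}))" by (rule image_mset_eq_add_msetE) simp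
  have "mset (map (T(i := subst_map (map_of (zip fs as)) S)) [0..<n]) = M'"
    unfolding mset_family call(2) i_thread(3) using i_thread(1) by (intro image_mset_fun_upd) auto
  then show ?thesis using i_thread call(3,4) family_react.call[of i n T K as fs S E] by blast
next
  case (comm x y S\<^sub>1 bs z S\<^sub>2 cs M)
  from comm(1)[unfolded mset_family] obtain j where j_thread: "j \<in> {..<n}" "T j = Sum bs"
    "add_mset (Sum cs) M = image_mset T (mset_set ({..<n} - {j}))"
    by (rule image_mset_eq_add_msetE) simp
  from j_thread(3)[symmetric] obtain i where i_thread: "i \<in> {..<n} - {j}" "T i = Sum cs"
    "M = image_mset T (mset_set ({..<n} - {j} - {i}))" by (rule image_mset_eq_add_msetE) simp
  have "mset (map (T(i := S\<^sub>2, j := rename1 S\<^sub>1 z y)) [0..<n]) =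
      add_mset (rename1 S\<^sub>1 z y) (image_mset (T(i := S\<^sub>2)) (mset_set ({..<n} - {j})))"
    unfolding mset_family using j_thread(1) by (intro image_mset_fun_upd) auto
  also have "image_mset (T(i := S\<^sub>2)) (mset_set ({..<n} - {j})) = add_mset S\<^sub>2 M"
    unfolding i_thread(3) using i_thread(1) by (intro image_mset_fun_upd) auto
  finally have "mset (map (T(i := S\<^sub>2, j := rename1 S\<^sub>1 z y)) [0..<n]) = M'"
    unfolding comm(2) .
  then show ?thesis
    using i_thread(1,2) j_thread(1,2) comm(3,4)
      family_react.comm[of i n j T cs bs x z S\<^sub>2 y S\<^sub>1 E] by blast
qed

theorem react_nu_family:
  assumes "closed_eqs E" "react E G G'" "G \<cong> nu A (par_family n T)" "finite A"
    and guarded: "\<And>i. i < n \<Longrightarrow> is_call (T i) \<or> is_choice (T i)"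
  obtains U where "family_react E n T U" "G' \<cong> nu A (par_family n U)"
proof -
  have "\<exists>Qs. mset_react E (mset (map T [0..<n])) (mset Qs) \<and> G' \<cong> nu A (par_list Qs)"
    by (rule react_nu_par_list[OF assms(1-4)]) (use guarded in fastforce)
  then obtain Qs where Qs_react: "mset_react E (mset (map T [0..<n])) (mset Qs)"
    "G' \<cong> nu A (par_list Qs)" by blast
  obtain U where U_react: "family_react E n T U" "mset (map U [0..<n]) = mset Qs"
    using mset_react_family[OF Qs_react(1)] by blast
  have "par_list Qs \<cong> par_family n U" using U_react(2) by (intro par_list_perm) simp
  then have "G' \<cong> nu A (par_family n U)" using Qs_react(2) nu_cong scong.trans by blast
  with U_react(1) show thesis by (rule that)
qed

lemma react_nu: "react E P Q \<Longrightarrow> react E (nu A P) (nu A Q)"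
proof -
  have "react E P Q \<Longrightarrow> react E (res_list rs P) (res_list rs Q)" for rs
    by (induction rs) (auto intro: react.res)
  then show "react E P Q \<Longrightarrow> react E (nu A P) (nu A Q)" by (simp add: nu_def)
qed

lemma react_family_fun_upd:
  assumes "i < n" "react E (T i) P"
  shows "react E (par_family n T) (par_family n (T(i := P)))"
proof -
  obtain Rs where mset_Rs: "mset Rs = image_mset T (mset_set ({..<n} - {i}))" using ex_mset by blast
  have "par_family n T \<cong> Par (T i) (par_list Rs)"
    using par_family_fun_upd[OF assms(1) mset_Rs, of "T i"] by simp
  moreover have "react E (Par (T i) (par_list Rs)) (Par P (par_list Rs))"
    using assms(2) by (rule react.par)
  moreover have "Par P (par_list Rs) \<cong> par_family n (T(i := P))"
    by (rule scong.sym[OF par_family_fun_upd[OF assms(1) mset_Rs]])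
  ultimately show ?thesis by (rule react.struct)
qed

lemma react_family_fun_upd2:
  assumes "i < n" "j < n" "i \<noteq> j" "react E (Par (T j) (T i)) (Par Q P)"
  shows "react E (par_family n T) (par_family n (T(i := P, j := Q)))"
proof -
  obtain Rs where mset_Rs: "mset Rs = image_mset T (mset_set ({..<n} - {j} - {i}))"
    using ex_mset by blast
  have split: "par_family n (T(i := P, j := Q)) \<cong> Par (Par Q P) (par_list Rs)" for P Q
  proof -
    have "mset (P # Rs) = image_mset (T(i := P)) (mset_set ({..<n} - {j}))"
      using assms(1,3) mset_Rs by (simp add: image_mset_fun_upd)
    then have "par_family n (T(i := P, j := Q)) \<cong> Par Q (par_list (P # Rs))"
      by (rule par_family_fun_upd[OF assms(2)])
    also have "\<dots> \<cong> Par Q (Par P (par_list Rs))"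
      by (intro scong.cong_par scong.refl par_list_Cons)
    also have "\<dots> \<cong> Par (Par Q P) (par_list Rs)" by (rule scong.sym[OF scong.par_assoc])
    finally show ?thesis .
  qed
  have "par_family n T \<cong> Par (Par (T j) (T i)) (par_list Rs)"
    using split[of "T i" "T j"] by simp
  moreover have "react E (Par (Par (T j) (T i)) (par_list Rs)) (Par (Par Q P) (par_list Rs))"
    using assms(4) by (rule react.par)
  ultimately show ?thesis using scong.sym[OF split] by (rule react.struct)
qed

subsection \<open>Names of a specification\<close>

definition binders :: "proc \<Rightarrow> name set" where
  "binders S = set (res_binders S) \<union> set (inp_binders S)"

lemma binders_simps [simp]:
  "binders (Call K xs) = {}" "binders (Res r S) = insert r (binders S)"
  by (auto simp: binders_def)

lemma set_inp_binders_Sum: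
  "set (inp_binders (Sum bs)) = (\<Union>(\<pi>, S)\<in>set bs. prefix_bound \<pi> \<union> set (inp_binders S))"
proof -
  have "set ((case \<pi> of Recv a x \<Rightarrow> [x] | _ \<Rightarrow> []) @ inp_binders S) =
      prefix_bound \<pi> \<union> set (inp_binders S)" for \<pi> S by (cases \<pi>) auto
  then show ?thesis by (auto simp del: set_append)
qed

lemma binders_Sum: "binders (Sum bs) = (\<Union>(\<pi>, S)\<in>set bs. prefix_bound \<pi> \<union> binders S)"
  unfolding binders_def set_inp_binders_Sum by auto

declare inp_binders.simps(2) [simp del]

fun no_shadowing :: "proc \<Rightarrow> bool" where
  "no_shadowing (Call K xs) = True"
| "no_shadowing (Sum bs) =
     (\<forall>(\<pi>, S)\<in>set bs. prefix_bound \<pi> \<inter> binders S = {} \<and> no_shadowing S)"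
| "no_shadowing (Res r S) = (r \<notin> binders S \<and> no_shadowing S)"
| "no_shadowing (Par P Q) = (no_shadowing P \<and> no_shadowing Q)"

lemma distinct_no_shadowing:
  "distinct (res_binders S @ inp_binders S) \<Longrightarrow> no_shadowing S"
proof (induction S rule: proc_induct)
  case (Sum bs)
  have "prefix_bound \<pi> \<inter> binders S = {} \<and> no_shadowing S" if branch: "(\<pi>, S) \<in> set bs" for \<pi> S
  proof
    have res: "distinct (res_binders S)"
      using Sum.prems branch by (auto simp: distinct_concat_iff)
    have "distinct ((case \<pi> of Recv a x \<Rightarrow> [x] | _ \<Rightarrow> []) @ inp_binders S)"
      using Sum.prems branch
      unfolding inp_binders.simps distinct_append distinct_concat_iff by fastforce
    then have inp: "distinct (inp_binders S)" "prefix_bound \<pi> \<inter> set (inp_binders S) = {}"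
      by (cases \<pi>; auto)+
    have disjoint: "set (res_binders (Sum bs)) \<inter> set (inp_binders (Sum bs)) = {}"
      using Sum.prems by auto
    have subset: "set (res_binders S) \<subseteq> set (res_binders (Sum bs))"
      "prefix_bound \<pi> \<union> set (inp_binders S) \<subseteq> set (inp_binders (Sum bs))"
      using branch unfolding set_inp_binders_Sum by auto
    show "prefix_bound \<pi> \<inter> binders S = {}"
      unfolding binders_def using inp(2) disjoint subset by blast
    have "set (res_binders S) \<inter> set (inp_binders S) = {}" using disjoint subset by blast
    then show "no_shadowing S" using Sum.IH[OF branch] res inp(1) by simp
  qed
  then show ?case by auto
next
  case (Res r P)
  then show ?case by (auto simp: binders_def)
qed auto

definition wf_thread :: "proc \<Rightarrow> bool" where
  "wf_thread S \<longleftrightarrow>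
     fn S \<inter> binders S = {} \<and> no_shadowing S \<and> thread S \<and> zero_free S \<and> binders_used S"

lemma fn_continuation_subset: "(\<pi>, S) \<in> set bs \<Longrightarrow> fn S \<subseteq> fn (Sum bs) \<union> prefix_bound \<pi>"
  using fn_branch_subset by blast

lemma wf_thread_branch:
  assumes "wf_thread (Sum bs)" and branch: "(\<pi>, S) \<in> set bs"
  shows "wf_thread S"
proof -
  have "prefix_bound \<pi> \<inter> binders S = {}" using assms by (auto simp: wf_thread_def)
  moreover have "binders S \<subseteq> binders (Sum bs)" using branch by (auto simp: binders_Sum)
  ultimately have "fn S \<inter> binders S = {}"
    using assms(1) fn_continuation_subset[OF branch] unfolding wf_thread_def by blast
  then show ?thesis using assms by (auto simp: wf_thread_def)
qed

lemma wf_thread_Res: "wf_thread (Res r S) \<Longrightarrow> wf_thread S"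
  by (auto simp: wf_thread_def)

lemma distinct_concat_map_disjoint:
  assumes "distinct (concat (map g xs))" "distinct xs" "x \<in> set xs" "y \<in> set xs" "x \<noteq> y"
  shows "set (g x) \<inter> set (g y) = {}"
  using assms by (induction xs) auto

lemma map_of_zip_nth:
  assumes "distinct fs" "j < length fs"
  shows "map_of (zip fs xs) (fs ! j) = (if j < length xs then Some (xs ! j) else None)"
  using assms
proof (induction fs arbitrary: j xs)
  case (Cons f fs)
  then show ?case by (cases xs; cases j) auto
qed simp

locale fcp_spec =
  fixes F :: fcp and NEW :: "name set"
  assumes normal_form: "normal_form F" and new_names: "new_names F NEW"
begin

definition idents :: "ident set" where
  "idents = fst ` set (eqs F)"

definition formals :: "ident \<Rightarrow> name list" where
  "formals K = fst (the (map_of (eqs F) K))"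

definition body :: "ident \<Rightarrow> proc" where
  "body K = snd (the (map_of (eqs F) K))"

lemma distinct_eqs: "distinct (map fst (eqs F))"
  using normal_form by (simp add: normal_form_def)

lemma
  assumes "(K, fs, S) \<in> set (eqs F)"
  shows eqs_ident: "K \<in> idents" and eqs_formals: "formals K = fs" and eqs_body: "body K = S"
proof -
  have "map_of (eqs F) K = Some (fs, S)" using assms distinct_eqs by simp
  then show "formals K = fs" "body K = S" by (auto simp: formals_def body_def)
  show "K \<in> idents" using assms by (force simp: idents_def)
qed

lemma ident_eqs: "K \<in> idents \<Longrightarrow> (K, formals K, body K) \<in> set (eqs F)"
  using eqs_formals eqs_body unfolding idents_def by force

lemma
  assumes "K \<in> idents"
  shows thread_body: "thread (body K)" and fn_body: "fn (body K) = set (formals K)"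
    and zero_free_body: "zero_free (body K)" and binders_used_body: "binders_used (body K)"
    and not_calls_itself: "(K, m) \<notin> calls (body K)"
    and calls_arity: "(K', m) \<in> calls (body K) \<Longrightarrow> K' \<in> idents \<and> length (formals K') = m"
proof -
  have "\<forall>(K, fs, S) \<in> set (eqs F).
        thread S \<and> fn S = set fs \<and> zero_free S \<and> binders_used S \<and>
        K \<notin> fst ` calls S \<and>
        (\<forall>(K', m) \<in> calls S. \<exists>fs' S'. (K', fs', S') \<in> set (eqs F) \<and> length fs' = m)"
    using normal_form by (simp add: normal_form_def)
  with ident_eqs[OF assms] have normal_form: "thread (body K) \<and> fn (body K) = set (formals K) \<and>
      zero_free (body K) \<and> binders_used (body K) \<and> K \<notin> fst ` calls (body K) \<and>
      (\<forall>(K', m) \<in> calls (body K). \<exists>fs' S'. (K', fs', S') \<in> set (eqs F) \<and> length fs' = m)"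
    by fast
  then show "thread (body K)" "fn (body K) = set (formals K)" "zero_free (body K)"
    "binders_used (body K)" by auto
  show "(K, m) \<notin> calls (body K)" using normal_form by (metis fst_conv imageI)
  show "K' \<in> idents \<and> length (formals K') = m" if "(K', m) \<in> calls (body K)"
    using normal_form that eqs_ident eqs_formals by fast
qed

lemma closed_eqs: "closed_eqs (eqs F)"
  using eqs_ident eqs_formals eqs_body fn_body unfolding closed_eqs_def by fast

lemma distinct_binders:
  "distinct (restr_binders F)" "distinct (input_binders F)" "distinct (formal_binders F)"
  using normal_form by (auto simp: normal_form_def)

lemma binder_classes_disjoint:
  "RESTR F \<inter> INP F = {}" "RESTR F \<inter> FRM F = {}" "INP F \<inter> FRM F = {}"
  using normal_form by (auto simp: normal_form_def)

lemma
  assumes "K \<in> idents"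
  shows formals_FRM: "set (formals K) \<subseteq> FRM F"
    and res_binders_RESTR: "set (res_binders (body K)) \<subseteq> RESTR F"
    and inp_binders_INP: "set (inp_binders (body K)) \<subseteq> INP F"
  using ident_eqs[OF assms]
  by (fastforce simp: formal_binders_def restr_binders_def input_binders_def)+

lemma distinct_formals: "K \<in> idents \<Longrightarrow> distinct (formals K)"
  using distinct_binders(3) ident_eqs unfolding formal_binders_def distinct_concat_iff by fastforce

definition ident_names :: "ident \<Rightarrow> name set" where
  "ident_names K = set (formals K) \<union> binders (body K)"

lemma ident_names_disjoint:
  assumes "K \<in> idents" "L \<in> idents" "K \<noteq> L"
  shows "ident_names K \<inter> ident_names L = {}"
proof -
  have "distinct (eqs F)" using distinct_eqs by (simp add: distinct_map)
  note disjoint =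
    distinct_concat_map_disjoint[OF _ this ident_eqs[OF assms(1)] ident_eqs[OF assms(2)]]
  have "set (formals K) \<inter> set (formals L) = {}"
    using disjoint[OF distinct_binders(3)[unfolded formal_binders_def]] assms(3) by simp
  moreover have "distinct (concat (map (\<lambda>(K, fs, S). res_binders S) (eqs F)))"
    using distinct_binders(1) by (simp add: restr_binders_def)
  then have "set (res_binders (body K)) \<inter> set (res_binders (body L)) = {}"
    using disjoint assms(3) by fastforce
  moreover have "set (inp_binders (body K)) \<inter> set (inp_binders (body L)) = {}"
    using disjoint[OF distinct_binders(2)[unfolded input_binders_def]] assms(3) by simp
  ultimately show ?thesis
    using assms(1,2)[THEN formals_FRM] assms(1,2)[THEN res_binders_RESTR]
      assms(1,2)[THEN inp_binders_INP] binder_classes_disjoint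
    unfolding ident_names_def binders_def by blast
qed

lemma wf_thread_body:
  assumes "K \<in> idents" shows "wf_thread (body K)"
proof -
  have "distinct (concat (map (\<lambda>(K, fs, S). res_binders S) (eqs F)))"
    using distinct_binders(1) by (simp add: restr_binders_def)
  then have "distinct (res_binders (body K))"
    using ident_eqs[OF assms] by (fastforce simp: distinct_concat_iff)
  moreover have "distinct (inp_binders (body K))"
    using distinct_binders(2) ident_eqs[OF assms]
    unfolding input_binders_def distinct_concat_iff by fastforce
  moreover have "set (res_binders (body K)) \<inter> set (inp_binders (body K)) = {}"
    using res_binders_RESTR[OF assms] inp_binders_INP[OF assms] binder_classes_disjoint(1) by blast
  ultimately have "no_shadowing (body K)" by (intro distinct_no_shadowing) simp
  moreover have "fn (body K) \<inter> binders (body K) = {}"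
    using formals_FRM[OF assms] res_binders_RESTR[OF assms] inp_binders_INP[OF assms]
      binder_classes_disjoint fn_body[OF assms]
    unfolding binders_def by blast
  ultimately show ?thesis
    using assms by (simp add: wf_thread_def thread_body zero_free_body binders_used_body)
qed

lemma PUB_NEW_disjoint: "PUB F \<inter> NEW = {}"
  using new_names by (auto simp: new_names_def)

lemma finite_NEW [simp]: "finite NEW"
  using new_names by (simp add: new_names_def)

definition thread_names :: "nat \<Rightarrow> name set" where
  "thread_names i = (\<Union>K \<in> thread_idents F i \<inter> idents. ident_names K)"

lemma thread_names_disjoint:
  assumes "i < n_threads F" "j < n_threads F" "i \<noteq> j"
  shows "thread_names i \<inter> thread_names j = {}"
proof -
  have "thread_idents F i \<inter> thread_idents F j = {}"
    using normal_form assms by (simp add: normal_form_def)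
  then show ?thesis using ident_names_disjoint unfolding thread_names_def by blast
qed

lemma ident_names_thread:
  "K \<in> thread_idents F i \<Longrightarrow> K \<in> idents \<Longrightarrow> ident_names K \<subseteq> thread_names i"
  unfolding thread_names_def by blast

lemma thread_idents_call:
  "K \<in> thread_idents F i \<Longrightarrow> (K, L) \<in> call_graph F \<Longrightarrow> L \<in> thread_idents F i"
  unfolding thread_idents_def by (auto intro: rtrancl.rtrancl_into_rtrancl)

subsection \<open>Places of the control flow nets\<close>

definition residual :: "ident \<Rightarrow> proc \<Rightarrow> name list \<Rightarrow> bool" where
  "residual K S l \<longleftrightarrow> K \<in> idents \<and> distinct l \<and> fn S \<union> set l \<subseteq> ident_names K \<and> wf_thread S \<and>
     set l \<inter> (fn S \<union> binders S) = {} \<and>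
     set (res_binders S) \<subseteq> set (res_binders (body K)) \<and>
     set (inp_binders S) \<subseteq> set (inp_binders (body K)) \<and>
     calls S \<subseteq> calls (body K) \<and> derived F NEW (S, l)"

text \<open>The body of \<open>K\<close> has called \<open>L\<close>, \<open>xs\<close> are the arguments still to be passed, and \<open>l\<close> the
  caller's names still to be unmapped.\<close>

definition calling :: "ident \<Rightarrow> ident \<Rightarrow> name list \<Rightarrow> name list \<Rightarrow> bool" where
  "calling K L xs l \<longleftrightarrow> K \<in> idents \<and> distinct l \<and> set xs \<union> set l \<subseteq> ident_names K \<and>
     (\<exists>m. (L, m) \<in> calls (body K)) \<and> length xs \<le> length (formals L) \<and>
     (xs \<noteq> [] \<and> length xs = length (formals L) \<longrightarrow> derived F NEW (Call L xs, l))"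

fun place_within :: "ident \<Rightarrow> aug \<Rightarrow> bool" where
  "place_within K (Call L xs, l) = calling K L xs l"
| "place_within K (S, l) = residual K S l"

definition thread_place :: "nat \<Rightarrow> aug \<Rightarrow> bool" where
  "thread_place i q \<longleftrightarrow> (\<exists>K \<in> thread_idents F i. place_within K q)"

text \<open>The names that a substitution must be defined on when a thread is at the given place.\<close>

fun active_names :: "aug \<Rightarrow> name set" where
  "active_names (Call K xs, l) = set xs \<union> set l \<union> set (drop (length xs) (formals K))"
| "active_names (S, l) = fn S \<union> set l"

lemma place_cases [case_names Call residual]:
  assumes "place_within K q"
  obtains L xs l where "q = (Call L xs, l)" "calling K L xs l"
  | S l where "q = (S, l)" "\<not> is_call S" "residual K S l"
proof (cases "fst q")
  case (Call L xs)
  then show ?thesis using assms that(1)[of L xs "snd q"] by (cases q) auto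
qed (use assms that(2)[of "fst q" "snd q"] in \<open>cases q; auto\<close>)+

lemma residual_place: "residual K S l \<Longrightarrow> place_within K (S, l)"
proof (cases S)
  case (Call L xs)
  assume "residual K S l"
  then show ?thesis
    using calls_arity[of K L "length xs"] by (auto simp: Call residual_def calling_def)
qed auto

lemma residual_thread_place: "K \<in> thread_idents F i \<Longrightarrow> residual K S l \<Longrightarrow> thread_place i (S, l)"
  using residual_place unfolding thread_place_def by blast

lemma thread_place_Sum:
  "thread_place i (Sum bs, l) \<longleftrightarrow> (\<exists>K\<in>thread_idents F i. residual K (Sum bs) l)"
  and thread_place_Res:
  "thread_place i (Res r S, l) \<longleftrightarrow> (\<exists>K\<in>thread_idents F i. residual K (Res r S) l)"
  and thread_place_Call:
  "thread_place i (Call L xs, l) \<longleftrightarrow> (\<exists>K\<in>thread_idents F i. calling K L xs l)"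
  by (simp_all add: thread_place_def)

lemma active_names_residual: "residual K S l \<Longrightarrow> active_names (S, l) = fn S \<union> set l"
  using calls_arity[of K] by (cases S) (auto simp: residual_def)

lemma
  assumes "calling K L xs l"
  shows calling_caller: "K \<in> idents" and calling_callee: "L \<in> idents"
    and calling_call_graph: "(K, L) \<in> call_graph F"
    and calling_names_disjoint: "ident_names K \<inter> ident_names L = {}"
proof -
  from assms obtain m where calls_L: "K \<in> idents" "(L, m) \<in> calls (body K)"
    by (auto simp: calling_def)
  then show "K \<in> idents" "L \<in> idents" using calls_arity[of K] by auto
  then show "ident_names K \<inter> ident_names L = {}"
    using ident_names_disjoint not_calls_itself[of K] calls_L(2) by blast
  show "(K, L) \<in> call_graph F" using calls_L ident_eqs unfolding call_graph_def by blast
qed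

lemma thread_place_callee: "thread_place i (Call L xs, l) \<Longrightarrow> L \<in> idents"
  using calling_callee by (auto simp: thread_place_Call)

lemma calling_names:
  assumes "K \<in> thread_idents F i" "calling K L xs l"
  shows "ident_names K \<union> ident_names L \<subseteq> thread_names i"
  using assms calling_caller calling_callee calling_call_graph
  by (blast dest: ident_names_thread thread_idents_call)

lemma residual_binders: "residual K S l \<Longrightarrow> binders S \<subseteq> ident_names K"
  unfolding residual_def binders_def ident_names_def by blast

lemma active_names_thread:
  assumes "thread_place i q" shows "active_names q \<subseteq> thread_names i"
proof -
  from assms obtain K where K_within: "K \<in> thread_idents F i" "place_within K q"
    by (auto simp: thread_place_def)
  from K_within(2) show ?thesis
  proof (cases rule: place_cases)
    case (Call L xs l)
    have "set (drop (length xs) (formals L)) \<subseteq> ident_names L"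
      using set_drop_subset unfolding ident_names_def by fast
    then show ?thesis using calling_names[OF K_within(1) Call(2)] Call by (auto simp: calling_def)
  next
    case (residual S l)
    have "fn S \<union> set l \<subseteq> ident_names K" using residual(3) by (simp add: residual_def)
    then show ?thesis
      using ident_names_thread[OF K_within(1)] residual active_names_residual
      by (simp add: residual_def) blast
  qed
qed

lemma derived_step:
  assumes "derived F NEW q" "(q, q') \<in> cf_step F NEW" "\<not> is_call (fst q)"
  shows "derived F NEW q'"
proof -
  have "(q, q') \<in> {(u, v) \<in> cf_step F NEW. \<not> is_call (fst u)}" using assms(2,3) by simp
  with assms(1) show ?thesis
    unfolding derived_def by (fast intro: rtrancl.rtrancl_into_rtrancl)
qed

lemma residual_body: "K \<in> idents \<Longrightarrow> residual K (body K) []"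
proof -
  assume K_ident: "K \<in> idents"
  then have "derived F NEW (body K, [])" unfolding derived_def using ident_eqs by fast
  then show ?thesis using K_ident wf_thread_body fn_body
    unfolding residual_def ident_names_def by auto
qed

lemma set_dropped [simp]: "set (dropped bs S) = fn (Sum bs) - fn S"
  and distinct_dropped [simp]: "distinct (dropped bs S)"
  unfolding dropped_def by (auto simp del: fn_Sum)

lemma residual_branch:
  assumes res: "residual K (Sum bs) l" and branch: "(\<pi>, S) \<in> set bs"
    and step: "((Sum bs, l), (S, l @ dropped bs S)) \<in> cf_step F NEW"
  shows "residual K S (l @ dropped bs S)"
proof -
  have sub: "set (res_binders S) \<subseteq> set (res_binders (Sum bs))"
    "set (inp_binders S) \<subseteq> set (inp_binders (Sum bs))" "calls S \<subseteq> calls (Sum bs)"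
    "binders S \<subseteq> binders (Sum bs)" "prefix_bound \<pi> \<subseteq> binders (Sum bs)"
    using branch by (auto simp: set_inp_binders_Sum binders_Sum)
  have Sum: "K \<in> idents" "distinct l" "fn (Sum bs) \<union> set l \<subseteq> ident_names K"
    "set l \<inter> (fn (Sum bs) \<union> binders (Sum bs)) = {}" "fn (Sum bs) \<inter> binders (Sum bs) = {}"
    using res by (simp_all add: residual_def wf_thread_def del: fn_Sum)
  note fn_S = fn_continuation_subset[OF branch]
  have "derived F NEW (S, l @ dropped bs S)"
    using res derived_step[OF _ step] unfolding residual_def by simp
  moreover have "wf_thread S" using res branch wf_thread_branch unfolding residual_def by blast
  moreover have "distinct (l @ dropped bs S)" using Sum(2,4) by (auto simp del: fn_Sum)
  moreover have "fn S \<union> set (l @ dropped bs S) \<subseteq> ident_names K"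
    using Sum(3) residual_binders[OF res] sub(5) fn_S by (auto simp del: fn_Sum)
  moreover have "set (l @ dropped bs S) \<inter> (fn S \<union> binders S) = {}"
    using Sum(4,5) sub(4,5) fn_S unfolding set_append set_dropped by blast
  moreover have "set (res_binders S) \<subseteq> set (res_binders (body K))"
    "set (inp_binders S) \<subseteq> set (inp_binders (body K))" "calls S \<subseteq> calls (body K)"
    using res sub(1-3) unfolding residual_def by blast+
  ultimately show ?thesis using Sum(1) unfolding residual_def by blast
qed

lemma residual_Res:
  assumes res: "residual K (Res r S) l" and step: "((Res r S, l), (S, l)) \<in> cf_step F NEW"
  shows "residual K S l"
proof -
  have "derived F NEW (S, l)"
    using res derived_step[OF _ step] unfolding residual_def by simp
  moreover have "r \<in> ident_names K" using residual_binders[OF res] by simp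
  ultimately show ?thesis using res wf_thread_Res[of r S] unfolding residual_def by auto
qed

lemma active_names_branch:
  assumes res: "residual K (Sum bs) l" "residual K S (l @ dropped bs S)"
    and branch: "(\<pi>, S) \<in> set bs"
  shows "active_names (S, l @ dropped bs S) = active_names (Sum bs, l) \<union> prefix_bound \<pi>"
proof -
  have "prefix_bound \<pi> \<subseteq> fn S" using res(1) branch by (auto simp: residual_def wf_thread_def)
  then show ?thesis
    using fn_continuation_subset[OF branch]
    unfolding active_names_residual[OF res(1)] active_names_residual[OF res(2)]
      set_append set_dropped by blast
qed

lemma settled_Sum: "thread_place i (Sum bs, l) \<Longrightarrow> settled_place F NEW (Sum bs, l)"
  by (auto simp: thread_place_Sum residual_def wf_thread_def settled_place_def)

lemma
  assumes "thread_place i (Res r S, l)"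
  shows Res_binder_RESTR: "r \<in> RESTR F" and Res_binder_thread: "r \<in> thread_names i"
    and Res_binder_inactive: "r \<notin> active_names (Res r S, l)"
proof -
  from assms obtain K where K_residual: "K \<in> thread_idents F i" "residual K (Res r S) l"
    by (auto simp: thread_place_Res)
  then have "K \<in> idents" "r \<in> set (res_binders (body K))" by (auto simp: residual_def)
  then show "r \<in> RESTR F" "r \<in> thread_names i"
    using res_binders_RESTR K_residual(1)
    by (auto simp: thread_names_def ident_names_def binders_def)
  show "r \<notin> active_names (Res r S, l)" using K_residual(2) by (auto simp: residual_def)
qed

lemma
  assumes "thread_place i (Sum bs, l)" and branch: "(Recv x y, S) \<in> set bs"
  shows Recv_binder_INP: "y \<in> INP F" and Recv_binder_thread: "y \<in> thread_names i"
    and Recv_binder_inactive: "y \<notin> active_names (Sum bs, l)"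
proof -
  from assms obtain K where K_residual: "K \<in> thread_idents F i" "residual K (Sum bs) l"
    by (auto simp: thread_place_Sum)
  have y_inp: "y \<in> set (inp_binders (Sum bs))" using branch by (force simp: set_inp_binders_Sum)
  then have "K \<in> idents" "y \<in> set (inp_binders (body K))"
    using K_residual by (auto simp: residual_def)
  then show "y \<in> INP F" "y \<in> thread_names i"
    using inp_binders_INP K_residual(1) by (auto simp: thread_names_def ident_names_def binders_def)
  have "y \<in> binders (Sum bs)" using y_inp by (simp add: binders_def)
  then show "y \<notin> active_names (Sum bs, l)"
    using K_residual(2) unfolding active_names_residual[OF K_residual(2)] residual_def wf_thread_def
    by blast
qed

lemma
  assumes "thread_place i (Call L (xs @ [x]), l)" and len: "length xs < length (formals L)"
  shows formal_FRM: "formals L ! length xs \<in> FRM F"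
    and formal_thread: "formals L ! length xs \<in> thread_names i"
    and formal_inactive: "formals L ! length xs \<notin> active_names (Call L (xs @ [x]), l)"
proof -
  let ?f = "formals L ! length xs"
  from assms obtain K where K_calling: "K \<in> thread_idents F i" "calling K L (xs @ [x]) l"
    by (auto simp: thread_place_Call)
  note L_callee = calling_callee[OF K_calling(2)]
  have formal: "?f \<in> set (formals L)" using len by simp
  then show "?f \<in> FRM F" using formals_FRM[OF L_callee] by blast
  have formal_name: "?f \<in> ident_names L" using formal by (simp add: ident_names_def)
  then show "?f \<in> thread_names i" using calling_names[OF K_calling] by blast
  have "?f \<notin> ident_names K" using formal_name calling_names_disjoint[OF K_calling(2)] by blast
  moreover have "?f \<notin> set (drop (Suc (length xs)) (formals L))"
    using distinct_formals[OF L_callee] len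
    by (metis Cons_nth_drop_Suc distinct.simps(2) distinct_drop)
  ultimately show "?f \<notin> active_names (Call L (xs @ [x]), l)"
    using K_calling(2) by (auto simp: calling_def)
qed

lemma unmapped_not_formal:
  assumes "thread_place i (Call L [], x # l)" shows "x \<notin> set (formals L)"
proof -
  from assms obtain K where call: "calling K L [] (x # l)" by (auto simp: thread_place_Call)
  then have "x \<in> ident_names K" by (auto simp: calling_def)
  then show ?thesis using calling_names_disjoint[OF call] by (auto simp: ident_names_def)
qed

lemma unmapped_thread: "thread_place i (Call L [], x # l) \<Longrightarrow> x \<in> thread_names i"
  using active_names_thread by fastforce

subsection \<open>Steps of a thread\<close>

definition valid_subst :: "(name \<rightharpoonup> name) \<Rightarrow> bool" where
  "valid_subst \<theta> \<longleftrightarrow> dom \<theta> \<subseteq> RESTR F \<union> INP F \<union> FRM F \<and> ran \<theta> \<subseteq> PUB F \<union> NEW \<and>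
     (\<forall>r\<in>RESTR F. \<forall>a. \<theta> r = Some a \<longrightarrow> a \<in> NEW) \<and>
     (\<forall>r\<in>RESTR F. \<forall>r'\<in>RESTR F. \<forall>a. \<theta> r = Some a \<longrightarrow> \<theta> r' = Some a \<longrightarrow> r = r')"

lemma
  assumes "valid_subst \<theta>" "\<theta> x = Some a"
  shows valid_subst_range: "a \<in> PUB F \<union> NEW" and valid_subst_domain: "x \<in> RESTR F \<union> INP F \<union> FRM F"
    and valid_subst_RESTR: "x \<in> RESTR F \<Longrightarrow> a \<in> NEW"
  using assms by (auto simp: valid_subst_def ran_def)

lemma valid_subst_allocate:
  "valid_subst \<theta> \<Longrightarrow> r \<in> RESTR F \<Longrightarrow> m \<in> NEW \<Longrightarrow> m \<notin> ran \<theta> \<Longrightarrow> valid_subst (\<theta>(r \<mapsto> m))"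
  unfolding valid_subst_def by (auto simp: ran_def)

lemma valid_subst_map:
  assumes "valid_subst \<theta>" "x \<in> INP F \<union> FRM F" "a \<in> PUB F \<union> NEW"
  shows "valid_subst (\<theta>(x \<mapsto> a))"
proof -
  have "x \<notin> RESTR F" using assms(2) binder_classes_disjoint by blast
  with assms show ?thesis unfolding valid_subst_def by (auto simp: ran_def)
qed

lemma valid_subst_unmap: "valid_subst \<theta> \<Longrightarrow> valid_subst (\<theta>(x := None))"
  unfolding valid_subst_def by (auto simp: ran_def)

definition at_place :: "nat \<Rightarrow> aug \<Rightarrow> (name \<rightharpoonup> name) \<Rightarrow> bool" where
  "at_place i q \<theta> \<longleftrightarrow>
     thread_place i q \<and> dom \<theta> \<inter> thread_names i = active_names q \<and> valid_subst \<theta>"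

lemma
  assumes "at_place i q \<theta>"
  shows at_place_thread_place: "thread_place i q" and at_place_valid_subst: "valid_subst \<theta>"
    and at_place_active: "x \<in> active_names q \<Longrightarrow> x \<in> dom \<theta>"
    and at_place_inactive: "x \<in> thread_names i \<Longrightarrow> x \<notin> active_names q \<Longrightarrow> \<theta> x = None"
  using assms by (auto simp: at_place_def)

lemma Res_binder_unmapped: "at_place i (Res r S, l) \<theta> \<Longrightarrow> \<theta> r = None"
  using at_place_inactive at_place_thread_place Res_binder_thread Res_binder_inactive by blast

lemma Recv_binder_unmapped:
  "at_place i (Sum bs, l) \<theta> \<Longrightarrow> (Recv x y, S) \<in> set bs \<Longrightarrow> \<theta> y = None"
  using at_place_inactive at_place_thread_place Recv_binder_thread Recv_binder_inactive by blast

lemma formal_unmapped: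
  "at_place i (Call L (xs @ [x]), l) \<theta> \<Longrightarrow> length xs < length (formals L) \<Longrightarrow>
   \<theta> (formals L ! length xs) = None"
  using at_place_inactive at_place_thread_place formal_thread formal_inactive by blast

inductive thread_step ::
  "(name \<rightharpoonup> name) \<Rightarrow> aug \<Rightarrow> label \<Rightarrow> command set \<Rightarrow> aug \<Rightarrow> (name \<rightharpoonup> name) \<Rightarrow> bool"
  for \<theta> :: "name \<rightharpoonup> name" where
  nu: "m \<in> NEW \<Longrightarrow> m \<notin> ran \<theta> \<Longrightarrow>
    thread_step \<theta> (Res r S, l) LTau {MapTo r m} (S, l) (\<theta>(r \<mapsto> m))"
| tau: "(Tau, S) \<in> set bs \<Longrightarrow>
    thread_step \<theta> (Sum bs, l) LTau {} (S, l @ dropped bs S) \<theta>"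
| snd: "(Send x y, S) \<in> set bs \<Longrightarrow> \<theta> x = Some a \<Longrightarrow> \<theta> y = Some b \<Longrightarrow>
    thread_step \<theta> (Sum bs, l) (LSend a b) {Test x a, Test y b} (S, l @ dropped bs S) \<theta>"
| rec: "(Recv x y, S) \<in> set bs \<Longrightarrow> \<theta> x = Some a \<Longrightarrow> b \<in> PUB F \<union> NEW \<Longrightarrow>
    thread_step \<theta> (Sum bs, l) (LRec a b) {Test x a, MapTo y b} (S, l @ dropped bs S) (\<theta>(y \<mapsto> b))"
| call1: "K \<in> idents \<Longrightarrow> length xs < length (formals K) \<Longrightarrow> \<theta> x = Some a \<Longrightarrow>
    thread_step \<theta> (Call K (xs @ [x]), l) LTau {Test x a, MapTo (formals K ! length xs) a}
      (Call K xs, if x \<in> set l then l else l @ [x]) (\<theta>(formals K ! length xs \<mapsto> a))"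
| call2: "\<theta> x = Some a \<Longrightarrow>
    thread_step \<theta> (Call K [], x # l) LTau {Unmap x a} (Call K [], l) (\<theta>(x := None))"
| call3: "K \<in> idents \<Longrightarrow> thread_step \<theta> (Call K [], []) LTau {} (body K, []) \<theta>"

lemma thread_step_cf_trans:
  assumes "thread_step \<theta> q lab C q' \<theta>'" "valid_subst \<theta>"
  shows "(q, lab, C, q') \<in> cf_trans F NEW"
  using assms
proof (induction rule: thread_step.induct)
  case (call1 K xs x a l)
  then show ?case using ident_eqs valid_subst_range by (intro cf_trans.call1) auto
next
  case (call3 K)
  then show ?case using ident_eqs by (intro cf_trans.call3)
qed (use valid_subst_range in \<open>auto intro!: cf_trans.nu cf_trans.tau cf_trans.snd cf_trans.rec
    cf_trans.call2\<close>)

lemma thread_step_cf_step: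
  "thread_step \<theta> q lab C q' \<theta>' \<Longrightarrow> valid_subst \<theta> \<Longrightarrow> (q, q') \<in> cf_step F NEW"
  using thread_step_cf_trans unfolding cf_step_def by blast

lemma thread_step_SumE:
  assumes "thread_step \<theta> (Sum bs, l) lab C q' \<theta>'"
  obtains \<pi> S where "(\<pi>, S) \<in> set bs" "q' = (S, l @ dropped bs S)"
    "\<theta>' = \<theta> \<and> prefix_bound \<pi> = {} \<or>
     (\<exists>x y b. \<pi> = Recv x y \<and> b \<in> PUB F \<union> NEW \<and> \<theta>' = \<theta>(y \<mapsto> b))"
  using assms by cases fastforce+

lemma residual_thread_step_Sum:
  assumes place: "at_place i (Sum bs, l) \<theta>" and step: "thread_step \<theta> (Sum bs, l) lab C q' \<theta>'"
  shows "\<exists>K\<in>thread_idents F i. residual K (Sum bs) l \<and> residual K (fst q') (snd q')"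
proof -
  from place obtain K where K_residual: "K \<in> thread_idents F i" "residual K (Sum bs) l"
    by (auto simp: at_place_def thread_place_Sum)
  from step obtain \<pi> S where "(\<pi>, S) \<in> set bs" "q' = (S, l @ dropped bs S)"
    by (rule thread_step_SumE)
  then have "residual K (fst q') (snd q')"
    using residual_branch[OF K_residual(2)]
      thread_step_cf_step[OF step at_place_valid_subst[OF place]]
    by simp
  with K_residual show ?thesis by blast
qed

lemma residual_thread_step_Res:
  assumes place: "at_place i (Res r S, l) \<theta>" and step: "thread_step \<theta> (Res r S, l) lab C (S, l) \<theta>'"
  shows "\<exists>K\<in>thread_idents F i. residual K (Res r S) l \<and> residual K S l"
proof -
  from place obtain K where K_residual: "K \<in> thread_idents F i" "residual K (Res r S) l"
    by (auto simp: at_place_def thread_place_Res)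
  then have "residual K S l"
    using residual_Res thread_step_cf_step[OF step at_place_valid_subst[OF place]] by blast
  with K_residual show ?thesis by blast
qed

lemma at_place_extend:
  assumes "at_place i q \<theta>" "thread_place i q'" "active_names q' = insert x (active_names q)"
    and "x \<in> thread_names i" "valid_subst (\<theta>(x \<mapsto> a))"
  shows "at_place i q' (\<theta>(x \<mapsto> a))"
  using assms by (auto simp: at_place_def)

lemma at_place_Sum_step:
  assumes place: "at_place i (Sum bs, l) \<theta>" and step: "thread_step \<theta> (Sum bs, l) lab C q' \<theta>'"
  shows "at_place i q' \<theta>' \<and> (\<forall>x. x \<notin> thread_names i \<longrightarrow> \<theta>' x = \<theta> x)"
proof -
  note Sum_place = at_place_thread_place[OF place]
  from step obtain \<pi> S where branch: "(\<pi>, S) \<in> set bs" and q'_eq: "q' = (S, l @ dropped bs S)"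
    and effect: "\<theta>' = \<theta> \<and> prefix_bound \<pi> = {} \<or>
      (\<exists>x y b. \<pi> = Recv x y \<and> b \<in> PUB F \<union> NEW \<and> \<theta>' = \<theta>(y \<mapsto> b))" by (rule thread_step_SumE)
  from residual_thread_step_Sum[OF place step] obtain K where K_residual: "K \<in> thread_idents F i"
    and res: "residual K (Sum bs) l" "residual K S (l @ dropped bs S)" by (auto simp: q'_eq)
  have place': "thread_place i q'"
    using K_residual res(2) residual_thread_place by (simp add: q'_eq)
  have active: "active_names q' = active_names (Sum bs, l) \<union> prefix_bound \<pi>"
    unfolding q'_eq by (rule active_names_branch[OF res branch])
  from effect show ?thesis
  proof (elim disjE exE conjE)
    assume "\<theta>' = \<theta>" "prefix_bound \<pi> = {}"
    then show ?thesis using place place' active by (simp add: at_place_def)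
  next
    fix x y b assume recv: "\<pi> = Recv x y" "b \<in> PUB F \<union> NEW" "\<theta>' = \<theta>(y \<mapsto> b)"
    have y_inp: "y \<in> INP F" "y \<in> thread_names i"
      using Recv_binder_INP[OF Sum_place] Recv_binder_thread[OF Sum_place] branch recv(1) by auto
    then have "valid_subst (\<theta>(y \<mapsto> b))"
      using recv(2) by (intro valid_subst_map at_place_valid_subst[OF place]) auto
    then have "at_place i q' \<theta>'"
      unfolding recv(3) using active recv(1) y_inp(2)
      by (intro at_place_extend[OF place place']) auto
    then show ?thesis using y_inp(2) by (auto simp: recv(3))
  qed
qed

lemma at_place_nu_step:
  assumes place: "at_place i (Res r S, l) \<theta>" and m_unused: "m \<in> NEW" "m \<notin> ran \<theta>"
  shows "at_place i (S, l) (\<theta>(r \<mapsto> m)) \<and> r \<in> thread_names i"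
proof -
  note Res_place = at_place_thread_place[OF place]
  from residual_thread_step_Res[OF place thread_step.nu[OF m_unused]]
  obtain K where K_residual: "K \<in> thread_idents F i"
    and res: "residual K (Res r S) l" "residual K S l" by blast
  have r_restr: "r \<in> RESTR F" "r \<in> thread_names i" "r \<in> fn S"
    using Res_binder_RESTR[OF Res_place] Res_binder_thread[OF Res_place] res(1)
    by (auto simp: residual_def wf_thread_def)
  have "active_names (S, l) = insert r (active_names (Res r S, l))"
    using r_restr(3) active_names_residual[OF res(2)] by auto
  then show ?thesis
    using at_place_extend[OF place residual_thread_place[OF K_residual res(2)]] r_restr(2)
      valid_subst_allocate[OF at_place_valid_subst[OF place] r_restr(1) m_unused] by blast
qed

lemma at_place_call1_step:
  assumes place: "at_place i (Call K (xs @ [x]), l) \<theta>" and len: "length xs < length (formals K)"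
    and "\<theta> x = Some a"
  shows "at_place i (Call K xs, if x \<in> set l then l else l @ [x]) (\<theta>(formals K ! length xs \<mapsto> a)) \<and>
    formals K ! length xs \<in> thread_names i" (is "at_place i ?q (\<theta>(?f \<mapsto> a)) \<and> _")
proof -
  note Call_place = at_place_thread_place[OF place]
  from Call_place obtain K0 where "K0 \<in> thread_idents F i" "calling K0 K (xs @ [x]) l"
    by (auto simp: thread_place_Call)
  then have "thread_place i ?q" using len by (auto simp: thread_place_Call calling_def)
  moreover have "set (drop (length xs) (formals K)) =
      insert ?f (set (drop (Suc (length xs)) (formals K)))"
    using len by (metis Cons_nth_drop_Suc list.simps(15))
  then have "active_names ?q = insert ?f (active_names (Call K (xs @ [x]), l))" by auto
  moreover have "valid_subst (\<theta>(?f \<mapsto> a))"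
    using formal_FRM[OF Call_place len] at_place_valid_subst[OF place] valid_subst_range assms(3)
    by (intro valid_subst_map) auto
  ultimately show ?thesis
    using at_place_extend[OF place] formal_thread[OF Call_place len] by blast
qed

lemma at_place_call2_step:
  assumes place: "at_place i (Call K [], x # l) \<theta>"
  shows "at_place i (Call K [], l) (\<theta>(x := None))"
proof -
  from place obtain K0 where call: "K0 \<in> thread_idents F i" "calling K0 K [] (x # l)"
    by (auto simp: at_place_def thread_place_Call)
  then have "thread_place i (Call K [], l)" by (auto simp: thread_place_Call calling_def)
  moreover have "active_names (Call K [], l) = active_names (Call K [], x # l) - {x}"
    using unmapped_not_formal[OF at_place_thread_place[OF place]] call(2)
    by (auto simp: calling_def)
  ultimately show ?thesis using place valid_subst_unmap by (auto simp: at_place_def)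
qed

lemma at_place_call3_step:
  assumes place: "at_place i (Call K [], []) \<theta>"
  shows "at_place i (body K, []) \<theta>"
proof -
  from place obtain K0 where K0_thread: "K0 \<in> thread_idents F i" and call: "calling K0 K [] []"
    by (auto simp: at_place_def thread_place_Call)
  note body = residual_body[OF calling_callee[OF call]]
  have "K \<in> thread_idents F i"
    using K0_thread calling_call_graph[OF call] by (rule thread_idents_call)
  then have "thread_place i (body K, [])" using body by (rule residual_thread_place)
  moreover have "active_names (body K, []) = active_names (Call K [], [])"
    using active_names_residual[OF body] fn_body[OF calling_callee[OF call]] by simp
  ultimately show ?thesis using place by (simp add: at_place_def)
qed

lemma
  assumes step: "thread_step \<theta> q lab C q' \<theta>'" and place: "at_place i q \<theta>"
  shows at_place_thread_step: "at_place i q' \<theta>'"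
    and thread_step_other_names: "x \<notin> thread_names i \<Longrightarrow> \<theta>' x = \<theta> x"
proof -
  have "at_place i q' \<theta>' \<and> (\<forall>x. x \<notin> thread_names i \<longrightarrow> \<theta>' x = \<theta> x)"
    using step
  proof cases
    case (nu m r S l)
    then show ?thesis using at_place_nu_step place by auto
  next
    case (call1 K xs x a l)
    then show ?thesis using at_place_call1_step place by auto
  next
    case (call2 x a K l)
    then show ?thesis
      using at_place_call2_step place unmapped_thread by (auto dest: at_place_thread_place)
  next
    case (call3 K)
    then show ?thesis using at_place_call3_step place by auto
  qed (use at_place_Sum_step step place in metis)+
  then show "at_place i q' \<theta>'" "x \<notin> thread_names i \<Longrightarrow> \<theta>' x = \<theta> x" by auto
qed

subsection \<open>Configurations and their markings\<close>

definition consistent :: "(nat \<Rightarrow> aug) \<Rightarrow> (name \<rightharpoonup> name) \<Rightarrow> bool" where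
  "consistent s \<theta> \<longleftrightarrow> (\<forall>i < n_threads F. at_place i (s i) \<theta> \<and> s i \<in> cf_places F NEW i) \<and>
     dom \<theta> \<subseteq> (\<Union>i < n_threads F. thread_names i) \<and> valid_subst \<theta>"

lemma
  assumes "consistent s \<theta>"
  shows consistent_valid_subst: "valid_subst \<theta>"
    and consistent_at_place: "i < n_threads F \<Longrightarrow> at_place i (s i) \<theta>"
    and consistent_cf_place: "i < n_threads F \<Longrightarrow> s i \<in> cf_places F NEW i"
    and consistent_active: "i < n_threads F \<Longrightarrow> x \<in> active_names (s i) \<Longrightarrow> x \<in> dom \<theta>"
  using assms at_place_active unfolding consistent_def by blast+

lemma consistent_thread_step:
  assumes cons: "consistent s \<theta>" and i_less: "i < n_threads F"
    and step: "thread_step \<theta> (s i) lab C q' \<theta>'"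
  shows "consistent (s(i := q')) \<theta>'"
proof -
  note place = consistent_at_place[OF cons i_less]
  note place' = at_place_thread_step[OF step place]
    and other = thread_step_other_names[OF step place]
  have "q' \<in> cf_places F NEW i"
    using consistent_cf_place[OF cons i_less]
      thread_step_cf_step[OF step consistent_valid_subst[OF cons]]
    unfolding cf_places_def by (auto intro: rtrancl.rtrancl_into_rtrancl)
  moreover have "at_place j (s j) \<theta>'" if other_thread: "j < n_threads F" "j \<noteq> i" for j
  proof -
    have "dom \<theta>' \<inter> thread_names j = dom \<theta> \<inter> thread_names j"
      using thread_names_disjoint[OF other_thread(1) i_less other_thread(2)] other
      by (force simp: dom_def)
    then show ?thesis
      using consistent_at_place[OF cons other_thread(1)] at_place_valid_subst[OF place']
      by (simp add: at_place_def)
  qed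
  moreover have "dom \<theta>' \<subseteq> (\<Union>i < n_threads F. thread_names i)"
  proof
    fix x assume "x \<in> dom \<theta>'"
    then have "x \<in> thread_names i \<or> x \<in> dom \<theta>" using other by (metis domIff)
    then show "x \<in> (\<Union>i < n_threads F. thread_names i)"
      using cons i_less unfolding consistent_def by blast
  qed
  ultimately show ?thesis
    using place' at_place_valid_subst[OF place'] cons by (auto simp: consistent_def)
qed

inductive config_step ::
  "(nat \<Rightarrow> aug) \<Rightarrow> (name \<rightharpoonup> name) \<Rightarrow> (nat \<Rightarrow> aug) \<Rightarrow> (name \<rightharpoonup> name) \<Rightarrow> bool"
  for s :: "nat \<Rightarrow> aug" and \<theta> :: "name \<rightharpoonup> name" where
  local_step: "i < n_threads F \<Longrightarrow> thread_step \<theta> (s i) LTau C q' \<theta>' \<Longrightarrow>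
    config_step s \<theta> (s(i := q')) \<theta>'"
| sync_step: "i < n_threads F \<Longrightarrow> j < n_threads F \<Longrightarrow> i \<noteq> j \<Longrightarrow>
    thread_step \<theta> (s i) (LSend a b) C q\<^sub>1 \<theta> \<Longrightarrow> thread_step \<theta> (s j) (LRec a b) D q\<^sub>2 \<theta>' \<Longrightarrow>
    config_step s \<theta> (s(i := q\<^sub>1, j := q\<^sub>2)) \<theta>'"

lemma consistent_config_step: "config_step s \<theta> s' \<theta>' \<Longrightarrow> consistent s \<theta> \<Longrightarrow> consistent s' \<theta>'"
proof (induction rule: config_step.induct)
  case (local_step i C q' \<theta>')
  then show ?case by (intro consistent_thread_step)
next
  case (sync_step i j a b C q\<^sub>1 D q\<^sub>2 \<theta>')
  have "consistent (s(i := q\<^sub>1)) \<theta>" using sync_step by (intro consistent_thread_step)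
  then show ?case using sync_step by (intro consistent_thread_step) auto
qed

fun mark_subst :: "(name \<rightharpoonup> name) \<Rightarrow> splace \<Rightarrow> nat" where
  "mark_subst \<theta> (EqP x a) = of_bool (\<theta> x = Some a)"
| "mark_subst \<theta> (NeqP x m) = of_bool (x \<in> INP F \<union> FRM F \<and> m \<in> NEW \<and> \<theta> x \<noteq> Some m)"
| "mark_subst \<theta> (NeqStar m) = of_bool (m \<in> NEW \<and> (\<forall>r\<in>RESTR F. \<theta> r \<noteq> Some m))"

fun mark_config :: "(nat \<Rightarrow> aug) \<Rightarrow> (name \<rightharpoonup> name) \<Rightarrow> nplace \<Rightarrow> nat" where
  "mark_config s \<theta> (Ctl i q) = of_bool (i < n_threads F \<and> q = s i)"
| "mark_config s \<theta> (Sub p) = mark_subst \<theta> p"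

lemma
  assumes "mark_config s \<theta> = mark_config s' \<theta>'"
  shows mark_config_inj_subst: "\<theta> = \<theta>'"
    and mark_config_inj_place: "i < n_threads F \<Longrightarrow> s i = s' i"
proof -
  have "\<theta> x = Some a \<longleftrightarrow> \<theta>' x = Some a" for x a
    using fun_cong[OF assms, of "Sub (EqP x a)"]
    by (simp only: mark_config.simps mark_subst.simps of_bool_eq_iff)
  then show "\<theta> = \<theta>'" by (intro ext) (metis not_Some_eq)
  show "s i = s' i" if "i < n_threads F"
    using fun_cong[OF assms, of "Ctl i (s i)"] that unfolding mark_config.simps of_bool_eq_iff
    by blast
qed

subsection \<open>Implementation of commands\<close>

definition cmds_pre :: "command set \<Rightarrow> splace set" where
  "cmds_pre C = (\<Union>c\<in>C. cmd_pre F NEW c)"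

definition cmds_post :: "command set \<Rightarrow> splace set" where
  "cmds_post C = (\<Union>c\<in>C. cmd_post F NEW c)"

definition implements :: "command set \<Rightarrow> (name \<rightharpoonup> name) \<Rightarrow> (name \<rightharpoonup> name) \<Rightarrow> bool" where
  "implements C \<theta> \<theta>' \<longleftrightarrow> (\<forall>p\<in>cmds_pre C. mark_subst \<theta> p > 0) \<and>
     cmds_pre C \<union> cmds_post C \<subseteq> subst_places F NEW \<and>
     (\<forall>p. mark_subst \<theta>' p =
        mark_subst \<theta> p - of_bool (p \<in> cmds_pre C) + of_bool (p \<in> cmds_post C))"

lemma implements_empty: "implements {} \<theta> \<theta>"
  by (simp add: implements_def cmds_pre_def cmds_post_def)

lemma implements_singleI:
  assumes "\<And>p. p \<in> cmd_pre F NEW c \<Longrightarrow> mark_subst \<theta> p > 0"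
    and "cmd_pre F NEW c \<union> cmd_post F NEW c \<subseteq> subst_places F NEW"
    and "\<And>p. mark_subst \<theta>' p =
      mark_subst \<theta> p - of_bool (p \<in> cmd_pre F NEW c) + of_bool (p \<in> cmd_post F NEW c)"
  shows "implements {c} \<theta> \<theta>'"
  using assms by (simp add: implements_def cmds_pre_def cmds_post_def)

lemma EqP_subst_place: "valid_subst \<theta> \<Longrightarrow> \<theta> x = Some a \<Longrightarrow> EqP x a \<in> subst_places F NEW"
  using valid_subst_range valid_subst_domain valid_subst_RESTR unfolding subst_places_def by blast

lemma implements_test:
  assumes "implements C \<theta> \<theta>'" "valid_subst \<theta>" "\<theta> x = Some a" "\<theta>' x = Some a"
  shows "implements (insert (Test x a) C) \<theta> \<theta>'"
proof -
  have "cmds_pre (insert (Test x a) C) = insert (EqP x a) (cmds_pre C)"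
    "cmds_post (insert (Test x a) C) = insert (EqP x a) (cmds_post C)"
    by (simp_all add: cmds_pre_def cmds_post_def)
  moreover have "mark_subst \<theta>' p = mark_subst \<theta> p - of_bool (p \<in> insert (EqP x a) (cmds_pre C))
      + of_bool (p \<in> insert (EqP x a) (cmds_post C))" for p
  proof (cases "p = EqP x a")
    case False
    then show ?thesis using assms(1) by (simp add: implements_def)
  qed (use assms(3,4) in simp)
  ultimately show ?thesis
    using assms(1,3) EqP_subst_place[OF assms(2,3)] unfolding implements_def by simp
qed

lemma implements_allocate:
  assumes "valid_subst \<theta>" "r \<in> RESTR F" "m \<in> NEW" "m \<notin> ran \<theta>" "\<theta> r = None"
  shows "implements {MapTo r m} \<theta> (\<theta>(r \<mapsto> m))"
proof (rule implements_singleI)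
  fix p
  show "mark_subst \<theta> p > 0" if "p \<in> cmd_pre F NEW (MapTo r m)"
    using that assms by (auto simp: ran_def)
  show "mark_subst (\<theta>(r \<mapsto> m)) p = mark_subst \<theta> p - of_bool (p \<in> cmd_pre F NEW (MapTo r m))
      + of_bool (p \<in> cmd_post F NEW (MapTo r m))"
  proof (cases p)
    case (NeqStar k)
    have "(\<forall>r'\<in>RESTR F. (\<theta>(r \<mapsto> m)) r' \<noteq> Some k) \<longleftrightarrow>
        k \<noteq> m \<and> (\<forall>r'\<in>RESTR F. \<theta> r' \<noteq> Some k)"
      using assms(2,5) by (metis fun_upd_apply option.distinct(1) option.inject)
    then show ?thesis using assms(2-4) NeqStar by (auto simp: ran_def)
  qed (use assms binder_classes_disjoint in \<open>auto simp: ran_def\<close>)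
qed (use assms in \<open>auto simp: subst_places_def\<close>)

lemma implements_map:
  assumes "f \<in> INP F \<union> FRM F" "\<theta> f = None" "b \<in> PUB F \<union> NEW"
  shows "implements {MapTo f b} \<theta> (\<theta>(f \<mapsto> b))"
proof (rule implements_singleI)
  have f_not_restr: "f \<notin> RESTR F" using assms(1) binder_classes_disjoint by blast
  fix p
  show "mark_subst \<theta> p > 0" if "p \<in> cmd_pre F NEW (MapTo f b)"
    using that assms f_not_restr by (auto split: if_splits)
  show "mark_subst (\<theta>(f \<mapsto> b)) p = mark_subst \<theta> p - of_bool (p \<in> cmd_pre F NEW (MapTo f b))
      + of_bool (p \<in> cmd_post F NEW (MapTo f b))"
  proof (cases p)
    case (NeqStar m)
    have "(\<forall>r\<in>RESTR F. (\<theta>(f \<mapsto> b)) r \<noteq> Some m) \<longleftrightarrow> (\<forall>r\<in>RESTR F. \<theta> r \<noteq> Some m)"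
      using f_not_restr by auto
    then show ?thesis using f_not_restr NeqStar by simp
  qed (use assms f_not_restr in auto)
  show "cmd_pre F NEW (MapTo f b) \<union> cmd_post F NEW (MapTo f b) \<subseteq> subst_places F NEW"
    using assms f_not_restr by (auto simp: subst_places_def)
qed

lemma implements_unmap:
  assumes valid: "valid_subst \<theta>" and x_mapped: "\<theta> x = Some a"
  shows "implements {Unmap x a} \<theta> (\<theta>(x := None))"
proof (rule implements_singleI)
  note domain = valid_subst_domain[OF assms] and RESTR = valid_subst_RESTR[OF assms]
  have inj: "\<forall>r\<in>RESTR F. r \<noteq> x \<longrightarrow> \<theta> r \<noteq> Some a" if "x \<in> RESTR F"
    using that valid x_mapped unfolding valid_subst_def by blast
  fix p
  show "mark_subst \<theta> p > 0" if "p \<in> cmd_pre F NEW (Unmap x a)" using that x_mapped by auto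
  show "mark_subst (\<theta>(x := None)) p = mark_subst \<theta> p - of_bool (p \<in> cmd_pre F NEW (Unmap x a))
      + of_bool (p \<in> cmd_post F NEW (Unmap x a))"
  proof (cases p)
    case (EqP y b)
    then show ?thesis using x_mapped by simp
  next
    case (NeqP y m)
    have "y \<in> INP F \<union> FRM F \<Longrightarrow> y \<notin> RESTR F" using binder_classes_disjoint by blast
    then show ?thesis using x_mapped domain NeqP by auto
  next
    case (NeqStar m)
    show ?thesis
    proof (cases "x \<in> RESTR F")
      case True
      then show ?thesis using x_mapped inj[OF True] RESTR[OF True] NeqStar by auto
    next
      case False
      then have "(\<forall>r\<in>RESTR F. (\<theta>(x := None)) r \<noteq> Some m) \<longleftrightarrow> (\<forall>r\<in>RESTR F. \<theta> r \<noteq> Some m)" by auto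
      then show ?thesis using NeqStar False by simp
    qed
  qed
  show "cmd_pre F NEW (Unmap x a) \<union> cmd_post F NEW (Unmap x a) \<subseteq> subst_places F NEW"
    using EqP_subst_place[OF assms] domain by (auto simp: subst_places_def)
qed

lemma implements_thread_step:
  assumes step: "thread_step \<theta> q lab C q' \<theta>'" and place: "at_place i q \<theta>"
  shows "implements C \<theta> \<theta>'"
proof -
  note thread_place = at_place_thread_place[OF place] and valid = at_place_valid_subst[OF place]
  show ?thesis using step
  proof cases
    case (nu m r S l)
    then show ?thesis
      using implements_allocate valid Res_binder_RESTR Res_binder_unmapped place thread_place
      by blast
  next
    case (snd x y S bs a b l)
    then show ?thesis using implements_empty by (simp add: implements_test valid)
  next
    case (rec x y S bs a b l)
    then show ?thesis
      using Recv_binder_INP[OF thread_place[unfolded rec(1)] rec(6)]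
        Recv_binder_unmapped[OF place[unfolded rec(1)] rec(6)]
      by (auto intro!: implements_test valid implements_map)
  next
    case (call1 K xs x a l)
    then show ?thesis
      using formal_FRM[OF thread_place[unfolded call1(1)] call1(7)]
        formal_unmapped[OF place[unfolded call1(1)] call1(7)] valid_subst_range[OF valid call1(8)]
      by (auto intro!: implements_test valid implements_map)
  next
    case (call2 x a K l)
    then show ?thesis using implements_unmap[OF valid] by blast
  qed (auto simp: implements_empty)
qed

lemma implements_sync:
  assumes send: "thread_step \<theta> q\<^sub>1 (LSend a b) C q\<^sub>1' \<theta>" and receive: "implements D \<theta> \<theta>'"
    and "valid_subst \<theta>" and "\<And>x. x \<in> active_names q\<^sub>1 \<Longrightarrow> \<theta>' x = \<theta> x"
  shows "implements (C \<union> D) \<theta> \<theta>'"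
  using send
proof cases
  case (snd x y S bs l)
  have "{x, y} \<subseteq> fn (Sum bs)" using fn_branch_subset[OF snd(4)] by simp
  then have "\<theta>' x = Some a" "\<theta>' y = Some b" using assms(4) snd by (simp_all add: snd(1) del: fn_Sum)
  then show ?thesis
    using implements_test[OF implements_test[OF receive assms(3)] assms(3)] snd by simp
qed

subsection \<open>Steps of the net\<close>

abbreviation net :: "(splace \<Rightarrow> nat) \<Rightarrow> (nplace, ntrans) petri_net" where
  "net M \<equiv> fcp_net F NEW M"

lemma flow_net:
  "(Ctl i q, t) \<in> flow_pt (net M) \<longleftrightarrow> t \<in> net_trans F NEW \<and> (i, q) \<in> ctl_pre t"
  "(Sub p, t) \<in> flow_pt (net M) \<longleftrightarrow> t \<in> net_trans F NEW \<and> p \<in> sub_pre F NEW t"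
  "(t, Ctl i q) \<in> flow_tp (net M) \<longleftrightarrow> t \<in> net_trans F NEW \<and> (i, q) \<in> ctl_post t"
  "(t, Sub p) \<in> flow_tp (net M) \<longleftrightarrow> t \<in> net_trans F NEW \<and> p \<in> sub_post F NEW t"
  by (cases q; auto simp: fcp_net_def)+

lemma enabled_net:
  "enabled (net M\<^sub>0) M t \<longleftrightarrow> t \<in> net_trans F NEW \<and> (\<forall>(i, q) \<in> ctl_pre t. M (Ctl i q) > 0) \<and>
     (\<forall>p \<in> sub_pre F NEW t. M (Sub p) > 0)"
proof -
  have "transitions (net M\<^sub>0) = net_trans F NEW" by (simp add: fcp_net_def)
  moreover have "(\<forall>p. (p, t) \<in> flow_pt (net M\<^sub>0) \<longrightarrow> M p > 0) \<longleftrightarrow>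
      (\<forall>i q. (Ctl i q, t) \<in> flow_pt (net M\<^sub>0) \<longrightarrow> M (Ctl i q) > 0) \<and>
      (\<forall>p. (Sub p, t) \<in> flow_pt (net M\<^sub>0) \<longrightarrow> M (Sub p) > 0)"
    by (metis nplace.exhaust)
  ultimately show ?thesis unfolding enabled_def flow_net by auto
qed

lemma Local_par_trans:
  "i < n_threads F \<Longrightarrow> q \<in> cf_places F NEW i \<Longrightarrow> (q, lab, C, q') \<in> cf_trans F NEW \<Longrightarrow>
   Local i (q, lab, C, q') \<in> par_trans F NEW"
  by (cases q; cases q') (auto simp: par_trans_def cf_net_trans_def)

lemma Sync_par_trans:
  "i < n_threads F \<Longrightarrow> j < n_threads F \<Longrightarrow> i \<noteq> j \<Longrightarrow>
   q\<^sub>1 \<in> cf_places F NEW i \<Longrightarrow> (q\<^sub>1, LSend a b, C, q\<^sub>1') \<in> cf_trans F NEW \<Longrightarrow>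
   q\<^sub>2 \<in> cf_places F NEW j \<Longrightarrow> (q\<^sub>2, LRec a b, D, q\<^sub>2') \<in> cf_trans F NEW \<Longrightarrow>
   Sync i (q\<^sub>1, LSend a b, C, q\<^sub>1') j (q\<^sub>2, LRec a b, D, q\<^sub>2') \<in> par_trans F NEW"
  by (cases q\<^sub>1; cases q\<^sub>1'; cases q\<^sub>2; cases q\<^sub>2') (auto simp: par_trans_def cf_net_trans_def)

lemma par_transE:
  assumes "t \<in> par_trans F NEW"
  obtains (Local) i q lab C q' where "t = Local i (q, lab, C, q')" "i < n_threads F"
      "(q, lab, C, q') \<in> cf_trans F NEW"
    | (Sync) i j q\<^sub>1 a b C q\<^sub>1' q\<^sub>2 D q\<^sub>2' where "i < n_threads F" "j < n_threads F" "i \<noteq> j"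
      "t = Sync i (q\<^sub>1, LSend a b, C, q\<^sub>1') j (q\<^sub>2, LRec a b, D, q\<^sub>2')"
      "(q\<^sub>1, LSend a b, C, q\<^sub>1') \<in> cf_trans F NEW" "(q\<^sub>2, LRec a b, D, q\<^sub>2') \<in> cf_trans F NEW"
  using assms unfolding par_trans_def cf_net_trans_def by auto

lemma
  assumes t_trans: "t \<in> par_trans F NEW" "ntrans_label t = LTau"
    and commands: "implements (ntrans_commands t) \<theta> \<theta>'"
    and pre: "ctl_pre t = (\<lambda>i. (i, s i)) ` I" and post: "ctl_post t = (\<lambda>i. (i, s' i)) ` I"
    and I_threads: "I \<subseteq> {..<n_threads F}" and others: "\<And>i. i \<notin> I \<Longrightarrow> s' i = s i"
  shows enabled_mark_config: "enabled (net M) (mark_config s \<theta>) t"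
    and fire_mark_config: "fire (net M) (mark_config s \<theta>) t = mark_config s' \<theta>'"
proof -
  have sub: "sub_pre F NEW t = cmds_pre (ntrans_commands t)"
    "sub_post F NEW t = cmds_post (ntrans_commands t)"
    by (simp_all add: sub_pre_def sub_post_def cmds_pre_def cmds_post_def)
  have net_trans: "t \<in> net_trans F NEW"
    using t_trans commands by (auto simp: net_trans_def sub implements_def)
  then show "enabled (net M) (mark_config s \<theta>) t"
    using commands I_threads by (auto simp: enabled_net pre sub implements_def)
  show "fire (net M) (mark_config s \<theta>) t = mark_config s' \<theta>'"
  proof
    fix p
    show "fire (net M) (mark_config s \<theta>) t p = mark_config s' \<theta>' p"
    proof (cases p)
      case (Ctl i q)
      then show ?thesis
        using net_trans I_threads others[of i] by (auto simp: fire_def flow_net pre post)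
    next
      case (Sub p')
      then show ?thesis
        using net_trans commands by (simp add: fire_def flow_net sub implements_def)
    qed
  qed
qed

lemma
  assumes cons: "consistent s \<theta>" and i_less: "i < n_threads F"
    and step: "thread_step \<theta> (s i) LTau C q' \<theta>'"
  shows enabled_local: "enabled (net M) (mark_config s \<theta>) (Local i (s i, LTau, C, q'))"
    and fire_local: "fire (net M) (mark_config s \<theta>) (Local i (s i, LTau, C, q')) =
      mark_config (s(i := q')) \<theta>'"
proof -
  let ?t = "Local i (s i, LTau, C, q')"
  have par_trans: "?t \<in> par_trans F NEW"
    using Local_par_trans i_less consistent_cf_place[OF cons i_less]
      thread_step_cf_trans[OF step consistent_valid_subst[OF cons]] by blast
  have commands: "implements (ntrans_commands ?t) \<theta> \<theta>'"
    using implements_thread_step[OF step consistent_at_place[OF cons i_less]] by simp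
  show "enabled (net M) (mark_config s \<theta>) ?t"
    by (rule enabled_mark_config[OF par_trans _ commands, where I = "{i}" and s' = "s(i := q')"])
      (use i_less in auto)
  show "fire (net M) (mark_config s \<theta>) ?t = mark_config (s(i := q')) \<theta>'"
    by (rule fire_mark_config[OF par_trans _ commands, where I = "{i}"]) (use i_less in auto)
qed

lemma
  assumes cons: "consistent s \<theta>" and threads: "i < n_threads F" "j < n_threads F" "i \<noteq> j"
    and send: "thread_step \<theta> (s i) (LSend a b) C q\<^sub>1 \<theta>"
    and receive: "thread_step \<theta> (s j) (LRec a b) D q\<^sub>2 \<theta>'"
  shows enabled_sync:
      "enabled (net M) (mark_config s \<theta>) (Sync i (s i, LSend a b, C, q\<^sub>1) j (s j, LRec a b, D, q\<^sub>2))"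
    and fire_sync:
      "fire (net M) (mark_config s \<theta>) (Sync i (s i, LSend a b, C, q\<^sub>1) j (s j, LRec a b, D, q\<^sub>2)) =
        mark_config (s(i := q\<^sub>1, j := q\<^sub>2)) \<theta>'"
proof -
  let ?t = "Sync i (s i, LSend a b, C, q\<^sub>1) j (s j, LRec a b, D, q\<^sub>2)"
  note valid = consistent_valid_subst[OF cons] and place = consistent_at_place[OF cons]
  have par_trans: "?t \<in> par_trans F NEW"
    using Sync_par_trans threads consistent_cf_place[OF cons]
      thread_step_cf_trans[OF send valid] thread_step_cf_trans[OF receive valid] by blast
  have "\<theta>' x = \<theta> x" if "x \<in> active_names (s i)" for x
    using that active_names_thread[OF at_place_thread_place[OF place[OF threads(1)]]]
      thread_names_disjoint[OF threads] thread_step_other_names[OF receive place[OF threads(2)]]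
    by blast
  then have commands: "implements (ntrans_commands ?t) \<theta> \<theta>'"
    using implements_sync[OF send implements_thread_step[OF receive place[OF threads(2)]] valid]
    by simp
  show "enabled (net M) (mark_config s \<theta>) ?t"
    by (rule enabled_mark_config[OF par_trans _ commands,
          where I = "{i, j}" and s' = "s(i := q\<^sub>1, j := q\<^sub>2)"]) (use threads in auto)
  show "fire (net M) (mark_config s \<theta>) ?t = mark_config (s(i := q\<^sub>1, j := q\<^sub>2)) \<theta>'"
    by (rule fire_mark_config[OF par_trans _ commands, where I = "{i, j}"]) (use threads in auto)
qed

lemma unused_if_allocatable:
  assumes "valid_subst \<theta>" "r \<in> RESTR F" "m \<in> NEW"
    and marked: "\<And>p. p \<in> cmd_pre F NEW (MapTo r m) \<Longrightarrow> mark_subst \<theta> p > 0"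
  shows "m \<notin> ran \<theta>"
proof
  assume "m \<in> ran \<theta>"
  then obtain x where x_mapped: "\<theta> x = Some m" by (auto simp: ran_def)
  then consider "x \<in> RESTR F" | "x \<in> INP F \<union> FRM F" using valid_subst_domain[OF assms(1)] by blast
  then show False
  proof cases
    assume "x \<in> RESTR F"
    then show False using marked[of "NeqStar m"] x_mapped assms(2,3) by auto
  next
    assume "x \<in> INP F \<union> FRM F"
    then show False using marked[of "NeqP x m"] x_mapped assms(2,3) by auto
  qed
qed

lemma cf_trans_thread_step:
  assumes trans: "(q, lab, C, q') \<in> cf_trans F NEW" and "thread_place i q" "valid_subst \<theta>"
    and marked: "\<And>c p. c \<in> C \<Longrightarrow> p \<in> cmd_pre F NEW c \<Longrightarrow> mark_subst \<theta> p > 0"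
  shows "\<exists>\<theta>'. thread_step \<theta> q lab C q' \<theta>'"
proof -
  have test: "\<theta> x = Some a" if "Test x a \<in> C" for x a
    using marked[OF that] by (simp split: if_splits)
  obtain S l S' l' where q_eq: "q = (S, l)" "q' = (S', l')" by (cases q; cases q')
  from trans[unfolded q_eq] have "\<exists>\<theta>'. thread_step \<theta> (S, l) lab C (S', l') \<theta>'"
  proof (cases rule: cf_trans.cases)
    case (nu m r)
    then have "m \<notin> ran \<theta>"
      using assms(2) marked
      by (intro unused_if_allocatable[OF assms(3)] Res_binder_RESTR) (auto simp: q_eq)
    then show ?thesis using nu thread_step.nu[of m \<theta> r S' l] by auto
  next
    case (tau bs)
    then show ?thesis using thread_step.tau[of S' bs \<theta> l] by auto
  next
    case (snd x y bs a b)
    then show ?thesis using thread_step.snd[of x y S' bs \<theta> a b l] test by auto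
  next
    case (rec x y bs a b)
    then show ?thesis using thread_step.rec[of x y S' bs \<theta> a b l] test by auto
  next
    case (call1 K fs B xs a x)
    then show ?thesis
      using thread_step.call1[of K xs \<theta> x a l] test[of x a] eqs_ident eqs_formals by auto
  next
    case (call2 a K x)
    then have "\<theta> x = Some a" using marked[of "Unmap x a" "EqP x a"] by (simp split: if_splits)
    then show ?thesis using call2 thread_step.call2[of \<theta> x a K l'] by auto
  next
    case (call3 K fs)
    then show ?thesis using thread_step.call3[of K \<theta>] eqs_ident eqs_body by auto
  qed
  then show ?thesis by (simp only: q_eq)
qed

lemma thread_step_send_subst: "thread_step \<theta> q (LSend a b) C q' \<theta>' \<Longrightarrow> \<theta>' = \<theta>"
  by (auto elim: thread_step.cases)

lemma enabled_mark_configE: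
  assumes cons: "consistent s \<theta>" and enabled: "enabled (net M) (mark_config s \<theta>) t"
  obtains (Local) i C q' \<theta>' where "i < n_threads F" "thread_step \<theta> (s i) LTau C q' \<theta>'"
      "t = Local i (s i, LTau, C, q')"
    | (Sync) i j a b C q\<^sub>1 D q\<^sub>2 \<theta>' where "i < n_threads F" "j < n_threads F" "i \<noteq> j"
      "thread_step \<theta> (s i) (LSend a b) C q\<^sub>1 \<theta>" "thread_step \<theta> (s j) (LRec a b) D q\<^sub>2 \<theta>'"
      "t = Sync i (s i, LSend a b, C, q\<^sub>1) j (s j, LRec a b, D, q\<^sub>2)"
proof -
  have t_trans: "t \<in> par_trans F NEW" "ntrans_label t = LTau"
    and pre: "\<And>i q. (i, q) \<in> ctl_pre t \<Longrightarrow> q = s i"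
    and marked: "\<And>c p. c \<in> ntrans_commands t \<Longrightarrow> p \<in> cmd_pre F NEW c \<Longrightarrow> mark_subst \<theta> p > 0"
    using enabled by (auto simp: enabled_net net_trans_def sub_pre_def split: if_splits)
  have thread_step: "\<exists>\<theta>'. thread_step \<theta> (s i) lab C q' \<theta>'"
    if "(s i, lab, C, q') \<in> cf_trans F NEW" "i < n_threads F" "C \<subseteq> ntrans_commands t" for i lab C q'
    using that marked consistent_at_place[OF cons that(2)]
    by (intro cf_trans_thread_step) (auto dest: at_place_thread_place at_place_valid_subst)
  from t_trans(1) show thesis
  proof (cases rule: par_transE)
    case trans: (Local i q lab C q')
    then have q_place: "q = s i" "lab = LTau" using pre t_trans(2) by simp_all
    then obtain \<theta>' where "thread_step \<theta> (s i) LTau C q' \<theta>'"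
      using thread_step[of i LTau C q'] trans by auto
    with trans(2) show ?thesis by (rule Local) (simp add: trans(1) q_place)
  next
    case trans: (Sync i j q\<^sub>1 a b C q\<^sub>1' q\<^sub>2 D q\<^sub>2')
    then have q_place: "q\<^sub>1 = s i" "q\<^sub>2 = s j" using pre by simp_all
    then obtain \<theta>\<^sub>1 \<theta>' where "thread_step \<theta> (s i) (LSend a b) C q\<^sub>1' \<theta>\<^sub>1"
      and receive: "thread_step \<theta> (s j) (LRec a b) D q\<^sub>2' \<theta>'"
      using thread_step[of i "LSend a b" C q\<^sub>1'] thread_step[of j "LRec a b" D q\<^sub>2'] trans by auto
    then have send: "thread_step \<theta> (s i) (LSend a b) C q\<^sub>1' \<theta>"
      using thread_step_send_subst by blast
    from trans(1-3) send receive show ?thesis by (rule Sync) (simp add: trans(4) q_place)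
  qed
qed

lemma config_step_net_steps:
  assumes "config_step s \<theta> s' \<theta>'" "consistent s \<theta>"
  shows "(mark_config s \<theta>, mark_config s' \<theta>') \<in> net_steps (net M)"
proof -
  have "\<exists>t. enabled (net M) (mark_config s \<theta>) t \<and>
      fire (net M) (mark_config s \<theta>) t = mark_config s' \<theta>'"
    using assms by (induction rule: config_step.induct)
      (blast intro: enabled_local fire_local enabled_sync fire_sync)+
  then show ?thesis unfolding net_steps_def by force
qed

lemma net_steps_config_step:
  assumes "(mark_config s \<theta>, M') \<in> net_steps (net M)" "consistent s \<theta>"
  obtains s' \<theta>' where "M' = mark_config s' \<theta>'" "config_step s \<theta> s' \<theta>'"
proof -
  from assms(1) obtain t where t_enabled: "enabled (net M) (mark_config s \<theta>) t"
    "M' = fire (net M) (mark_config s \<theta>) t" unfolding net_steps_def by blast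
  from assms(2) t_enabled(1) show thesis
  proof (cases rule: enabled_mark_configE)
    case (Local i C q' \<theta>')
    then have "M' = mark_config (s(i := q')) \<theta>'" using t_enabled(2) fire_local[OF assms(2)] by simp
    then show ?thesis by (rule that) (rule config_step.local_step, fact+)
  next
    case (Sync i j a b C q\<^sub>1 D q\<^sub>2 \<theta>')
    then have "M' = mark_config (s(i := q\<^sub>1, j := q\<^sub>2)) \<theta>'"
      using t_enabled(2) fire_sync[OF assms(2)] by simp
    then show ?thesis by (rule that) (rule config_step.sync_step, fact+)
  qed
qed

lemma thread_step_housekeeping:
  assumes "consistent s \<theta>" "i < n_threads F" "thread_step \<theta> (s i) LTau C q' \<theta>'"
    and "\<not> settled_place F NEW (s i)"
  shows "(mark_config s \<theta>, mark_config (s(i := q')) \<theta>') \<in> housekeeping F NEW M"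
proof -
  have "\<forall>j q. (Ctl j q, Local i (s i, LTau, C, q')) \<in> flow_pt (net M) \<longrightarrow> \<not> settled_place F NEW q"
    using assms(4) by (auto simp: flow_net)
  then show ?thesis
    unfolding housekeeping_def Let_def fire_local[OF assms(1-3), of M, symmetric]
    using enabled_local[OF assms(1-3), of M] by blast
qed

lemma housekeeping_thread_step:
  assumes cons: "consistent s \<theta>" and step: "(mark_config s \<theta>, M') \<in> housekeeping F NEW M"
  obtains i C q' \<theta>' where "i < n_threads F" "thread_step \<theta> (s i) LTau C q' \<theta>'"
    "\<not> settled_place F NEW (s i)" "M' = mark_config (s(i := q')) \<theta>'"
proof -
  from step obtain t where t_enabled: "enabled (net M) (mark_config s \<theta>) t"
    "M' = fire (net M) (mark_config s \<theta>) t"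
    and unsettled: "\<And>i q. (Ctl i q, t) \<in> flow_pt (net M) \<Longrightarrow> \<not> settled_place F NEW q"
    unfolding housekeeping_def Let_def by blast
  have net_trans: "t \<in> net_trans F NEW" using t_enabled(1) by (simp add: enabled_net)
  from cons t_enabled(1) show thesis
  proof (cases rule: enabled_mark_configE)
    case (Local i C q' \<theta>')
    have "\<not> settled_place F NEW (s i)"
      using unsettled[of i "s i"] net_trans by (simp add: flow_net Local)
    moreover have "M' = mark_config (s(i := q')) \<theta>'"
      using Local fire_local[OF cons] t_enabled(2) by simp
    ultimately show ?thesis using that Local(1,2) by blast
  next
    case (Sync i j a b C q\<^sub>1 D q\<^sub>2 \<theta>')
    have "\<not> settled_place F NEW (s i)"
      using unsettled[of i "s i"] net_trans by (simp add: flow_net Sync)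
    moreover have "thread_place i (s i)"
      using consistent_at_place[OF cons Sync(1)] by (rule at_place_thread_place)
    ultimately show ?thesis using settled_Sum Sync(4) by (auto elim: thread_step.cases)
  qed
qed

lemma housekeeping_subset_net_steps: "housekeeping F NEW M \<subseteq> net_steps (net M)"
  unfolding housekeeping_def net_steps_def Let_def by blast

subsection \<open>The process of a configuration\<close>

definition map_apply :: "(name \<rightharpoonup> name) \<Rightarrow> name \<Rightarrow> name" where
  "map_apply \<theta> x = (case \<theta> x of None \<Rightarrow> x | Some a \<Rightarrow> a)"

lemma subst_map_map_apply: "subst_map \<theta> S = subst (map_apply \<theta>) S"
  by (simp add: subst_map_def map_apply_def[abs_def])

lemma map_apply_Some: "\<theta> x = Some a \<Longrightarrow> map_apply \<theta> x = a"
  by (simp add: map_apply_def)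

lemma map_apply_upd: "\<theta> x = None \<Longrightarrow> map_apply (\<theta>(x \<mapsto> a)) = (map_apply \<theta>)(x := a)"
  by (auto simp: map_apply_def)

lemma map_apply_dom: "x \<in> dom \<theta> \<Longrightarrow> \<theta> x = Some (map_apply \<theta> x)"
  by (auto simp: map_apply_def)

lemma map_apply_ran: "x \<in> dom \<theta> \<Longrightarrow> map_apply \<theta> x \<in> ran \<theta>"
  by (auto simp: map_apply_def ran_def)

lemma subst_map_cong: "(\<And>x. x \<in> fn S \<Longrightarrow> \<theta> x = \<theta>' x) \<Longrightarrow> subst_map \<theta> S = subst_map \<theta>' S"
  unfolding subst_map_map_apply by (rule subst_cong) (simp add: map_apply_def)

definition argument :: "ident \<Rightarrow> name list \<Rightarrow> nat \<Rightarrow> name" where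
  "argument K xs j = (if j < length xs then xs ! j else formals K ! j)"

text \<open>The body of \<open>K\<close> when the arguments \<open>xs\<close> are still to be passed, whereas those of the
  remaining formal parameters can already be found in \<open>\<theta>\<close>.\<close>

definition called_body :: "(name \<rightharpoonup> name) \<Rightarrow> ident \<Rightarrow> name list \<Rightarrow> proc" where
  "called_body \<theta> K xs = subst (map_apply \<theta> \<circ> map_apply (map_of (zip (formals K) xs))) (body K)"

text \<open>A call in progress stands for the body of its callee.  The exception are calls without
  parameters: while the caller's names are being unmapped, housekeeping may run into another
  settled place of the same call, and then the process there has not yet reacted.\<close>

definition pending :: "ident \<Rightarrow> name list \<Rightarrow> name list \<Rightarrow> bool" where
  "pending K xs l \<longleftrightarrow> (\<exists>l\<^sub>1 l\<^sub>2. l = l\<^sub>1 @ l\<^sub>2 \<and> settled_place F NEW (Call K xs, l\<^sub>2))"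

fun place_proc :: "(name \<rightharpoonup> name) \<Rightarrow> aug \<Rightarrow> proc" where
  "place_proc \<theta> (Call K xs, l) =
     (if pending K xs l then subst_map \<theta> (Call K xs) else called_body \<theta> K xs)"
| "place_proc \<theta> (S, l) = subst_map \<theta> S"

definition config_proc :: "(nat \<Rightarrow> aug) \<Rightarrow> (name \<rightharpoonup> name) \<Rightarrow> proc" where
  "config_proc s \<theta> = nu NEW (par_family (n_threads F) (\<lambda>i. place_proc \<theta> (s i)))"

lemma config_proc_cong: "(\<And>i. i < n_threads F \<Longrightarrow> s i = s' i) \<Longrightarrow> config_proc s \<theta> = config_proc s' \<theta>"
  unfolding config_proc_def by (intro arg_cong[where f = "nu NEW"] par_family_eq) simp

lemma formal_argument:
  assumes "K \<in> idents" "f \<in> fn (body K)"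
  shows "\<exists>j < length (formals K). \<forall>xs. map_apply (map_of (zip (formals K) xs)) f = argument K xs j"
proof -
  from assms obtain j where j_formal: "j < length (formals K)" "f = formals K ! j"
    using fn_body by (auto simp: in_set_conv_nth)
  have "map_apply (map_of (zip (formals K) xs)) f = argument K xs j" for xs
    using map_of_zip_nth[OF distinct_formals[OF assms(1)] j_formal(1), of xs] j_formal(2)
    by (simp add: map_apply_def argument_def)
  with j_formal(1) show ?thesis by blast
qed

lemma argument_active:
  assumes "j < length (formals K)" shows "argument K xs j \<in> active_names (Call K xs, l)"
proof (cases "j < length xs")
  case False
  then have "formals K ! j \<in> set (drop (length xs) (formals K))"
    using assms nth_mem[of "j - length xs" "drop (length xs) (formals K)"] by simp
  then show ?thesis using False by (simp add: argument_def)
qed (simp add: argument_def)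

lemma called_body_cong:
  assumes "K \<in> idents"
    and "\<And>j. j < length (formals K) \<Longrightarrow>
      map_apply \<theta> (argument K xs j) = map_apply \<theta>' (argument K ys j)"
  shows "called_body \<theta> K xs = called_body \<theta>' K ys"
  unfolding called_body_def
proof (rule subst_cong)
  fix f assume "f \<in> fn (body K)"
  from formal_argument[OF assms(1) this] obtain j where "j < length (formals K)"
    "\<forall>xs. map_apply (map_of (zip (formals K) xs)) f = argument K xs j" by blast
  then show "(map_apply \<theta> \<circ> map_apply (map_of (zip (formals K) xs))) f =
      (map_apply \<theta>' \<circ> map_apply (map_of (zip (formals K) ys))) f"
    using assms(2) by simp
qed

lemma called_body_full:
  assumes "K \<in> idents" "length xs = length (formals K)"
  shows "called_body \<theta> K xs =
    subst_map (map_of (zip (formals K) (map (map_apply \<theta>) xs))) (body K)"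
  unfolding called_body_def subst_map_map_apply
proof (rule subst_cong)
  fix f assume "f \<in> fn (body K)"
  from formal_argument[OF assms(1) this] obtain j where "j < length (formals K)"
    "\<forall>xs. map_apply (map_of (zip (formals K) xs)) f = argument K xs j" by blast
  then show "(map_apply \<theta> \<circ> map_apply (map_of (zip (formals K) xs))) f =
      map_apply (map_of (zip (formals K) (map (map_apply \<theta>) xs))) f"
    using assms(2) by (simp add: argument_def)
qed

lemma called_body_Nil: "called_body \<theta> K [] = subst_map \<theta> (body K)"
proof -
  have "map_apply \<theta> \<circ> map_apply (map_of (zip (formals K) [])) = map_apply \<theta>"
    by (auto simp: map_apply_def)
  then show ?thesis by (simp add: called_body_def subst_map_map_apply)
qed

lemma fn_called_body:
  assumes "K \<in> idents" "active_names (Call K xs, l) \<subseteq> dom \<theta>"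
  shows "fn (called_body \<theta> K xs) \<subseteq> ran \<theta>"
proof
  fix y assume "y \<in> fn (called_body \<theta> K xs)"
  then obtain f where f_body: "f \<in> fn (body K)"
    "y = map_apply \<theta> (map_apply (map_of (zip (formals K) xs)) f)" by (auto simp: called_body_def)
  from formal_argument[OF assms(1) f_body(1)] obtain j where j_formal: "j < length (formals K)"
    "y = map_apply \<theta> (argument K xs j)" unfolding f_body(2) by metis
  show "y \<in> ran \<theta>"
    using argument_active[OF j_formal(1)] assms(2) unfolding j_formal(2)
    by (intro map_apply_ran) blast
qed

lemma called_body_call1:
  assumes place: "at_place i (Call K (xs @ [x]), l) \<theta>" and len: "length xs < length (formals K)"
    and "\<theta> x = Some a"
  shows "called_body (\<theta>(formals K ! length xs \<mapsto> a)) K xs = called_body \<theta> K (xs @ [x])"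
proof -
  let ?f = "formals K ! length xs"
  note Call_place = at_place_thread_place[OF place]
  note K_ident = thread_place_callee[OF Call_place]
  show ?thesis
  proof (rule called_body_cong[OF K_ident])
    fix j assume j_less: "j < length (formals K)"
    consider "j < length xs" | "j = length xs" | "j > length xs" by linarith
    then show "map_apply (\<theta>(?f \<mapsto> a)) (argument K xs j) = map_apply \<theta> (argument K (xs @ [x]) j)"
    proof cases
      assume "j < length xs"
      moreover from this have "xs ! j \<in> active_names (Call K (xs @ [x]), l)" by simp
      then have "xs ! j \<noteq> ?f" using formal_inactive[OF Call_place len] by metis
      ultimately show ?thesis by (simp add: map_apply_def nth_append argument_def)
    next
      assume "j = length xs"
      then show ?thesis using assms(3) by (simp add: map_apply_def argument_def)
    next
      assume "j > length xs"
      moreover from this have "formals K ! j \<noteq> ?f"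
        using distinct_formals[OF K_ident] j_less len by (simp add: nth_eq_iff_index_eq)
      ultimately show ?thesis by (simp add: map_apply_def nth_append argument_def)
    qed
  qed
qed

lemma called_body_call2:
  assumes "thread_place i (Call K [], x # l)"
  shows "called_body (\<theta>(x := None)) K [] = called_body \<theta> K []"
proof -
  have "formals K ! j \<noteq> x" if "j < length (formals K)" for j
    using unmapped_not_formal[OF assms] that by auto
  then show ?thesis
    by (intro called_body_cong thread_place_callee[OF assms])
      (auto simp: map_apply_def argument_def)
qed

lemma place_proc_not_call: "\<not> is_call S \<Longrightarrow> place_proc \<theta> (S, l) = subst_map \<theta> S"
  by (cases S) auto

lemma place_proc_cong:
  assumes "thread_place i q" and agree: "\<And>x. x \<in> active_names q \<Longrightarrow> \<theta> x = \<theta>' x"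
  shows "place_proc \<theta> q = place_proc \<theta>' q"
proof -
  from assms(1) obtain K where "place_within K q" by (auto simp: thread_place_def)
  then show ?thesis
  proof (cases rule: place_cases)
    case (Call L xs l)
    have "called_body \<theta> L xs = called_body \<theta>' L xs"
      using argument_active agree Call(1)
      by (intro called_body_cong calling_callee[OF Call(2)]) (simp add: map_apply_def)
    moreover have "subst_map \<theta> (Call L xs) = subst_map \<theta>' (Call L xs)"
      using agree by (intro subst_map_cong) (simp add: Call(1))
    ultimately show ?thesis by (simp add: Call(1))
  next
    case (residual S l)
    then show ?thesis
      using agree active_names_residual[OF residual(3)]
      by (auto simp: place_proc_not_call intro!: subst_map_cong)
  qed
qed

lemma residual_settled: "residual K (Call L xs) l \<Longrightarrow> settled_place F NEW (Call L xs, l)"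
proof -
  assume res: "residual K (Call L xs) l"
  then have "L \<in> idents" "length (formals L) = length xs"
    using calls_arity[of K L "length xs"] by (auto simp: residual_def)
  then have "stable_place F (Call L xs, l)" using ident_eqs[of L] by auto
  then show ?thesis using res by (simp add: settled_place_def residual_def)
qed

lemma settled_pending: "settled_place F NEW (Call K xs, l) \<Longrightarrow> pending K xs l"
  unfolding pending_def by (metis append_Nil)

lemma settled_length: "settled_place F NEW (Call K xs, l) \<Longrightarrow> length xs = length (formals K)"
  using eqs_formals by (auto simp: settled_place_def)

lemma pending_length: "pending K xs l \<Longrightarrow> length xs = length (formals K)"
  using settled_length unfolding pending_def by blast

lemma pending_Cons: "pending K xs (x # l) \<longleftrightarrow> settled_place F NEW (Call K xs, x # l) \<or> pending K xs l"
  unfolding pending_def by (metis append_Cons append_Nil append_eq_Cons_conv)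

lemma place_proc_residual: "residual K S l \<Longrightarrow> place_proc \<theta> (S, l) = subst_map \<theta> S"
  using residual_settled settled_pending by (cases S) auto

lemma place_proc_settled: "settled_place F NEW (S, l) \<Longrightarrow> place_proc \<theta> (S, l) = subst_map \<theta> S"
  using settled_pending by (cases S) auto

lemma fn_subst_map: "fn S \<subseteq> dom \<theta> \<Longrightarrow> fn (subst_map \<theta> S) \<subseteq> ran \<theta>"
  unfolding subst_map_map_apply by (auto intro!: map_apply_ran)

lemma fn_place_proc:
  assumes "thread_place i q" "active_names q \<subseteq> dom \<theta>"
  shows "fn (place_proc \<theta> q) \<subseteq> ran \<theta>"
proof -
  from assms(1) obtain K where "place_within K q" by (auto simp: thread_place_def)
  then show ?thesis
  proof (cases rule: place_cases)
    case (Call L xs l)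
    have "fn (called_body \<theta> L xs) \<subseteq> ran \<theta>"
      using calling_callee[OF Call(2)] assms(2)[unfolded Call(1)] by (rule fn_called_body)
    moreover have "fn (subst_map \<theta> (Call L xs)) \<subseteq> ran \<theta>"
      using assms(2) by (intro fn_subst_map) (simp add: Call(1))
    ultimately show ?thesis by (simp add: Call(1))
  next
    case (residual S l)
    then show ?thesis
      using assms(2) active_names_residual[OF residual(3)] fn_subst_map
      by (simp add: place_proc_not_call)
  qed
qed

subsection \<open>Steps of the net as reactions\<close>

lemma place_proc_thread_step_other:
  assumes cons: "consistent s \<theta>" and i_less: "i < n_threads F"
    and step: "thread_step \<theta> (s i) lab C q' \<theta>'" and other_thread: "j < n_threads F" "j \<noteq> i"
  shows "place_proc \<theta>' (s j) = place_proc \<theta> (s j)"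
proof (rule place_proc_cong)
  note place = consistent_at_place[OF cons]
  show "thread_place j (s j)" using place[OF other_thread(1)] by (rule at_place_thread_place)
  then show "\<theta>' x = \<theta> x" if "x \<in> active_names (s j)" for x
    using that active_names_thread thread_names_disjoint[OF other_thread(1) i_less other_thread(2)]
      thread_step_other_names[OF step place[OF i_less]] by blast
qed

lemma place_procs_thread_step:
  assumes "consistent s \<theta>" "i < n_threads F" "thread_step \<theta> (s i) lab C q' \<theta>'" "k < n_threads F"
  shows "place_proc \<theta>' ((s(i := q')) k) = ((\<lambda>k. place_proc \<theta> (s k))(i := place_proc \<theta>' q')) k"
  using place_proc_thread_step_other[OF assms] by simp

lemma config_proc_thread_step:
  assumes "consistent s \<theta>" "i < n_threads F" "thread_step \<theta> (s i) lab C q' \<theta>'"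
  shows "config_proc (s(i := q')) \<theta>' =
    nu NEW (par_family (n_threads F) ((\<lambda>k. place_proc \<theta> (s k))(i := place_proc \<theta>' q')))"
  unfolding config_proc_def using place_procs_thread_step[OF assms]
  by (intro arg_cong[where f = "nu NEW"] par_family_eq)

lemma config_proc_sync:
  assumes cons: "consistent s \<theta>" and threads: "i < n_threads F" "j < n_threads F" "i \<noteq> j"
    and send: "thread_step \<theta> (s i) (LSend a b) C q\<^sub>1 \<theta>"
    and receive: "thread_step \<theta> (s j) (LRec a b) D q\<^sub>2 \<theta>'"
  shows "config_proc (s(i := q\<^sub>1, j := q\<^sub>2)) \<theta>' = nu NEW (par_family (n_threads F)
    ((\<lambda>k. place_proc \<theta> (s k))(i := place_proc \<theta> q\<^sub>1, j := place_proc \<theta>' q\<^sub>2)))"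
proof -
  have "thread_step \<theta> ((s(i := q\<^sub>1)) j) (LRec a b) D q\<^sub>2 \<theta>'" using receive threads(3) by simp
  then have "config_proc (s(i := q\<^sub>1, j := q\<^sub>2)) \<theta>' = nu NEW (par_family (n_threads F)
      ((\<lambda>k. place_proc \<theta> ((s(i := q\<^sub>1)) k))(j := place_proc \<theta>' q\<^sub>2)))"
    using consistent_thread_step[OF cons threads(1) send] threads(2)
    by (intro config_proc_thread_step)
  also have "(\<lambda>k. place_proc \<theta> ((s(i := q\<^sub>1)) k)) = (\<lambda>k. place_proc \<theta> (s k))(i := place_proc \<theta> q\<^sub>1)"
    by auto
  finally show ?thesis .
qed

lemma place_proc_thread_step_Sum:
  assumes "at_place i (Sum bs, l) \<theta>" "thread_step \<theta> (Sum bs, l) lab C (S, l') \<theta>'"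
  shows "place_proc \<theta>' (S, l') = subst_map \<theta>' S"
  using residual_thread_step_Sum[OF assms] place_proc_residual by auto

lemma react_pending:
  assumes "pending K xs l" "K \<in> idents"
  shows "react (eqs F) (place_proc \<theta> (Call K xs, l)) (called_body \<theta> K xs)"
proof -
  note len = pending_length[OF assms(1)]
  have "react (eqs F) (Call K (map (map_apply \<theta>) xs))
      (subst_map (map_of (zip (formals K) (map (map_apply \<theta>) xs))) (body K))"
    using ident_eqs[OF assms(2)] len by (intro react.call) auto
  then show ?thesis
    using assms(1) called_body_full[OF assms(2) len] by (simp add: subst_map_map_apply)
qed

definition reacts_if_settled :: "aug \<Rightarrow> proc \<Rightarrow> proc \<Rightarrow> bool" where
  "reacts_if_settled q P Q \<longleftrightarrow> P \<cong> Q \<or> settled_place F NEW q \<and> react (eqs F) P Q"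

lemma place_proc_tau_step:
  assumes place: "at_place i (Sum bs, l) \<theta>" and branch: "(Tau, S) \<in> set bs"
  shows "reacts_if_settled (Sum bs, l) (place_proc \<theta> (Sum bs, l))
    (place_proc \<theta> (S, l @ dropped bs S))"
proof -
  have "place_proc \<theta> (S, l @ dropped bs S) = subst (map_apply \<theta>) S"
    using place_proc_thread_step_Sum[OF place thread_step.tau[OF branch]]
    by (simp add: subst_map_map_apply)
  moreover have "react (eqs F) (place_proc \<theta> (Sum bs, l)) (subst (map_apply \<theta>) S)"
    using subst_branch_mem[OF branch, of "map_apply \<theta>"]
    by (simp add: subst_map_map_apply react.tau del: set_map)
  ultimately show ?thesis
    using settled_Sum[OF at_place_thread_place[OF place]] by (simp add: reacts_if_settled_def)
qed

lemma call_reacts_if_settled: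
  assumes "K \<in> idents" and "Q = called_body \<theta> K xs"
    and "pending K xs l \<Longrightarrow> settled_place F NEW (Call K xs, l)"
  shows "reacts_if_settled (Call K xs, l) (place_proc \<theta> (Call K xs, l)) Q"
  using react_pending[of K xs l \<theta>] assms unfolding reacts_if_settled_def
  by (cases "pending K xs l") simp_all

lemma place_proc_call1_step:
  assumes place: "at_place i (Call K (xs @ [x]), l) \<theta>" and "K \<in> idents"
    and len: "length xs < length (formals K)" and "\<theta> x = Some a"
  shows "reacts_if_settled (Call K (xs @ [x]), l) (place_proc \<theta> (Call K (xs @ [x]), l))
    (place_proc (\<theta>(formals K ! length xs \<mapsto> a)) (Call K xs, l'))"
proof (rule call_reacts_if_settled[OF \<open>K \<in> idents\<close>])
  have "\<not> pending K xs l'" using len pending_length by fastforce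
  then show "place_proc (\<theta>(formals K ! length xs \<mapsto> a)) (Call K xs, l') =
      called_body \<theta> K (xs @ [x])"
    using called_body_call1[OF place len \<open>\<theta> x = Some a\<close>] by simp
  assume "pending K (xs @ [x]) l"
  then have "length (xs @ [x]) = length (formals K)" by (rule pending_length)
  then show "settled_place F NEW (Call K (xs @ [x]), l)"
    using at_place_thread_place[OF place] ident_eqs[OF \<open>K \<in> idents\<close>]
    by (auto simp: thread_place_Call calling_def settled_place_def)
qed

lemma place_proc_call2_step:
  assumes place: "at_place i (Call K [], x # l) \<theta>"
  shows "reacts_if_settled (Call K [], x # l) (place_proc \<theta> (Call K [], x # l))
    (place_proc (\<theta>(x := None)) (Call K [], l))"
proof (cases "pending K [] l")
  case True
  then have "place_proc (\<theta>(x := None)) (Call K [], l) = place_proc \<theta> (Call K [], x # l)"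
    by (simp add: pending_Cons subst_map_map_apply)
  then show ?thesis by (simp add: reacts_if_settled_def)
next
  case False
  note Call_place = at_place_thread_place[OF place]
  show ?thesis
    using False called_body_call2[OF Call_place]
    by (intro call_reacts_if_settled thread_place_callee[OF Call_place])
      (simp_all add: pending_Cons)
qed

lemma place_proc_call3_step:
  assumes "K \<in> idents"
  shows "reacts_if_settled (Call K [], []) (place_proc \<theta> (Call K [], []))
    (place_proc \<theta> (body K, []))"
  using assms place_proc_residual[OF residual_body[OF assms]]
  by (intro call_reacts_if_settled) (simp_all add: called_body_Nil pending_def)

lemma place_proc_nu_step:
  assumes place: "at_place i (Res r S, l) \<theta>" and m_unused: "m \<in> NEW" "m \<notin> ran \<theta>"
  shows "place_proc \<theta> (Res r S, l) \<cong> Res m (place_proc (\<theta>(r \<mapsto> m)) (S, l))"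
proof -
  have "place_proc (\<theta>(r \<mapsto> m)) (S, l) = subst_map (\<theta>(r \<mapsto> m)) S"
    using residual_thread_step_Res[OF place thread_step.nu[OF m_unused]] place_proc_residual
    by blast
  then have proc_S: "place_proc (\<theta>(r \<mapsto> m)) (S, l) = subst ((map_apply \<theta>)(r := m)) S"
    by (simp add: subst_map_map_apply map_apply_upd Res_binder_unmapped[OF place])
  have "m \<notin> map_apply \<theta> ` (fn S - {r})"
    using at_place_active[OF place] map_apply_ran m_unused(2) by fastforce
  then have "subst (map_apply \<theta>) (Res r S) \<cong> Res m (subst ((map_apply \<theta>)(r := m)) S)"
    by (rule subst_Res_fresh)
  then show ?thesis unfolding proc_S by (simp only: place_proc.simps subst_map_map_apply)
qed

lemma config_proc_nu_step:
  assumes cons: "consistent s \<theta>" and i_less: "i < n_threads F" and place_i: "s i = (Res r S, l)"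
    and m_unused: "m \<in> NEW" "m \<notin> ran \<theta>"
  shows "config_proc s \<theta> \<cong> config_proc (s(i := (S, l))) (\<theta>(r \<mapsto> m))"
proof -
  let ?T = "\<lambda>k. place_proc \<theta> (s k)" and ?P = "place_proc (\<theta>(r \<mapsto> m)) (S, l)"
  note place = consistent_at_place[OF cons]
  have "thread_step \<theta> (s i) LTau {MapTo r m} (S, l) (\<theta>(r \<mapsto> m))"
    unfolding place_i using m_unused by (rule thread_step.nu)
  note after = config_proc_thread_step[OF cons i_less this]
  have "fn (?T j) \<subseteq> ran \<theta>" if "j < n_threads F" for j
    using fn_place_proc[OF at_place_thread_place[OF place[OF that]]] consistent_active[OF cons that]
    by blast
  then have unused: "m \<notin> fn (?T j)" if "j < n_threads F" for j using m_unused(2) that by blast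
  have "par_family (n_threads F) ?T \<cong> par_family (n_threads F) (?T(i := Res m ?P))"
    using place_proc_nu_step[OF place[OF i_less, unfolded place_i] m_unused] place_i
    by (intro par_family_cong) simp
  also have "\<dots> \<cong> Res m (par_family (n_threads F) (?T(i := ?P)))"
    using i_less unused by (intro par_family_extrude)
  finally have "config_proc s \<theta> \<cong> nu NEW (nu {m} (par_family (n_threads F) (?T(i := ?P))))"
    unfolding config_proc_def by (simp add: nu_cong nu_def[of "{m}"])
  also have "\<dots> \<cong> nu (NEW \<union> {m}) (par_family (n_threads F) (?T(i := ?P)))"
    by (rule scong.sym[OF nu_Un]) auto
  also have "NEW \<union> {m} = NEW" using m_unused(1) by auto
  finally show ?thesis unfolding after .
qed

lemma config_proc_local_step:
  assumes cons: "consistent s \<theta>" and i_less: "i < n_threads F"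
    and step: "thread_step \<theta> (s i) LTau C q' \<theta>'"
  shows "reacts_if_settled (s i) (config_proc s \<theta>) (config_proc (s(i := q')) \<theta>')"
proof -
  let ?T = "\<lambda>k. place_proc \<theta> (s k)" and ?n = "n_threads F"
  note place = consistent_at_place[OF cons i_less]
  have lift: ?thesis if "reacts_if_settled (s i) (place_proc \<theta> (s i)) (place_proc \<theta>' q')"
  proof -
    have "par_family ?n ?T \<cong> par_family ?n (?T(i := place_proc \<theta>' q'))"
      if "place_proc \<theta> (s i) \<cong> place_proc \<theta>' q'"
      using that by (intro par_family_cong) simp
    moreover have "react (eqs F) (par_family ?n ?T) (par_family ?n (?T(i := place_proc \<theta>' q')))"
      if "react (eqs F) (place_proc \<theta> (s i)) (place_proc \<theta>' q')"
      using i_less that by (rule react_family_fun_upd)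
    ultimately show ?thesis
      using that nu_cong react_nu unfolding reacts_if_settled_def
      by (metis config_proc_def config_proc_thread_step[OF cons i_less step])
  qed
  from step show ?thesis
  proof cases
    case (nu m r S l)
    then show ?thesis using config_proc_nu_step[OF cons i_less] by (simp add: reacts_if_settled_def)
  next
    case (tau S bs l)
    show ?thesis
      by (rule lift) (use place_proc_tau_step[OF place[unfolded tau(1)]] tau in simp)
  next
    case (call1 K xs x a l)
    show ?thesis
      by (rule lift) (use place_proc_call1_step[OF place[unfolded call1(1)]] call1 in simp)
  next
    case (call2 x a K l)
    show ?thesis
      by (rule lift) (use place_proc_call2_step[OF place[unfolded call2(1)]] call2 in simp)
  next
    case (call3 K)
    show ?thesis by (rule lift) (use place_proc_call3_step call3 in simp)
  qed
qed

lemma place_proc_receive: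
  assumes place: "at_place i (Sum bs, l) \<theta>" and branch: "(Recv x y, S) \<in> set bs"
    and "\<theta> x = Some a" "b \<in> PUB F \<union> NEW"
  shows "place_proc (\<theta>(y \<mapsto> b)) (S, l @ dropped bs S) = subst ((map_apply \<theta>)(y := b)) S"
  using place_proc_thread_step_Sum[OF place thread_step.rec[where \<theta> = \<theta>, OF assms(2-4)]]
    Recv_binder_unmapped[OF place branch]
  by (simp add: subst_map_map_apply map_apply_upd)

lemma place_proc_send:
  assumes "at_place i (Sum bs, l) \<theta>" "(Send x y, S) \<in> set bs" "\<theta> x = Some a" "\<theta> y = Some b"
  shows "place_proc \<theta> (S, l @ dropped bs S) = subst (map_apply \<theta>) S"
  using place_proc_thread_step_Sum[OF assms(1) thread_step.snd[where \<theta> = \<theta>, OF assms(2-4)]]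
  by (simp add: subst_map_map_apply)

lemma config_proc_sync_step:
  assumes cons: "consistent s \<theta>" and threads: "i < n_threads F" "j < n_threads F" "i \<noteq> j"
    and send: "thread_step \<theta> (s i) (LSend a b) C q\<^sub>1 \<theta>"
    and receive: "thread_step \<theta> (s j) (LRec a b) D q\<^sub>2 \<theta>'"
  shows "react (eqs F) (config_proc s \<theta>) (config_proc (s(i := q\<^sub>1, j := q\<^sub>2)) \<theta>')"
proof -
  let ?T = "\<lambda>k. place_proc \<theta> (s k)" and ?\<mu> = "map_apply \<theta>"
  note place = consistent_at_place[OF cons]
  from send obtain x y S bs l where snd: "s i = (Sum bs, l)" "q\<^sub>1 = (S, l @ dropped bs S)"
    "(Send x y, S) \<in> set bs" "\<theta> x = Some a" "\<theta> y = Some b" by cases auto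
  from receive obtain x' y' S' cs l' where rec: "s j = (Sum cs, l')" "q\<^sub>2 = (S', l' @ dropped cs S')"
    "(Recv x' y', S') \<in> set cs" "\<theta> x' = Some a" "\<theta>' = \<theta>(y' \<mapsto> b)" "b \<in> PUB F \<union> NEW" by cases auto
  let ?z = "bound_name ?\<mu> y' S'"
  have "(Recv a ?z, subst (?\<mu>(y' := ?z)) S') \<in> set (map (subst_branch ?\<mu>) cs)"
    using subst_branch_mem[OF rec(3), of ?\<mu>] rec(4) by (simp add: map_apply_Some del: set_map)
  moreover have "(Send a b, subst ?\<mu> S) \<in> set (map (subst_branch ?\<mu>) bs)"
    using subst_branch_mem[OF snd(3), of ?\<mu>] snd(4,5) by (simp add: map_apply_Some del: set_map)
  ultimately have comm: "react (eqs F) (Par (?T j) (?T i))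
      (Par (rename1 (subst (?\<mu>(y' := ?z)) S') b ?z) (subst ?\<mu> S))"
    unfolding snd(1) rec(1) place_proc.simps subst_map_map_apply subst_Sum by (rule react.comm)
  have received: "rename1 (subst (?\<mu>(y' := ?z)) S') b ?z \<cong> place_proc \<theta>' q\<^sub>2"
    unfolding rec(2,5) place_proc_receive[OF place[OF threads(2), unfolded rec(1)] rec(3,4,6)]
    by (rule rename1_subst_upd) (rule bound_name_fresh)
  have sent: "place_proc \<theta> q\<^sub>1 = subst ?\<mu> S"
    using place_proc_send[OF place[OF threads(1), unfolded snd(1)] snd(3-5)] snd(2) by simp
  have "react (eqs F) (Par (?T j) (?T i)) (Par (place_proc \<theta>' q\<^sub>2) (place_proc \<theta> q\<^sub>1))"
    unfolding sent by (rule react.struct[OF scong.refl comm scong.cong_par[OF received scong.refl]])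
  then show ?thesis
    unfolding config_proc_sync[OF assms] unfolding config_proc_def
    by (intro react_nu react_family_fun_upd2 threads)
qed

lemma config_proc_config_step:
  assumes "config_step s \<theta> s' \<theta>'" "consistent s \<theta>"
  shows "config_proc s \<theta> \<cong> config_proc s' \<theta>' \<or> react (eqs F) (config_proc s \<theta>) (config_proc s' \<theta>')"
  using assms
proof (induction rule: config_step.induct)
  case (local_step i C q' \<theta>')
  then show ?case using config_proc_local_step unfolding reacts_if_settled_def by blast
next
  case (sync_step i j a b C q\<^sub>1 D q\<^sub>2 \<theta>')
  then show ?case using config_proc_sync_step by blast
qed

subsection \<open>Progress of housekeeping\<close>

lemma call_progress:
  assumes place: "at_place i (Call K xs, l) \<theta>"
  obtains (enter) "xs = []" "l = []" "thread_step \<theta> (Call K xs, l) LTau {} (body K, []) \<theta>"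
    | (step) xs' l' C \<theta>' where "thread_step \<theta> (Call K xs, l) LTau C (Call K xs', l') \<theta>'"
      "2 * length xs' + length l' < 2 * length xs + length l"
      "called_body \<theta>' K xs' = called_body \<theta> K xs"
proof -
  note thread_place = at_place_thread_place[OF place]
  from thread_place obtain K0 where call: "calling K0 K xs l" by (auto simp: thread_place_Call)
  note callee = calling_callee[OF call]
  have mapped: "\<exists>a. \<theta> x = Some a" if "x \<in> set xs \<union> set l" for x
    using at_place_active[OF place, of x] that by auto
  show thesis
  proof (cases xs rule: rev_cases)
    case (snoc ys x)
    with mapped obtain a where x_mapped: "\<theta> x = Some a" by auto
    have len: "length ys < length (formals K)" using call by (simp add: snoc calling_def)
    show thesis
      using thread_step.call1[where \<theta> = \<theta>, OF callee len x_mapped]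
        called_body_call1[OF place[unfolded snoc] len x_mapped]
      by (intro step[of _ ys]) (auto simp: snoc)
  next
    case no_args: Nil
    show thesis
    proof (cases l)
      case (Cons x l')
      with mapped obtain a where x_mapped: "\<theta> x = Some a" by auto
      show thesis
        using thread_step.call2[where \<theta> = \<theta>, OF x_mapped] called_body_call2 thread_place
        by (intro step[of _ "[]" l' "\<theta>(x := None)"]) (auto simp: no_args Cons)
    next
      case Nil
      then show thesis using no_args thread_step.call3[OF callee] by (intro enter) simp_all
    qed
  qed
qed

fun res_depth :: "proc \<Rightarrow> nat" where
  "res_depth (Res r S) = Suc (res_depth S)"
| "res_depth _ = 0"

definition max_res_depth :: nat where
  "max_res_depth = (\<Sum>e\<leftarrow>eqs F. res_depth (snd (snd e)))"

fun housekeeping_left :: "aug \<Rightarrow> nat" where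
  "housekeeping_left (Call K xs, l) = (if settled_place F NEW (Call K xs, l) then 0
     else Suc max_res_depth + 2 * length xs + length l)"
| "housekeeping_left (S, l) = res_depth S"

lemma res_depth_body: "K \<in> idents \<Longrightarrow> res_depth (body K) \<le> max_res_depth"
proof -
  assume "K \<in> idents"
  then have "res_depth (body K) \<in> set (map (\<lambda>e. res_depth (snd (snd e))) (eqs F))"
    using ident_eqs by force
  then show ?thesis unfolding max_res_depth_def by (intro member_le_sum_list) simp_all
qed

lemma housekeeping_left_residual: "residual K S l \<Longrightarrow> housekeeping_left (S, l) \<le> res_depth S"
  using residual_settled by (cases S) auto

text \<open>A restricted name about to be allocated is not in use itself, so fewer than \<open>card NEW\<close>
  names are.\<close>

lemma ex_unused_new:
  assumes "valid_subst \<theta>" "r \<in> RESTR F" "\<theta> r = None"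
  shows "\<exists>m\<in>NEW. m \<notin> ran \<theta>"
proof (rule ccontr)
  let ?V = "RESTR F \<union> INP F \<union> FRM F"
  assume "\<not> ?thesis"
  then have "NEW \<subseteq> ran \<theta>" by blast
  moreover have "ran \<theta> = (\<lambda>x. the (\<theta> x)) ` dom \<theta>" by (force simp: ran_def)
  moreover have dom: "dom \<theta> \<subseteq> ?V - {r}" using assms by (auto simp: valid_subst_def)
  then have "finite (dom \<theta>)" by (rule finite_subset) simp
  ultimately have "card NEW \<le> card (dom \<theta>)" by (metis surj_card_le)
  also have "\<dots> \<le> card (?V - {r})" using dom by (intro card_mono) auto
  also have "\<dots> < card ?V" using assms(2) by (intro psubset_card_mono) auto
  also have "\<dots> \<le> card (RESTR F) + card (INP F) + card (FRM F)"
    by (meson add_le_mono1 card_Un_le le_trans)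
  finally show False using new_names by (simp add: new_names_def)
qed

lemma ex_nu_step:
  assumes place: "at_place i (Res r S, l) \<theta>"
  shows "\<exists>C \<theta>'. thread_step \<theta> (Res r S, l) LTau C (S, l) \<theta>' \<and>
    housekeeping_left (S, l) < housekeeping_left (Res r S, l)"
proof -
  obtain m where "m \<in> NEW" "m \<notin> ran \<theta>"
    using ex_unused_new at_place_valid_subst[OF place] Res_binder_unmapped[OF place]
      Res_binder_RESTR[OF at_place_thread_place[OF place]] by blast
  then have step: "thread_step \<theta> (Res r S, l) LTau {MapTo r m} (S, l) (\<theta>(r \<mapsto> m))"
    by (rule thread_step.nu)
  then have "housekeeping_left (S, l) \<le> res_depth S"
    using residual_thread_step_Res[OF place] housekeeping_left_residual by blast
  with step show ?thesis by auto
qed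

lemma ex_call_step:
  assumes place: "at_place i (Call K xs, l) \<theta>" and "\<not> settled_place F NEW (Call K xs, l)"
  shows "\<exists>C q' \<theta>'. thread_step \<theta> (Call K xs, l) LTau C q' \<theta>' \<and>
    housekeeping_left q' < housekeeping_left (Call K xs, l)"
  using place
proof (cases rule: call_progress)
  case enter
  have "K \<in> idents" using at_place_thread_place[OF place] by (rule thread_place_callee)
  then have "housekeeping_left (body K, []) \<le> max_res_depth"
    using housekeeping_left_residual[OF residual_body] res_depth_body le_trans by blast
  then show ?thesis using enter(3) assms(2) by (intro exI conjI) auto
next
  case (step xs' l' C \<theta>')
  then show ?thesis using assms(2) by (intro exI conjI) auto
qed

lemma ex_housekeeping_step:
  assumes place: "at_place i q \<theta>" and unsettled: "\<not> settled_place F NEW q"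
  shows "\<exists>C q' \<theta>'. thread_step \<theta> q LTau C q' \<theta>' \<and> housekeeping_left q' < housekeeping_left q"
proof -
  obtain S l where q_eq: "q = (S, l)" by force
  note thread_place = at_place_thread_place[OF place[unfolded q_eq]]
  show ?thesis
  proof (cases S)
    case (Call K xs)
    then show ?thesis using ex_call_step place unsettled by (auto simp: q_eq)
  next
    case (Sum bs)
    then show ?thesis using unsettled settled_Sum thread_place by (simp add: q_eq)
  next
    case (Res r S')
    then show ?thesis using ex_nu_step place unfolding q_eq by blast
  next
    case (Par P Q)
    then show ?thesis
      using thread_place by (simp add: thread_place_def residual_def wf_thread_def)
  qed
qed

lemma housekeeping_settles:
  "consistent s \<theta> \<Longrightarrow>
   \<exists>s' \<theta>'. (mark_config s \<theta>, mark_config s' \<theta>') \<in> (housekeeping F NEW M)\<^sup>* \<and> consistent s' \<theta>' \<and>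
     (\<forall>i < n_threads F. settled_place F NEW (s' i)) \<and> config_proc s \<theta> \<cong> config_proc s' \<theta>'"
proof (induction "\<Sum>i < n_threads F. housekeeping_left (s i)" arbitrary: s \<theta> rule: less_induct)
  case less
  note cons = less.prems
  show ?case
  proof (cases "\<forall>i < n_threads F. settled_place F NEW (s i)")
    case True
    then show ?thesis using cons scong.refl by blast
  next
    case False
    then obtain i where i_less: "i < n_threads F" and unsettled: "\<not> settled_place F NEW (s i)"
      by blast
    from ex_housekeeping_step[OF consistent_at_place[OF cons i_less] unsettled] obtain C q' \<theta>' where
      step: "thread_step \<theta> (s i) LTau C q' \<theta>'" and
      less_left: "housekeeping_left q' < housekeeping_left (s i)" by blast
    let ?s = "s(i := q')"
    have "(\<Sum>j < n_threads F. housekeeping_left (?s j)) <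
        (\<Sum>j < n_threads F. housekeeping_left (s j))"
      by (rule sum_strict_mono_ex1) (use less_left i_less in auto)
    from less.hyps[OF this consistent_thread_step[OF cons i_less step]] obtain s' \<theta>'' where
      IH: "(mark_config ?s \<theta>', mark_config s' \<theta>'') \<in> (housekeeping F NEW M)\<^sup>*" "consistent s' \<theta>''"
      "\<forall>i < n_threads F. settled_place F NEW (s' i)" "config_proc ?s \<theta>' \<cong> config_proc s' \<theta>''"
      by blast
    have "config_proc s \<theta> \<cong> config_proc ?s \<theta>'"
      using config_proc_local_step[OF cons i_less step] unsettled unfolding reacts_if_settled_def
      by blast
    then have "config_proc s \<theta> \<cong> config_proc s' \<theta>''" using IH(4) by (rule scong.trans)
    moreover have "(mark_config s \<theta>, mark_config s' \<theta>'') \<in> (housekeeping F NEW M)\<^sup>*"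
      using thread_step_housekeeping[OF cons i_less step unsettled] IH(1)
      by (rule converse_rtrancl_into_rtrancl)
    ultimately show ?thesis using IH(2,3) by blast
  qed
qed

subsection \<open>Reactions as steps of the net\<close>

definition net_reaches ::
  "(splace \<Rightarrow> nat) \<Rightarrow> (nat \<Rightarrow> aug) \<Rightarrow> (name \<rightharpoonup> name) \<Rightarrow> proc \<Rightarrow> bool" where
  "net_reaches M s \<theta> G \<longleftrightarrow> (\<exists>s' \<theta>'. (mark_config s \<theta>, mark_config s' \<theta>') \<in> (net_steps (net M))\<^sup>* \<and>
     consistent s' \<theta>' \<and> G \<cong> config_proc s' \<theta>')"

lemma net_reaches_config_step:
  assumes step: "config_step s \<theta> s' \<theta>'" and cons: "consistent s \<theta>" and "G \<cong> config_proc s' \<theta>'"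
  shows "net_reaches M s \<theta> G"
  using config_step_net_steps[OF step cons] consistent_config_step[OF step cons] assms(3)
  unfolding net_reaches_def by blast

lemma net_reaches_config_step_trans:
  assumes "config_step s \<theta> s' \<theta>'" "consistent s \<theta>" "net_reaches M s' \<theta>' G"
  shows "net_reaches M s \<theta> G"
  using config_step_net_steps[OF assms(1,2)] assms(3)
  unfolding net_reaches_def by (blast intro: converse_rtrancl_into_rtrancl)

lemma net_reaches_scong: "G \<cong> H \<Longrightarrow> net_reaches M s \<theta> H \<Longrightarrow> net_reaches M s \<theta> G"
  unfolding net_reaches_def using scong.trans by blast

lemma net_reaches_thread_step:
  assumes cons: "consistent s \<theta>" and i_less: "i < n_threads F"
    and step: "thread_step \<theta> (s i) LTau C q' \<theta>'"
  shows "net_reaches M s \<theta> (nu NEW (par_family (n_threads F)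
    ((\<lambda>k. place_proc \<theta> (s k))(i := place_proc \<theta>' q'))))"
proof (rule net_reaches_config_step[OF _ cons])
  show "config_step s \<theta> (s(i := q')) \<theta>'" using i_less step by (rule config_step.local_step)
qed (simp only: config_proc_thread_step[OF assms] scong.refl)

lemma net_reaches_call:
  "consistent s \<theta> \<Longrightarrow> i < n_threads F \<Longrightarrow> s i = (Call K xs, l) \<Longrightarrow>
   net_reaches M s \<theta> (nu NEW (par_family (n_threads F)
     ((\<lambda>k. place_proc \<theta> (s k))(i := called_body \<theta> K xs))))"
proof (induction "2 * length xs + length l" arbitrary: s \<theta> xs l rule: less_induct)
  case less
  note cons = less.prems(1) and i_less = less.prems(2) and place_i = less.prems(3)
  note place = consistent_at_place[OF cons i_less, unfolded place_i]
  from place show ?case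
  proof (cases rule: call_progress)
    case enter
    then have step: "thread_step \<theta> (s i) LTau {} (body K, []) \<theta>" by (simp add: place_i)
    have "K \<in> idents" using at_place_thread_place[OF place] by (rule thread_place_callee)
    then have "place_proc \<theta> (body K, []) = called_body \<theta> K xs"
      using place_proc_residual[OF residual_body] enter(1) by (simp add: called_body_Nil)
    then show ?thesis using net_reaches_thread_step[OF cons i_less step] by simp
  next
    case (step xs' l' C \<theta>')
    let ?s = "s(i := (Call K xs', l'))"
    from step(1) have call_step: "thread_step \<theta> (s i) LTau C (Call K xs', l') \<theta>'"
      by (simp add: place_i)
    have "net_reaches M ?s \<theta>' (nu NEW (par_family (n_threads F)
        ((\<lambda>k. place_proc \<theta>' (?s k))(i := called_body \<theta>' K xs'))))"
      using less.hyps[OF step(2) consistent_thread_step[OF cons i_less call_step] i_less] by simp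
    also have "par_family (n_threads F) ((\<lambda>k. place_proc \<theta>' (?s k))(i := called_body \<theta>' K xs')) =
        par_family (n_threads F) ((\<lambda>k. place_proc \<theta> (s k))(i := called_body \<theta> K xs))"
      using place_proc_thread_step_other[OF cons i_less call_step] step(3)
      by (intro par_family_eq) auto
    finally show ?thesis
      by (rule net_reaches_config_step_trans[OF
            config_step.local_step[where s = s and \<theta> = \<theta>, OF i_less call_step] cons])
  qed
qed

lemma subst_eq_SumD: "subst \<sigma> S = Sum cs \<Longrightarrow> \<exists>bs. S = Sum bs \<and> cs = map (subst_branch \<sigma>) bs"
  by (cases S) auto

lemma subst_eq_CallD: "subst \<sigma> S = Call K as \<Longrightarrow> \<exists>xs. S = Call K xs \<and> as = map \<sigma> xs"
  by (cases S) auto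

lemma subst_branch_eq_TauD: "(Tau, S) = subst_branch \<sigma> b \<Longrightarrow> \<exists>S'. b = (Tau, S') \<and> S = subst \<sigma> S'"
  and subst_branch_eq_SendD: "(Send a c, S) = subst_branch \<sigma> b \<Longrightarrow>
    \<exists>x y S'. b = (Send x y, S') \<and> a = \<sigma> x \<and> c = \<sigma> y \<and> S = subst \<sigma> S'"
  and subst_branch_eq_RecvD: "(Recv a z, S) = subst_branch \<sigma> b \<Longrightarrow>
    \<exists>x y S'. b = (Recv x y, S') \<and> a = \<sigma> x \<and> z = bound_name \<sigma> y S' \<and> S = subst (\<sigma>(y := z)) S'"
  by (cases b; cases "fst b"; auto)+

lemma settled_place_proc:
  "settled_place F NEW q \<Longrightarrow> place_proc \<theta> q = subst (map_apply \<theta>) (fst q)"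
  using place_proc_settled[of "fst q" "snd q"] by (simp add: subst_map_map_apply)

lemma settled_guarded:
  assumes "settled_place F NEW q" shows "is_call (place_proc \<theta> q) \<or> is_choice (place_proc \<theta> q)"
proof -
  have "stable_place F q" using assms by (simp add: settled_place_def)
  then show ?thesis
    unfolding settled_place_proc[OF assms] by (cases q; cases "fst q") auto
qed

lemma settled_place_proc_SumD:
  assumes "settled_place F NEW q" "place_proc \<theta> q = Sum bs"
  shows "\<exists>cs l. q = (Sum cs, l) \<and> bs = map (subst_branch (map_apply \<theta>)) cs"
  using subst_eq_SumD[of "map_apply \<theta>" "fst q" bs] settled_place_proc[OF assms(1)] assms(2)
  by (metis prod.collapse)

lemma settled_tau_step:
  assumes "settled_place F NEW q" "at_place i q \<theta>" "place_proc \<theta> q = Sum bs" "(Tau, S) \<in> set bs"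
  obtains q' where "thread_step \<theta> q LTau {} q' \<theta>" "place_proc \<theta> q' = S"
proof -
  obtain cs l where q_eq: "q = (Sum cs, l)" "bs = map (subst_branch (map_apply \<theta>)) cs"
    using settled_place_proc_SumD[OF assms(1,3)] by blast
  with assms(4) obtain S' where branch: "(Tau, S') \<in> set cs" "S = subst (map_apply \<theta>) S'"
    by (auto dest!: subst_branch_eq_TauD)
  have step: "thread_step \<theta> (Sum cs, l) LTau {} (S', l @ dropped cs S') \<theta>"
    using branch(1) by (rule thread_step.tau)
  then have "place_proc \<theta> (S', l @ dropped cs S') = S"
    using place_proc_thread_step_Sum assms(2) branch(2) by (simp add: q_eq(1) subst_map_map_apply)
  with step show thesis unfolding q_eq(1)[symmetric] by (rule that)
qed

lemma settled_send_step:
  assumes "settled_place F NEW q" and place: "at_place i q \<theta>" and "place_proc \<theta> q = Sum bs"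
    and "(Send a b, S) \<in> set bs"
  obtains C q' where "thread_step \<theta> q (LSend a b) C q' \<theta>" "place_proc \<theta> q' = S" "b \<in> PUB F \<union> NEW"
proof -
  let ?\<mu> = "map_apply \<theta>"
  obtain cs l where q_eq: "q = (Sum cs, l)" "bs = map (subst_branch ?\<mu>) cs"
    using settled_place_proc_SumD[OF assms(1,3)] by blast
  with assms(4) obtain x y S' where branch: "(Send x y, S') \<in> set cs" "a = ?\<mu> x" "b = ?\<mu> y"
    "S = subst ?\<mu> S'" by (auto dest!: subst_branch_eq_SendD)
  have "{x, y} \<subseteq> fn (Sum cs)" using fn_branch_subset[OF branch(1)] by simp
  then have mapped: "\<theta> x = Some a" "\<theta> y = Some b"
    using at_place_active[OF place] branch(2,3) map_apply_dom by (simp_all add: q_eq(1) del: fn_Sum)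
  have "thread_step \<theta> q (LSend a b) {Test x a, Test y b} (S', l @ dropped cs S') \<theta>"
    unfolding q_eq(1) using branch(1) mapped by (rule thread_step.snd)
  moreover have "place_proc \<theta> (S', l @ dropped cs S') = S"
    using place_proc_send[OF place[unfolded q_eq(1)] branch(1) mapped] branch(4) by simp
  moreover have "b \<in> PUB F \<union> NEW"
    using at_place_valid_subst[OF place] mapped(2) by (rule valid_subst_range)
  ultimately show thesis by (rule that)
qed

lemma settled_receive_step:
  assumes "settled_place F NEW q" and place: "at_place i q \<theta>" and "place_proc \<theta> q = Sum bs"
    and "(Recv a z, S) \<in> set bs" and b_range: "b \<in> PUB F \<union> NEW"
  obtains D q' \<theta>' where "thread_step \<theta> q (LRec a b) D q' \<theta>'" "rename1 S b z \<cong> place_proc \<theta>' q'"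
proof -
  let ?\<mu> = "map_apply \<theta>"
  obtain cs l where q_eq: "q = (Sum cs, l)" "bs = map (subst_branch ?\<mu>) cs"
    using settled_place_proc_SumD[OF assms(1,3)] by blast
  with assms(4) obtain x y S' where branch: "(Recv x y, S') \<in> set cs" "a = ?\<mu> x"
    "z = bound_name ?\<mu> y S'" "S = subst (?\<mu>(y := z)) S'" by (auto dest!: subst_branch_eq_RecvD)
  have "x \<in> fn (Sum cs)" using fn_branch_subset[OF branch(1)] by simp
  then have mapped: "\<theta> x = Some a"
    using at_place_active[OF place] branch(2) map_apply_dom by (simp add: q_eq(1) del: fn_Sum)
  have "thread_step \<theta> q (LRec a b) {Test x a, MapTo y b} (S', l @ dropped cs S') (\<theta>(y \<mapsto> b))"
    unfolding q_eq(1) using branch(1) mapped b_range by (rule thread_step.rec)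
  moreover have "rename1 S b z \<cong> place_proc (\<theta>(y \<mapsto> b)) (S', l @ dropped cs S')"
    unfolding branch(4) place_proc_receive[OF place[unfolded q_eq(1)] branch(1) mapped b_range]
    by (rule rename1_subst_upd) (simp only: branch(3) bound_name_fresh not_False_eq_True)
  ultimately show thesis by (rule that)
qed

lemma net_reaches_settled_call:
  assumes cons: "consistent s \<theta>" and settled: "settled_place F NEW (s i)"
    and i_less: "i < n_threads F" and "place_proc \<theta> (s i) = Call K as"
    and eqn: "(K, fs, S) \<in> set (eqs F)" "length as = length fs"
  shows "net_reaches M s \<theta> (nu NEW (par_family (n_threads F)
    ((\<lambda>k. place_proc \<theta> (s k))(i := subst_map (map_of (zip fs as)) S))))"
proof -
  obtain xs where call_xs: "fst (s i) = Call K xs" "as = map (map_apply \<theta>) xs"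
    using subst_eq_CallD settled_place_proc[OF settled] assms(4) by metis
  then have place_i: "s i = (Call K xs, snd (s i))" by (simp add: prod_eq_iff)
  have body: "called_body \<theta> K xs = subst_map (map_of (zip fs as)) S"
    using called_body_full[OF eqs_ident[OF eqn(1)], of xs \<theta>] eqn(2) call_xs(2)
      eqs_formals[OF eqn(1)] eqs_body[OF eqn(1)] by simp
  show ?thesis using net_reaches_call[OF cons i_less place_i] unfolding body .
qed

lemma net_reaches_settled_comm:
  assumes cons: "consistent s \<theta>" and settled: "\<And>i. i < n_threads F \<Longrightarrow> settled_place F NEW (s i)"
    and threads: "i < n_threads F" "j < n_threads F" "i \<noteq> j"
    and procs: "place_proc \<theta> (s i) = Sum cs" "place_proc \<theta> (s j) = Sum bs"
    and branches: "(Send a b, S\<^sub>2) \<in> set cs" "(Recv a z, S\<^sub>1) \<in> set bs"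
  shows "net_reaches M s \<theta> (nu NEW (par_family (n_threads F)
    ((\<lambda>k. place_proc \<theta> (s k))(i := S\<^sub>2, j := rename1 S\<^sub>1 b z))))"
proof -
  note place = consistent_at_place[OF cons]
  obtain C q\<^sub>1 where send: "thread_step \<theta> (s i) (LSend a b) C q\<^sub>1 \<theta>"
    and sent: "place_proc \<theta> q\<^sub>1 = S\<^sub>2" and "b \<in> PUB F \<union> NEW"
    using settled_send_step[OF settled[OF threads(1)] place[OF threads(1)] procs(1) branches(1)] .
  obtain D q\<^sub>2 \<theta>' where receive: "thread_step \<theta> (s j) (LRec a b) D q\<^sub>2 \<theta>'"
    and received: "rename1 S\<^sub>1 b z \<cong> place_proc \<theta>' q\<^sub>2"
    using settled_receive_step[OF settled[OF threads(2)] place[OF threads(2)] procs(2)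
        branches(2) \<open>b \<in> PUB F \<union> NEW\<close>] .
  have "nu NEW (par_family (n_threads F)
      ((\<lambda>k. place_proc \<theta> (s k))(i := S\<^sub>2, j := rename1 S\<^sub>1 b z))) \<cong>
      config_proc (s(i := q\<^sub>1, j := q\<^sub>2)) \<theta>'"
    unfolding config_proc_sync[OF cons threads send receive]
    using sent received by (intro nu_cong par_family_cong) simp
  then show ?thesis
    by (rule net_reaches_config_step[OF
          config_step.sync_step[where s = s and \<theta> = \<theta>, OF threads send receive] cons])
qed

theorem net_reaches_reaction:
  assumes cons: "consistent s \<theta>" and settled: "\<And>i. i < n_threads F \<Longrightarrow> settled_place F NEW (s i)"
    and react: "react (eqs F) G G'" and G_config: "G \<cong> config_proc s \<theta>"
  shows "net_reaches M s \<theta> G'"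
proof -
  let ?T = "\<lambda>k. place_proc \<theta> (s k)"
  obtain U where family: "family_react (eqs F) (n_threads F) ?T U"
    and G'_family: "G' \<cong> nu NEW (par_family (n_threads F) U)"
    using settled_guarded[OF settled]
    by (rule react_nu_family[OF closed_eqs react G_config[unfolded config_proc_def] finite_NEW])
  from family have "net_reaches M s \<theta> (nu NEW (par_family (n_threads F) U))"
  proof cases
    case (tau i bs S)
    then obtain q' where "thread_step \<theta> (s i) LTau {} q' \<theta>" "place_proc \<theta> q' = S"
      using settled_tau_step settled consistent_at_place[OF cons] by metis
    then show ?thesis using net_reaches_thread_step[OF cons] tau(1,2) by metis
  next
    case (call i K as fs S)
    then show ?thesis using net_reaches_settled_call[OF cons settled] by simp
  next
    case (comm i j cs bs x z S\<^sub>2 y S\<^sub>1)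
    then show ?thesis using net_reaches_settled_comm[OF cons settled] by simp
  qed
  with G'_family show ?thesis by (rule net_reaches_scong)
qed

end

subsection \<open>Substitution markings\<close>

lemma sum_le_1_nonzero:
  fixes f :: "'a \<Rightarrow> nat"
  assumes "finite A" "sum f A \<le> 1" "a \<in> A" "f a \<noteq> 0"
  shows "f a = 1 \<and> (\<forall>b\<in>A. b \<noteq> a \<longrightarrow> f b = 0)"
proof -
  have "sum f A = f a + sum f (A - {a})" using assms(1,3) by (rule sum.remove)
  with assms(2,4) have "f a = 1" "sum f (A - {a}) = 0" by linarith+
  then show ?thesis using assms(1) by (auto simp: sum_eq_0_iff)
qed

lemma sum_of_bool_le_1:
  assumes "\<And>x y. x \<in> A \<Longrightarrow> y \<in> A \<Longrightarrow> P x \<Longrightarrow> P y \<Longrightarrow> x = y"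
  shows "(\<Sum>x\<in>A. of_bool (P x) :: nat) \<le> 1"
proof (cases "finite A")
  case True
  have "card (A \<inter> {x. P x}) \<le> 1"
    using True assms by (auto simp: card_le_Suc0_iff_eq)
  then show ?thesis using True by (simp add: sum_of_bool_eq)
qed simp

lemma is_unionD:
  assumes "is_union \<sigma> n \<sigma>s"
  shows "\<sigma> x = Some a \<longleftrightarrow> (\<exists>i<n. \<sigma>s i x = Some a)"
proof -
  have "(x, a) \<in> Map.graph \<sigma> \<longleftrightarrow> (x, a) \<in> (\<Union>i<n. Map.graph (\<sigma>s i))"
    using assms by (simp add: is_union_def)
  then show ?thesis by (simp add: Map.graph_def Bex_def)
qed

lemma is_union_restrict_map:
  assumes "dom \<theta> \<subseteq> (\<Union>i<n. A i)" shows "is_union \<theta> n (\<lambda>i. \<theta> |` A i)"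
proof -
  have "\<theta> x = Some a \<longleftrightarrow> (\<exists>i<n. (\<theta> |` A i) x = Some a)" for x a
    using assms by (fastforce simp: restrict_map_def split: if_splits)
  then show ?thesis unfolding is_union_def by (auto simp: Map.graph_def)
qed

lemma scong_class_eq_iff: "scong_class P = scong_class Q \<longleftrightarrow> P \<cong> Q"
  unfolding scong_class_def by (auto intro: scong.sym scong.trans)

context fcp_spec
begin

lemma subst_marking_mark_subst:
  assumes "valid_subst \<theta>" shows "subst_marking F NEW (mark_subst \<theta>)"
  unfolding subst_marking_def
proof (intro conjI allI ballI impI)
  fix p assume "p \<notin> subst_places F NEW"
  then show "mark_subst \<theta> p = 0"
    using EqP_subst_place[OF assms] by (cases p) (auto simp: subst_places_def)
next
  fix m assume m_new: "m \<in> NEW"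
  have sum_le: "(\<Sum>r\<in>RESTR F. mark_subst \<theta> (EqP r m)) \<le> 1"
    unfolding mark_subst.simps using assms by (intro sum_of_bool_le_1) (auto simp: valid_subst_def)
  show "mark_subst \<theta> (NeqStar m) + (\<Sum>r\<in>RESTR F. mark_subst \<theta> (EqP r m)) = 1"
  proof (cases "\<exists>r\<in>RESTR F. \<theta> r = Some m")
    case True
    then obtain r where r_mapped: "r \<in> RESTR F" "\<theta> r = Some m" by blast
    have "mark_subst \<theta> (EqP r m) \<le> (\<Sum>r\<in>RESTR F. mark_subst \<theta> (EqP r m))"
      using r_mapped(1) by (intro member_le_sum) auto
    then show ?thesis using True r_mapped(2) sum_le by auto
  next
    case False
    then show ?thesis using m_new by auto
  qed
next
  fix x assume "x \<in> INP F \<union> FRM F \<union> RESTR F"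
  show "(\<Sum>a\<in>PUB F \<union> NEW. mark_subst \<theta> (EqP x a)) \<le> 1"
    unfolding mark_subst.simps by (intro sum_of_bool_le_1) auto
next
  fix x m assume "x \<in> INP F \<union> FRM F" "m \<in> NEW"
  then show "mark_subst \<theta> (EqP x m) + mark_subst \<theta> (NeqP x m) = 1" by simp
qed

lemma corresponds_mark_subst:
  assumes "valid_subst \<theta>" shows "corresponds F NEW NEW \<theta> (mark_subst \<theta>)"
proof -
  have "inj_on \<theta> (dom \<theta> \<inter> RESTR F)" "\<forall>r\<in>dom \<theta> \<inter> RESTR F. the (\<theta> r) \<in> NEW"
    "dom \<theta> \<subseteq> INP F \<union> FRM F \<union> RESTR F" "ran \<theta> \<subseteq> PUB F \<union> NEW"
    using assms unfolding valid_subst_def by (auto intro!: inj_onI)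
  moreover have "r = r' \<longleftrightarrow> (\<forall>m\<in>NEW. mark_subst \<theta> (EqP x m) = mark_subst \<theta> (EqP y m))"
    if "\<theta> x = Some r" "r \<in> NEW" "\<theta> y = Some r'" "r' \<in> NEW" for x y r r'
    using that by auto
  ultimately show ?thesis
    unfolding corresponds_def using subst_marking_mark_subst[OF assms] PUB_NEW_disjoint by auto
qed

lemma init_normal_form:
  assumes "(K, \<sigma>) \<in> set (inits F)"
  shows "K \<in> idents \<and> (is_choice (body K) \<or> is_call (body K)) \<and> dom \<sigma> = set (formals K) \<and>
    ran \<sigma> \<subseteq> set (restr F) \<union> PUB F"
proof -
  have "\<forall>(K, \<sigma>) \<in> set (inits F). \<exists>fs S. (K, fs, S) \<in> set (eqs F) \<and>
        (is_choice S \<or> is_call S) \<and> dom \<sigma> = set fs \<and> ran \<sigma> \<subseteq> set (restr F) \<union> PUB F"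
    using normal_form by (simp add: normal_form_def)
  with assms obtain fs S where eqn: "(K, fs, S) \<in> set (eqs F)"
    and init: "is_choice S \<or> is_call S" "dom \<sigma> = set fs" "ran \<sigma> \<subseteq> set (restr F) \<union> PUB F" by fast
  then show ?thesis using eqs_ident[OF eqn] eqs_formals[OF eqn] eqs_body[OF eqn] by simp
qed

lemma finite_PUB [simp]: "finite (PUB F)"
proof -
  have "finite (ran \<sigma>)" if "(K, \<sigma>) \<in> set (inits F)" for K \<sigma>
    using init_normal_form[OF that] by (intro finite_ran) simp
  then show ?thesis unfolding PUB_def by auto
qed

definition subst_of :: "(splace \<Rightarrow> nat) \<Rightarrow> name \<rightharpoonup> name" where
  "subst_of M x =
     (if \<exists>a. M (EqP x a) \<noteq> 0 then Some (THE a. M (EqP x a) \<noteq> 0) else None)"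

lemma subst_marking_place: "subst_marking F NEW M \<Longrightarrow> M p \<noteq> 0 \<Longrightarrow> p \<in> subst_places F NEW"
  by (rule ccontr) (simp add: subst_marking_def)

lemma subst_marking_EqP:
  assumes marking: "subst_marking F NEW M" and marked: "M (EqP x a) \<noteq> 0"
  shows "x \<in> INP F \<union> FRM F \<union> RESTR F" "a \<in> PUB F \<union> NEW" "x \<in> RESTR F \<Longrightarrow> a \<in> NEW"
    "M (EqP x a) = 1" "M (EqP x b) \<noteq> 0 \<Longrightarrow> b = a"
proof -
  have place: "x \<in> INP F \<union> FRM F \<union> RESTR F \<and> a \<in> PUB F \<union> NEW \<and> (x \<in> RESTR F \<longrightarrow> a \<in> NEW)"
    if "M (EqP x a) \<noteq> 0" for a
  proof -
    have "EqP x a \<in> subst_places F NEW" using marking that by (rule subst_marking_place)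
    then show ?thesis using binder_classes_disjoint(1,2) by (auto simp: subst_places_def)
  qed
  from place[OF marked] show x_binder: "x \<in> INP F \<union> FRM F \<union> RESTR F" and a_range: "a \<in> PUB F \<union> NEW"
    and "x \<in> RESTR F \<Longrightarrow> a \<in> NEW" by blast+
  have "(\<Sum>a\<in>PUB F \<union> NEW. M (EqP x a)) \<le> 1"
    using marking x_binder unfolding subst_marking_def by (elim conjE) (rule bspec)
  then have unique: "M (EqP x a) = 1 \<and> (\<forall>b\<in>PUB F \<union> NEW. b \<noteq> a \<longrightarrow> M (EqP x b) = 0)"
    using a_range marked by (intro sum_le_1_nonzero[where f = "\<lambda>a. M (EqP x a)"]) simp_all
  then show "M (EqP x a) = 1" by (rule conjunct1)
  show "b = a" if "M (EqP x b) \<noteq> 0"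
  proof (rule ccontr)
    assume "b \<noteq> a"
    then have "M (EqP x b) = 0" using unique place[OF that] by simp
    with that show False ..
  qed
qed

lemma subst_of_eq_Some_iff:
  assumes "subst_marking F NEW M"
  shows "subst_of M x = Some a \<longleftrightarrow> M (EqP x a) \<noteq> 0"
proof -
  have "(THE a. M (EqP x a) \<noteq> 0) = a" if "M (EqP x a) \<noteq> 0" for a
    using that subst_marking_EqP(5)[OF assms that] by (rule the_equality)
  then show ?thesis by (auto simp: subst_of_def)
qed

lemma mark_subst_subst_of:
  assumes marking: "subst_marking F NEW M" shows "mark_subst (subst_of M) = M"
proof
  note graph = subst_of_eq_Some_iff[OF marking]
  have missing: "M p = 0" if "p \<notin> subst_places F NEW" for p
    using marking that by (simp add: subst_marking_def)
  fix p show "mark_subst (subst_of M) p = M p"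
  proof (cases p)
    case (EqP x a)
    then show ?thesis using subst_marking_EqP(4)[OF marking, of x a] by (auto simp: graph)
  next
    case (NeqP x m)
    show ?thesis
    proof (cases "x \<in> INP F \<union> FRM F \<and> m \<in> NEW")
      case True
      then have "M (EqP x m) + M (NeqP x m) = 1" using marking by (simp add: subst_marking_def)
      then show ?thesis using True NeqP by (auto simp: graph)
    next
      case False
      then have "M p = 0" by (intro missing) (auto simp: NeqP subst_places_def)
      then show ?thesis using False NeqP by auto
    qed
  next
    case (NeqStar m)
    show ?thesis
    proof (cases "m \<in> NEW")
      case True
      then have "M (NeqStar m) + (\<Sum>r\<in>RESTR F. M (EqP r m)) = 1"
        using marking by (simp add: subst_marking_def)
      then have "M (NeqStar m) = of_bool ((\<Sum>r\<in>RESTR F. M (EqP r m)) = 0)"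
        by (cases "(\<Sum>r\<in>RESTR F. M (EqP r m)) = 0") (simp_all del: sum_eq_0_iff)
      then show ?thesis using True NeqStar by (simp add: graph sum_eq_0_iff)
    next
      case False
      then have "M p = 0" by (intro missing) (auto simp: NeqStar subst_places_def)
      then show ?thesis using False NeqStar by auto
    qed
  qed
qed

lemma valid_subst_subst_of:
  assumes marking: "subst_marking F NEW M" shows "valid_subst (subst_of M)"
proof -
  note graph = subst_of_eq_Some_iff[OF marking] and EqP = subst_marking_EqP[OF marking]
  have "dom (subst_of M) \<subseteq> RESTR F \<union> INP F \<union> FRM F" using EqP(1) by (auto simp: dom_def graph)
  moreover have "ran (subst_of M) \<subseteq> PUB F \<union> NEW" using EqP(2) by (auto simp: ran_def graph)
  moreover have "r = r'"
    if r_mapped: "r \<in> RESTR F" "subst_of M r = Some a"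
      and r'_mapped: "r' \<in> RESTR F" "subst_of M r' = Some a" for r r' a
  proof -
    have "a \<in> NEW" using EqP(3) r_mapped by (simp add: graph)
    then have "M (NeqStar a) + (\<Sum>r\<in>RESTR F. M (EqP r a)) = 1"
      using marking by (simp add: subst_marking_def)
    then have "(\<Sum>r\<in>RESTR F. M (EqP r a)) \<le> 1" by linarith
    then show ?thesis
      using sum_le_1_nonzero[of "RESTR F" "\<lambda>r. M (EqP r a)" r] r_mapped r'_mapped
      by (auto simp: graph)
  qed
  ultimately show ?thesis using EqP(3) unfolding valid_subst_def graph by blast
qed

lemma
  assumes corr: "corresponds F NEW R \<sigma> (mark_subst \<theta>)"
  shows corresponds_restricted: "\<sigma> x = Some r \<Longrightarrow> r \<in> R \<Longrightarrow> \<exists>m\<in>NEW. \<theta> x = Some m"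
    and corresponds_public: "\<sigma> x = Some p \<Longrightarrow> p \<notin> R \<Longrightarrow> \<theta> x = Some p \<and> p \<in> PUB F"
    and corresponds_eq_iff: "\<sigma> x = Some r \<Longrightarrow> r \<in> R \<Longrightarrow> \<sigma> y = Some r' \<Longrightarrow> r' \<in> R \<Longrightarrow>
      r = r' \<longleftrightarrow> \<theta> x = \<theta> y"
proof -
  have restricted: "\<exists>m\<in>NEW. \<theta> x = Some m" if "\<sigma> x = Some r" "r \<in> R" for x r
  proof -
    have "\<exists>m\<in>NEW. mark_subst \<theta> (EqP x m) = 1" using corr that unfolding corresponds_def by blast
    then show ?thesis by (simp only: mark_subst.simps of_bool_eq_1_iff)
  qed
  then show "\<sigma> x = Some r \<Longrightarrow> r \<in> R \<Longrightarrow> \<exists>m\<in>NEW. \<theta> x = Some m" .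
  show "\<theta> x = Some p \<and> p \<in> PUB F" if "\<sigma> x = Some p" "p \<notin> R"
  proof -
    have "ran \<sigma> \<subseteq> PUB F \<union> R" using corr by (simp add: corresponds_def)
    then have "p \<in> PUB F" using ranI[of \<sigma> x p] that by blast
    then have "mark_subst \<theta> (EqP x p) = 1" using corr that(1) unfolding corresponds_def by blast
    then show ?thesis
      using \<open>p \<in> PUB F\<close> by (simp only: mark_subst.simps of_bool_eq_1_iff simp_thms)
  qed
  show "r = r' \<longleftrightarrow> \<theta> x = \<theta> y" if "\<sigma> x = Some r" "r \<in> R" "\<sigma> y = Some r'" "r' \<in> R"
  proof -
    have "r = r' \<longleftrightarrow> (\<forall>m\<in>NEW. mark_subst \<theta> (EqP x m) = mark_subst \<theta> (EqP y m))"
      using corr that unfolding corresponds_def by blast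
    then have "r = r' \<longleftrightarrow> (\<forall>m\<in>NEW. \<theta> x = Some m \<longleftrightarrow> \<theta> y = Some m)"
      by (simp only: mark_subst.simps of_bool_eq_iff)
    then show ?thesis using restricted that by metis
  qed
qed

lemma corresponds_renaming:
  assumes corr: "corresponds F NEW R \<sigma> (mark_subst \<theta>)"
  obtains h where "\<And>x r. \<sigma> x = Some r \<Longrightarrow> r \<in> R \<Longrightarrow> \<theta> x = Some (h r) \<and> h r \<in> NEW"
    and "inj_on h (R \<inter> ran \<sigma>)"
proof -
  define h where "h r = the (\<theta> (SOME x. \<sigma> x = Some r))" for r
  have h_new: "\<theta> x = Some (h r) \<and> h r \<in> NEW" if "\<sigma> x = Some r" "r \<in> R" for x r
  proof -
    have "\<sigma> (SOME x. \<sigma> x = Some r) = Some r" using that(1) by (rule someI)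
    then have "\<theta> (SOME x. \<sigma> x = Some r) = \<theta> x" using corresponds_eq_iff[OF corr] that by metis
    then show ?thesis using corresponds_restricted[OF corr that] by (auto simp: h_def)
  qed
  moreover have "inj_on h (R \<inter> ran \<sigma>)"
  proof (rule inj_onI)
    fix r r' assume r_images: "r \<in> R \<inter> ran \<sigma>" "r' \<in> R \<inter> ran \<sigma>" "h r = h r'"
    then obtain x y where mapped: "\<sigma> x = Some r" "\<sigma> y = Some r'" by (auto simp: ran_def)
    have "\<theta> x = \<theta> y" using h_new[OF mapped(1)] h_new[OF mapped(2)] r_images by simp
    then show "r = r'" using corresponds_eq_iff[OF corr mapped(1) _ mapped(2)] r_images(1,2) by simp
  qed
  ultimately show thesis using that by blast
qed

lemma corresponds_dom:
  assumes corr: "corresponds F NEW R \<sigma> (mark_subst \<theta>)" shows "dom \<theta> = dom \<sigma>"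
proof
  show "dom \<sigma> \<subseteq> dom \<theta>"
    using corresponds_restricted[OF corr] corresponds_public[OF corr] by fast
  have "\<forall>x a. x \<notin> dom \<sigma> \<longrightarrow> mark_subst \<theta> (EqP x a) = 0" using corr by (simp add: corresponds_def)
  then have "\<forall>x a. x \<notin> dom \<sigma> \<longrightarrow> \<theta> x \<noteq> Some a" by (simp only: mark_subst.simps of_bool_eq_0_iff)
  then show "dom \<theta> \<subseteq> dom \<sigma>" by blast
qed

lemma subst_subst_map:
  assumes "\<And>x. x \<in> fn S \<Longrightarrow> g (map_apply \<sigma> x) = map_apply \<theta> x"
  shows "subst g (subst_map \<sigma> S) \<cong> subst_map \<theta> S"
proof -
  have "subst g (subst_map \<sigma> S) \<cong> subst (g \<circ> map_apply \<sigma>) S"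
    unfolding subst_map_map_apply by (rule subst_comp)
  also have "\<dots> = subst_map \<theta> S"
    unfolding subst_map_map_apply by (rule subst_cong) (simp add: assms)
  finally show ?thesis .
qed

lemma res_list_corresponds:
  assumes union: "is_union \<sigma> (n_threads F) \<sigma>s"
    and corr: "corresponds F NEW (set rs) \<sigma> (mark_subst \<theta>)"
    and dom: "\<And>i. i < n_threads F \<Longrightarrow> fn (Ss i) \<subseteq> dom (\<sigma>s i)"
  shows "res_list rs (par_family (n_threads F) (\<lambda>i. subst_map (\<sigma>s i) (Ss i))) \<cong>
    nu NEW (par_family (n_threads F) (\<lambda>i. subst_map \<theta> (Ss i)))" (is "res_list rs ?P \<cong> nu NEW ?Q")
proof -
  let ?n = "n_threads F" and ?A = "set rs"
  obtain h where restricted: "\<And>x r. \<sigma> x = Some r \<Longrightarrow> r \<in> ?A \<Longrightarrow> \<theta> x = Some (h r) \<and> h r \<in> NEW"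
    and inj: "inj_on h (?A \<inter> ran \<sigma>)" using corresponds_renaming[OF corr] by blast
  note public = corresponds_public[OF corr]
  let ?g = "override_on id h ?A"
  have mapped: "\<exists>a. \<sigma> x = Some a \<and> map_apply (\<sigma>s i) x = a" if "i < ?n" "x \<in> fn (Ss i)" for i x
    using dom[OF that(1)] that is_unionD[OF union, of x] by (force simp: map_apply_def)
  then have fn_P: "fn ?P \<subseteq> ran \<sigma>" by (fastforce simp: subst_map_map_apply ran_def)
  have "?g a = map_apply \<theta> x" if "\<sigma> x = Some a" for x a
    using restricted[OF that] public[OF that] by (cases "a \<in> ?A") (auto simp: map_apply_def)
  then have rename_thread: "subst ?g (subst_map (\<sigma>s i) (Ss i)) \<cong> subst_map \<theta> (Ss i)"
    if "i < ?n" for i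
    using mapped[OF that] by (intro subst_subst_map) metis
  have "res_list rs ?P \<cong> nu ?A ?P" by (rule res_list_nu)
  also have "\<dots> \<cong> nu NEW (subst ?g ?P)"
  proof (rule nu_rename)
    show "inj_on h (?A \<inter> fn ?P)" using inj by (rule inj_on_subset) (use fn_P in blast)
    show "h ` (?A \<inter> fn ?P) \<subseteq> NEW" using fn_P restricted by (auto simp: ran_def)
    have "fn ?P - ?A \<subseteq> PUB F" using fn_P public by (auto simp: ran_def)
    then show "NEW \<inter> (fn ?P - ?A) = {}" using PUB_NEW_disjoint by blast
  qed simp_all
  also have "subst ?g ?P = par_family ?n (\<lambda>i. subst ?g (subst_map (\<sigma>s i) (Ss i)))"
    by (simp add: subst_par_list comp_def)
  also have "nu NEW \<dots> \<cong> nu NEW ?Q" by (intro nu_cong par_family_cong rename_thread)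
  finally show ?thesis .
qed

lemma settled_active_names: "settled_place F NEW q \<Longrightarrow> active_names q = fn (fst q) \<union> set (snd q)"
  using settled_length by (cases q; cases "fst q") auto

lemma derived_residual:
  assumes "derived F NEW q" shows "\<exists>K. residual K (fst q) (snd q)"
proof -
  from assms obtain K fs B where eqn: "(K, fs, B) \<in> set (eqs F)"
    and path: "((B, []), q) \<in> {(u, v) \<in> cf_step F NEW. \<not> is_call (fst u)}\<^sup>*"
    unfolding derived_def by fast
  from path have "residual K (fst q) (snd q)"
  proof (induction rule: rtrancl_induct)
    case base
    then show ?case using residual_body eqs_ident[OF eqn] eqs_body[OF eqn] by auto
  next
    case (step u v)
    then have cf_step: "(u, v) \<in> cf_step F NEW" and no_call: "\<not> is_call (fst u)" by auto
    obtain S l S' l' where uv_eq: "u = (S, l)" "v = (S', l')" by (cases u; cases v)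
    from cf_step obtain lab C where "((S, l), lab, C, (S', l')) \<in> cf_trans F NEW"
      by (auto simp: cf_step_def uv_eq)
    then show ?case
      using step.IH cf_step no_call residual_branch residual_Res unfolding uv_eq
      by (cases rule: cf_trans.cases) auto
  qed
  then show ?thesis ..
qed

lemma derived_settled:
  assumes "derived F NEW (S, l)" "is_choice S \<or> is_call S"
  shows "settled_place F NEW (S, l)"
proof -
  obtain K where "residual K S l" using derived_residual[OF assms(1)] by auto
  then show ?thesis
    using assms residual_settled by (cases S) (auto simp: settled_place_def)
qed

end

subsection \<open>The bisimulation\<close>

locale fcp_translation = fcp_spec +
  fixes M\<^sub>s :: "splace \<Rightarrow> nat" and \<sigma> :: "name \<rightharpoonup> name"
  assumes init_union: "is_union \<sigma> (n_threads F) (init_subst F)"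
    and init_corresponds: "corresponds F NEW (set (restr F)) \<sigma> M\<^sub>s"
begin

abbreviation N :: "(nplace, ntrans) petri_net" where
  "N \<equiv> net M\<^sub>s"

definition init_place :: "nat \<Rightarrow> aug" where
  "init_place i = (init_body F i, [])"

lemma
  assumes "i < n_threads F"
  shows init_ident: "init_ident F i \<in> idents"
    and init_body: "init_body F i = body (init_ident F i)"
    and init_guarded: "is_choice (init_body F i) \<or> is_call (init_body F i)"
    and dom_init_subst: "dom (init_subst F i) = set (formals (init_ident F i))"
proof -
  show body: "init_body F i = body (init_ident F i)" by (simp add: init_body_def body_def)
  have "(init_ident F i, init_subst F i) \<in> set (inits F)" using assms by simp
  note init_normal_form[OF this]
  then show "init_ident F i \<in> idents" "is_choice (init_body F i) \<or> is_call (init_body F i)"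
    "dom (init_subst F i) = set (formals (init_ident F i))"
    unfolding body by simp_all
qed

lemma init_residual: "i < n_threads F \<Longrightarrow> residual (init_ident F i) (init_body F i) []"
  using residual_body init_ident init_body by simp

lemma init_settled: "i < n_threads F \<Longrightarrow> settled_place F NEW (init_place i)"
  using init_residual init_guarded derived_settled unfolding init_place_def residual_def by blast

lemma init_formals_thread: "i < n_threads F \<Longrightarrow> set (formals (init_ident F i)) \<subseteq> thread_names i"
  using init_ident by (auto simp: thread_names_def thread_idents_def ident_names_def)

lemma init_at_place:
  assumes i_less: "i < n_threads F" and valid: "valid_subst \<theta>"
    and dom: "dom \<theta> = (\<Union>i < n_threads F. set (formals (init_ident F i)))"
  shows "at_place i (init_place i) \<theta>"
proof -
  have "init_ident F i \<in> thread_idents F i" by (simp add: thread_idents_def)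
  then have "thread_place i (init_place i)"
    unfolding init_place_def using init_residual[OF i_less] by (rule residual_thread_place)
  moreover have "set (formals (init_ident F j)) \<inter> thread_names i = {}"
    if "j < n_threads F" "j \<noteq> i" for j
    using init_formals_thread[OF that(1)] thread_names_disjoint[OF that(1) i_less that(2)] by blast
  then have "dom \<theta> \<inter> thread_names i = set (formals (init_ident F i))"
    unfolding dom using i_less init_formals_thread[OF i_less] by blast
  then have "dom \<theta> \<inter> thread_names i = active_names (init_place i)"
    using active_names_residual[OF init_residual[OF i_less]] fn_body[OF init_ident[OF i_less]]
      init_body[OF i_less]
    by (simp add: init_place_def)
  ultimately show ?thesis using valid by (simp add: at_place_def)
qed

definition init_config_subst :: "name \<rightharpoonup> name" where
  "init_config_subst = subst_of M\<^sub>s"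

lemma init_subst_marking: "subst_marking F NEW M\<^sub>s"
  using init_corresponds unfolding corresponds_def by blast

lemma mark_init_subst: "mark_subst init_config_subst = M\<^sub>s"
  unfolding init_config_subst_def by (rule mark_subst_subst_of[OF init_subst_marking])

lemma init_marking_eq: "init_marking N = mark_config init_place init_config_subst"
proof
  show "init_marking N p = mark_config init_place init_config_subst p" for p
    by (cases p) (simp_all add: fcp_net_def init_place_def mark_init_subst)
qed

lemma init_consistent: "consistent init_place init_config_subst"
proof -
  have "dom init_config_subst = dom \<sigma>"
    using corresponds_dom[of "set (restr F)" \<sigma>] init_corresponds by (simp add: mark_init_subst)
  then have dom: "dom init_config_subst = (\<Union>i < n_threads F. set (formals (init_ident F i)))"
    using is_unionD[OF init_union] dom_init_subst by (auto simp: dom_def set_eq_iff) blast+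
  have valid: "valid_subst init_config_subst"
    unfolding init_config_subst_def by (rule valid_subst_subst_of[OF init_subst_marking])
  have "init_place i \<in> cf_places F NEW i" for i by (simp add: cf_places_def init_place_def)
  then show ?thesis
    using init_at_place[OF _ valid dom] valid init_formals_thread
    unfolding consistent_def dom by blast
qed

lemma fcp_proc_scong: "fcp_proc F \<cong> config_proc init_place init_config_subst"
proof -
  let ?n = "n_threads F"
  have "fn (init_body F i) \<subseteq> dom (init_subst F i)" if "i < ?n" for i
    using that init_body fn_body[OF init_ident] dom_init_subst by simp
  then have "fcp_proc F \<cong> nu NEW (par_family ?n (\<lambda>i. subst_map init_config_subst (init_body F i)))"
    unfolding fcp_proc_def using init_corresponds
    by (intro res_list_corresponds[OF init_union]) (simp_all add: mark_init_subst)
  also have "par_family ?n (\<lambda>i. subst_map init_config_subst (init_body F i)) =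
      par_family ?n (\<lambda>i. place_proc init_config_subst (init_place i))"
    using place_proc_residual[OF init_residual] by (intro par_family_eq) (simp add: init_place_def)
  finally show ?thesis unfolding config_proc_def .
qed

lemma reachable_markings_consistent:
  assumes "M \<in> reachable_markings N"
  obtains s \<theta> where "M = mark_config s \<theta>" "consistent s \<theta>"
proof -
  have "(init_marking N, M) \<in> (net_steps N)\<^sup>*" using assms by (simp add: reachable_markings_def)
  then have "\<exists>s \<theta>. M = mark_config s \<theta> \<and> consistent s \<theta>"
  proof (induction rule: rtrancl_induct)
    case base
    then show ?case using init_consistent init_marking_eq by blast
  next
    case (step M M')
    then show ?case by (metis net_steps_config_step consistent_config_step)
  qed
  then show thesis using that by blast
qed

lemma reachable_markings_steps:
  "M \<in> reachable_markings N \<Longrightarrow> (M, M') \<in> (net_steps N)\<^sup>* \<Longrightarrow> M' \<in> reachable_markings N"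
  by (auto simp: reachable_markings_def)

lemma settled_subst_map_restrict:
  assumes "settled_place F NEW (S, l)"
  shows "subst_map (\<theta> |` active_names (S, l)) S = place_proc \<theta> (S, l)"
  using settled_active_names[OF assms] place_proc_settled[OF assms]
  by (auto intro!: subst_map_cong)

lemma settled_restrict_map:
  assumes settled: "settled_place F NEW (S, l)" and place: "at_place i (S, l) \<theta>"
  defines "\<sigma>' \<equiv> \<theta> |` active_names (S, l)"
  shows "dom \<sigma>' = fn S \<union> set l" "ran \<sigma>' \<subseteq> NEW \<union> PUB F"
proof -
  show "dom \<sigma>' = fn S \<union> set l"
    using settled_active_names[OF settled] at_place_active[OF place] by (auto simp: \<sigma>'_def)
  show "ran \<sigma>' \<subseteq> NEW \<union> PUB F"
    using valid_subst_range[OF at_place_valid_subst[OF place]]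
    by (auto simp: \<sigma>'_def ran_def restrict_map_def split: if_splits)
qed

lemma bisim_relI:
  assumes G_proc: "G \<in> reachable_procs F" "G \<cong> config_proc s \<theta>"
    and M_reachable: "mark_config s \<theta> \<in> reachable_markings N" and cons: "consistent s \<theta>"
    and settled: "\<And>i. i < n_threads F \<Longrightarrow> settled_place F NEW (s i)"
  shows "(scong_class G, mark_config s \<theta>) \<in> bisim_rel F NEW M\<^sub>s"
proof -
  let ?n = "n_threads F" and ?rs = "sorted_list_of_set NEW"
  define Ss where "Ss i = fst (s i)" for i
  define ls where "ls i = snd (s i)" for i
  define \<sigma>s where "\<sigma>s i = \<theta> |` active_names (s i)" for i
  have place: "s i = (Ss i, ls i)" for i by (simp add: Ss_def ls_def)
  have "par_family ?n (\<lambda>i. subst_map (\<sigma>s i) (Ss i)) = par_family ?n (\<lambda>i. place_proc \<theta> (s i))"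
    using settled_subst_map_restrict settled
    by (intro par_family_eq) (simp add: \<sigma>s_def place del: active_names.simps place_proc.simps)
  then have "G \<cong> res_list ?rs (par_family ?n (\<lambda>i. subst_map (\<sigma>s i) (Ss i)))"
    using G_proc(2) by (simp only: config_proc_def nu_def)
  moreover have "(is_choice (Ss i) \<or> is_call (Ss i)) \<and> derived F NEW (Ss i, ls i) \<and>
      dom (\<sigma>s i) = fn (Ss i) \<union> set (ls i) \<and> ran (\<sigma>s i) \<subseteq> set ?rs \<union> PUB F" if i_less: "i < ?n" for i
  proof -
    have "stable_place F (Ss i, ls i)" "derived F NEW (Ss i, ls i)"
      using settled[OF i_less] by (simp_all add: settled_place_def place)
    moreover from this(1) have "is_choice (Ss i) \<or> is_call (Ss i)" by (cases "Ss i") auto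
    ultimately show ?thesis
      using settled_restrict_map[of "Ss i" "ls i" i \<theta>] settled[OF i_less]
        consistent_at_place[OF cons i_less] by (simp add: \<sigma>s_def place)
  qed
  moreover have "dom \<theta> \<subseteq> (\<Union>i<?n. active_names (s i))"
    using cons unfolding consistent_def at_place_def by blast
  then have "is_union \<theta> ?n \<sigma>s" unfolding \<sigma>s_def by (rule is_union_restrict_map)
  moreover have "corresponds F NEW (set ?rs) \<theta> (\<lambda>q. mark_config s \<theta> (Sub q))"
    using corresponds_mark_subst[OF consistent_valid_subst[OF cons]] by simp
  moreover have "\<forall>i < ?n. mark_config s \<theta> (Ctl i (Ss i, ls i)) = 1" by (simp add: place)
  moreover have "\<forall>i < ?n. stable_place F (s i) \<and> mark_config s \<theta> (Ctl i (s i)) > 0"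
    using settled by (simp add: settled_place_def)
  then have "stable_marking F (mark_config s \<theta>)" unfolding stable_marking_def by blast
  moreover have "distinct ?rs" "set ?rs \<inter> PUB F = {}" using PUB_NEW_disjoint by auto
  ultimately show ?thesis unfolding bisim_rel_def using G_proc(1) M_reachable by blast
qed

lemma bisim_relE:
  assumes "(c, M) \<in> bisim_rel F NEW M\<^sub>s"
  obtains G s \<theta> where "c = scong_class G" "G \<in> reachable_procs F" "M = mark_config s \<theta>"
    "M \<in> reachable_markings N" "consistent s \<theta>"
    "\<And>i. i < n_threads F \<Longrightarrow> settled_place F NEW (s i)" "G \<cong> config_proc s \<theta>"
proof -
  let ?n = "n_threads F"
  from assms obtain G rs Ss ls \<sigma>s \<sigma>' where G_class: "c = scong_class G" "G \<in> reachable_procs F"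
    and M_reachable: "M \<in> reachable_markings N"
    and shape: "G \<cong> res_list rs (par_family ?n (\<lambda>i. subst_map (\<sigma>s i) (Ss i)))"
    and threads: "\<forall>i < ?n. (is_choice (Ss i) \<or> is_call (Ss i)) \<and> derived F NEW (Ss i, ls i) \<and>
           dom (\<sigma>s i) = fn (Ss i) \<union> set (ls i) \<and> ran (\<sigma>s i) \<subseteq> set rs \<union> PUB F"
    and union: "is_union \<sigma>' ?n \<sigma>s" and corr: "corresponds F NEW (set rs) \<sigma>' (\<lambda>q. M (Sub q))"
    and control: "\<forall>i < ?n. M (Ctl i (Ss i, ls i)) = 1"
    unfolding bisim_rel_def by blast
  from M_reachable obtain s \<theta> where config_s: "M = mark_config s \<theta>" "consistent s \<theta>"
    by (rule reachable_markings_consistent)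
  have place: "s i = (Ss i, ls i)" if "i < ?n" for i
  proof -
    have "mark_config s \<theta> (Ctl i (Ss i, ls i)) = 1" using control that config_s(1) by simp
    then show ?thesis by (simp only: mark_config.simps of_bool_eq_1_iff)
  qed
  have settled: "settled_place F NEW (s i)" if "i < ?n" for i
    using derived_settled threads that unfolding place[OF that] by blast
  have "res_list rs (par_family ?n (\<lambda>i. subst_map (\<sigma>s i) (Ss i))) \<cong>
      nu NEW (par_family ?n (\<lambda>i. subst_map \<theta> (Ss i)))"
    using corr threads by (intro res_list_corresponds[OF union]) (auto simp: config_s(1))
  also have "par_family ?n (\<lambda>i. subst_map \<theta> (Ss i)) = par_family ?n (\<lambda>i. place_proc \<theta> (s i))"
    using place_proc_settled settled place by (intro par_family_eq) simp
  finally have "G \<cong> config_proc s \<theta>" using shape scong.trans unfolding config_proc_def by blast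
  then show thesis using that G_class M_reachable config_s settled by blast
qed

lemma start_bisim_rel: "(scong_class (fcp_proc F), init_marking N) \<in> bisim_rel F NEW M\<^sub>s"
proof -
  have "fcp_proc F \<in> reachable_procs F" by (simp add: reachable_procs_def)
  moreover have "init_marking N \<in> reachable_markings N" by (simp add: reachable_markings_def)
  ultimately show ?thesis
    unfolding init_marking_eq by (intro bisim_relI fcp_proc_scong init_consistent init_settled)
qed

lemma housekeeping_config_proc:
  assumes "(mark_config s \<theta>, M') \<in> (housekeeping F NEW M\<^sub>s)\<^sup>*" and cons: "consistent s \<theta>"
  shows "\<exists>s' \<theta>'. M' = mark_config s' \<theta>' \<and> consistent s' \<theta>' \<and> config_proc s \<theta> \<cong> config_proc s' \<theta>'"
  using assms(1)
proof (induction rule: rtrancl_induct)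
  case base
  then show ?case using cons scong.refl by blast
next
  case (step M M')
  then obtain s' \<theta>' where IH: "M = mark_config s' \<theta>'" "consistent s' \<theta>'"
    "config_proc s \<theta> \<cong> config_proc s' \<theta>'" by blast
  from IH(2) step.hyps(2)[unfolded IH(1)] obtain i C q \<theta>'' where next_step: "i < n_threads F"
    "thread_step \<theta>' (s' i) LTau C q \<theta>''" "\<not> settled_place F NEW (s' i)"
    "M' = mark_config (s'(i := q)) \<theta>''" by (rule housekeeping_thread_step)
  have "config_proc s' \<theta>' \<cong> config_proc (s'(i := q)) \<theta>''"
    using config_proc_local_step[OF IH(2) next_step(1,2)] next_step(3)
    unfolding reacts_if_settled_def by blast
  then show ?case
    using next_step(4) consistent_thread_step[OF IH(2) next_step(1,2)] scong.trans[OF IH(3)]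
    by blast
qed

lemma full_bisim_relE:
  assumes "(c, M) \<in> full_bisim_rel F NEW M\<^sub>s"
  obtains G s \<theta> where "c = scong_class G" "G \<in> reachable_procs F" "M = mark_config s \<theta>"
    "M \<in> reachable_markings N" "consistent s \<theta>" "G \<cong> config_proc s \<theta>"
proof -
  from assms obtain M' where M_reachable: "M \<in> reachable_markings N"
    and housekeeping: "(M, M') \<in> (housekeeping F NEW M\<^sub>s)\<^sup>*"
    and M'_related: "(c, M') \<in> bisim_rel F NEW M\<^sub>s"
    unfolding full_bisim_rel_def by blast
  from M_reachable obtain s \<theta> where config_s: "M = mark_config s \<theta>" "consistent s \<theta>"
    by (rule reachable_markings_consistent)
  from housekeeping_config_proc[OF housekeeping[unfolded config_s(1)] config_s(2)]
  obtain s\<^sub>1 \<theta>\<^sub>1 where config_s\<^sub>1: "M' = mark_config s\<^sub>1 \<theta>\<^sub>1" "config_proc s \<theta> \<cong> config_proc s\<^sub>1 \<theta>\<^sub>1" by blast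
  from M'_related obtain G s\<^sub>2 \<theta>\<^sub>2 where G_class: "c = scong_class G" "G \<in> reachable_procs F"
    and config_s\<^sub>2: "M' = mark_config s\<^sub>2 \<theta>\<^sub>2" "G \<cong> config_proc s\<^sub>2 \<theta>\<^sub>2" by (rule bisim_relE)
  have "mark_config s\<^sub>1 \<theta>\<^sub>1 = mark_config s\<^sub>2 \<theta>\<^sub>2" using config_s\<^sub>1(1) config_s\<^sub>2(1) by simp
  then have "config_proc s\<^sub>1 \<theta>\<^sub>1 = config_proc s\<^sub>2 \<theta>\<^sub>2"
    using mark_config_inj_subst mark_config_inj_place config_proc_cong by metis
  then have "G \<cong> config_proc s \<theta>" using config_s\<^sub>1(2) config_s\<^sub>2(2) by (metis scong.sym scong.trans)
  then show thesis using that G_class config_s M_reachable by blast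
qed

lemma full_bisim_relI:
  assumes G_proc: "G \<in> reachable_procs F" "G \<cong> config_proc s \<theta>"
    and M_reachable: "mark_config s \<theta> \<in> reachable_markings N" and cons: "consistent s \<theta>"
  shows "(scong_class G, mark_config s \<theta>) \<in> full_bisim_rel F NEW M\<^sub>s"
proof -
  from housekeeping_settles[OF cons] obtain s' \<theta>' where
    housekeeping: "(mark_config s \<theta>, mark_config s' \<theta>') \<in> (housekeeping F NEW M\<^sub>s)\<^sup>*"
    and settled: "consistent s' \<theta>'" "\<forall>i < n_threads F. settled_place F NEW (s' i)"
      "config_proc s \<theta> \<cong> config_proc s' \<theta>'" by blast
  have "(mark_config s \<theta>, mark_config s' \<theta>') \<in> (net_steps N)\<^sup>*"
    using housekeeping rtrancl_mono[OF housekeeping_subset_net_steps] by blast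
  then have "mark_config s' \<theta>' \<in> reachable_markings N"
    using M_reachable reachable_markings_steps by blast
  moreover have "G \<cong> config_proc s' \<theta>'" using G_proc(2) settled(3) by (rule scong.trans)
  ultimately have "(scong_class G, mark_config s' \<theta>') \<in> bisim_rel F NEW M\<^sub>s"
    using G_proc(1) settled(1,2) by (intro bisim_relI) auto
  then show ?thesis using M_reachable housekeeping unfolding full_bisim_rel_def by blast
qed

lemma bisim_rel_subset_full: "bisim_rel F NEW M\<^sub>s \<subseteq> full_bisim_rel F NEW M\<^sub>s"
  unfolding full_bisim_rel_def bisim_rel_def by blast

lemma net_steps_tsys:
  assumes "M \<in> reachable_markings N" "(M, M') \<in> (net_steps N)\<^sup>*"
  shows "(M, M') \<in> (steps (net_tsys N))\<^sup>*"
  using assms(2)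
proof (induction rule: rtrancl_induct)
  case (step M' M'')
  then have "M' \<in> reachable_markings N" "M'' \<in> reachable_markings N"
    using assms(1) reachable_markings_steps by (meson rtrancl.rtrancl_into_rtrancl)+
  then have "(M', M'') \<in> steps (net_tsys N)" using step.hyps(2) by (simp add: net_tsys_def)
  with step.IH show ?case by (rule rtrancl.rtrancl_into_rtrancl)
qed simp

lemma net_simulates_fcp:
  assumes rel: "(c, M) \<in> full_bisim_rel F NEW M\<^sub>s" and step: "(c, c') \<in> steps (fcp_tsys F)"
  shows "\<exists>M'. (M, M') \<in> (steps (net_tsys N))\<^sup>* \<and> (c', M') \<in> full_bisim_rel F NEW M\<^sub>s"
proof -
  from rel obtain G s \<theta> where G_class: "c = scong_class G" "G \<cong> config_proc s \<theta>"
    and M_config: "M = mark_config s \<theta>" "M \<in> reachable_markings N" "consistent s \<theta>"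
    by (rule full_bisim_relE)
  from step obtain H G' where H_class: "c = scong_class H" "c' = scong_class G'"
    "G' \<in> reachable_procs F" "react (eqs F) H G'" by (auto simp: fcp_tsys_def)
  from housekeeping_settles[OF M_config(3)] obtain s\<^sub>1 \<theta>\<^sub>1 where
    housekeeping: "(M, mark_config s\<^sub>1 \<theta>\<^sub>1) \<in> (housekeeping F NEW M\<^sub>s)\<^sup>*" and cons\<^sub>1: "consistent s\<^sub>1 \<theta>\<^sub>1"
    and settled: "\<And>i. i < n_threads F \<Longrightarrow> settled_place F NEW (s\<^sub>1 i)"
    and same: "config_proc s \<theta> \<cong> config_proc s\<^sub>1 \<theta>\<^sub>1" unfolding M_config(1) by blast
  have "H \<cong> G" using G_class(1) H_class(1) scong_class_eq_iff by metis
  then have "H \<cong> config_proc s\<^sub>1 \<theta>\<^sub>1" using G_class(2) same by (blast intro: scong.trans)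
  from net_reaches_reaction[OF cons\<^sub>1 settled H_class(4) this] obtain s\<^sub>2 \<theta>\<^sub>2 where
    run: "(mark_config s\<^sub>1 \<theta>\<^sub>1, mark_config s\<^sub>2 \<theta>\<^sub>2) \<in> (net_steps N)\<^sup>*"
    and config_s\<^sub>2: "consistent s\<^sub>2 \<theta>\<^sub>2" "G' \<cong> config_proc s\<^sub>2 \<theta>\<^sub>2"
    unfolding net_reaches_def by blast
  have path: "(M, mark_config s\<^sub>2 \<theta>\<^sub>2) \<in> (net_steps N)\<^sup>*"
    using housekeeping rtrancl_mono[OF housekeeping_subset_net_steps] run
    by (meson rtrancl_trans subsetD)
  then have "(c', mark_config s\<^sub>2 \<theta>\<^sub>2) \<in> full_bisim_rel F NEW M\<^sub>s"
    unfolding H_class(2) using reachable_markings_steps[OF M_config(2) path] config_s\<^sub>2 H_class(3)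
    by (intro full_bisim_relI)
  then show ?thesis using net_steps_tsys[OF M_config(2) path] by blast
qed

lemma fcp_simulates_net:
  assumes rel: "(c, M) \<in> full_bisim_rel F NEW M\<^sub>s" and step: "(M, M') \<in> steps (net_tsys N)"
  shows "\<exists>c'. (c, c') \<in> (steps (fcp_tsys F))\<^sup>* \<and> (c', M') \<in> full_bisim_rel F NEW M\<^sub>s"
proof -
  from rel obtain G s \<theta> where G_class: "c = scong_class G" "G \<in> reachable_procs F"
    "G \<cong> config_proc s \<theta>"
    and M_config: "M = mark_config s \<theta>" and cons: "consistent s \<theta>" by (rule full_bisim_relE)
  from step have M'_step: "(mark_config s \<theta>, M') \<in> net_steps N" "M' \<in> reachable_markings N"
    by (auto simp: net_tsys_def M_config)
  from M'_step(1) cons obtain s' \<theta>' where config_s': "M' = mark_config s' \<theta>'"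
    and config: "config_step s \<theta> s' \<theta>'"
    by (rule net_steps_config_step)
  note cons' = consistent_config_step[OF config cons]
  let ?G = "config_proc s' \<theta>'"
  from config_proc_config_step[OF config cons]
  consider (same) "config_proc s \<theta> \<cong> ?G" | (reacts) "react (eqs F) (config_proc s \<theta>) ?G" by blast
  then show ?thesis
  proof cases
    case same
    then have "G \<cong> ?G" using G_class(3) by (blast intro: scong.trans)
    then have "(c, M') \<in> full_bisim_rel F NEW M\<^sub>s"
      using G_class(1,2) config_s' cons' M'_step(2) full_bisim_relI by blast
    then show ?thesis by blast
  next
    case reacts
    have react: "react (eqs F) G ?G" using G_class(3) reacts scong.refl by (rule react.struct)
    then have reachable: "?G \<in> reachable_procs F"
      using G_class(2) by (simp add: reachable_procs_def)
    then have "(c, scong_class ?G) \<in> steps (fcp_tsys F)"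
      using react G_class(1,2) by (auto simp: fcp_tsys_def)
    moreover have "(scong_class ?G, M') \<in> full_bisim_rel F NEW M\<^sub>s"
      using reachable config_s' cons' M'_step(2) full_bisim_relI scong.refl by blast
    ultimately show ?thesis by blast
  qed
qed

lemma full_bisim_rel_weak_bisimulation:
  "weak_bisimulation (fcp_tsys F) (net_tsys N) (full_bisim_rel F NEW M\<^sub>s)"
  unfolding weak_bisimulation_def
proof (intro conjI)
  show "full_bisim_rel F NEW M\<^sub>s \<subseteq> states (fcp_tsys F) \<times> states (net_tsys N)"
    by (auto simp: fcp_tsys_def net_tsys_def elim!: full_bisim_relE)
  show "(start (fcp_tsys F), start (net_tsys N)) \<in> full_bisim_rel F NEW M\<^sub>s"
    using start_bisim_rel bisim_rel_subset_full by (auto simp: fcp_tsys_def net_tsys_def)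
qed (use net_simulates_fcp fcp_simulates_net in blast)

lemma bisim_rel_settled_marking:
  assumes "(c, M) \<in> bisim_rel F NEW M\<^sub>s" shows "settled_marking F NEW M"
  using assms
proof (rule bisim_relE)
  fix G s \<theta> assume M_config: "M = mark_config s \<theta>"
    and settled: "\<And>i. i < n_threads F \<Longrightarrow> settled_place F NEW (s i)"
  have "settled_place F NEW (s i) \<and> M (Ctl i (s i)) > 0" if "i < n_threads F" for i
    using settled that M_config by simp
  then show ?thesis unfolding settled_marking_def by blast
qed

lemma full_bisim_rel_settled:
  "full_bisim_rel F NEW M\<^sub>s \<inter> {(c, M). settled_marking F NEW M} = bisim_rel F NEW M\<^sub>s"
proof
  show "full_bisim_rel F NEW M\<^sub>s \<inter> {(c, M). settled_marking F NEW M} \<subseteq> bisim_rel F NEW M\<^sub>s"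
  proof clarify
    fix c M assume rel: "(c, M) \<in> full_bisim_rel F NEW M\<^sub>s" and "settled_marking F NEW M"
    from rel obtain G s \<theta> where G_class: "c = scong_class G" "G \<in> reachable_procs F"
      "G \<cong> config_proc s \<theta>"
      and M_config: "M = mark_config s \<theta>" "M \<in> reachable_markings N" and cons: "consistent s \<theta>"
      by (rule full_bisim_relE)
    have "settled_place F NEW (s i)" if "i < n_threads F" for i
      using \<open>settled_marking F NEW M\<close> that
      unfolding settled_marking_def M_config(1) by (auto split: if_splits)
    then show "(c, M) \<in> bisim_rel F NEW M\<^sub>s"
      unfolding G_class(1) M_config(1) using G_class M_config cons by (intro bisim_relI) auto
  qed
  show "bisim_rel F NEW M\<^sub>s \<subseteq> full_bisim_rel F NEW M\<^sub>s \<inter> {(c, M). settled_marking F NEW M}"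
    using bisim_rel_subset_full bisim_rel_settled_marking by blast
qed

end

theorem theorem6p3:
  fixes F :: fcp and NEW :: "name set" and \<sigma> :: "name \<rightharpoonup> name" and M\<^sub>s :: "splace \<Rightarrow> nat"
  assumes "normal_form F"
    and "new_names F NEW"
    and "is_union \<sigma> (n_threads F) (init_subst F)"
    and "corresponds F NEW (set (restr F)) \<sigma> M\<^sub>s"
  shows "(start (fcp_tsys F), start (net_tsys (fcp_net F NEW M\<^sub>s))) \<in> bisim_rel F NEW M\<^sub>s \<and>
    weak_bisimulation (fcp_tsys F) (net_tsys (fcp_net F NEW M\<^sub>s)) (full_bisim_rel F NEW M\<^sub>s) \<and>
    full_bisim_rel F NEW M\<^sub>s \<inter> {(c, M). settled_marking F NEW M} = bisim_rel F NEW M\<^sub>s"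
proof -
  interpret fcp_translation F NEW M\<^sub>s \<sigma>
    by unfold_locales (fact assms)+
  have "(start (fcp_tsys F), start (net_tsys (fcp_net F NEW M\<^sub>s))) \<in> bisim_rel F NEW M\<^sub>s"
    using start_bisim_rel by (simp add: fcp_tsys_def net_tsys_def)
  then show ?thesis
    using full_bisim_rel_weak_bisimulation full_bisim_rel_settled by (intro conjI)
qed

end
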